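(* Let $n\in\mathbb{N}$, let $f\in\mathbb{R}[X_1,\dots,X_n]$ and suppose $f\ge 0$ on $V(\nabla f)\cap\mathbb{R}^n$. Then $f+\varepsilon$ is for all $\varepsilon>0$ a sum of squares modulo any principal ideal generated by a power of the polynomial $\|\nabla f\|^2(1+\|\bar X\|^2)$, i.e., for every $\varepsilon>0$ and $N\in\mathbb{N}$, there is a sum of squares $s$ in $\mathbb{R}[X_1,\dots,X_n]$ and a polynomial $p\in\mathbb{R}[X_1,\dots,X_n]$ such that $$f+\varepsilon=s+p\,\big(\|\nabla f\|^2(1+\|\bar X\|^2)\big)^N.$$ In particular, $f+\varepsilon$ is for all $\varepsilon>0$ a sum of squares modulo each power of its gradient ideal, i.e., for every $\varepsilon>0$ and $N\in\mathbb{N}$, there is a sum of squares $s$ in $\mathbb{R}[X_1,\dots,X_n]$ such that $$f+\varepsilon\in s+(\nabla f)^N.$$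
   Context: $\mathbb{N}=\{1,2,\dots\}$. Notation: $\|\bar X\|^2:=X_1^2+\dots+X_n^2$ and $\|\nabla f\|^2:=\sum_{i=1}^n\left(\frac{\partial f}{\partial X_i}\right)^2$, regarded as polynomials. The gradient variety of $f$ is $V(\nabla f):=\{x\in\mathbb{C}^n\mid\nabla f(x)=0\}$. The gradient ideal of $f$ is the ideal $(\nabla f):=\left(\frac{\partial f}{\partial X_1},\dots,\frac{\partial f}{\partial X_n}\right)$ of $\mathbb{R}[X_1,\dots,X_n]$, and $(\nabla f)^N$ is its $N$-th power. *)

theory Defs
  imports "HOL-Analysis.Finite_Cartesian_Product" "HOL-Library.Poly_Mapping" Complex_Main
begin

text \<open>
  The polynomial ring over the reals in \<open>n = CARD('n)\<close> indeterminates, indexed by a finite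
  (hence nonempty) type \<open>'n\<close>. A polynomial is a finitely supported map from exponent vectors
  to coefficients; the multiplication of \<^theory>\<open>HOL-Library.Poly_Mapping\<close> is convolution.
\<close>

type_synonym 'n rpoly = "('n \<Rightarrow>\<^sub>0 nat) \<Rightarrow>\<^sub>0 real"

definition Const :: "real \<Rightarrow> 'n rpoly" where
  "Const c = Poly_Mapping.single 0 c"

definition Var :: "'n \<Rightarrow> 'n rpoly" where
  "Var i = Poly_Mapping.single (Poly_Mapping.single i 1) 1"

text \<open>Evaluation at a point with coordinates in any commutative real algebra; it is used for
  real and for complex points.\<close>

definition eval_rpoly ::
    "'n::finite rpoly \<Rightarrow> 'a::{comm_ring_1, real_algebra_1} ^ 'n \<Rightarrow> 'a" where
  "eval_rpoly f x =
     (\<Sum>m\<in>Poly_Mapping.keys f.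
        Poly_Mapping.lookup f m *\<^sub>R (\<Prod>i\<in>UNIV. (x $ i) ^ Poly_Mapping.lookup m i))"

text \<open>If \<open>i\<close> does not occur in \<open>m\<close>, then the exponent subtraction below truncates, but the
  corresponding coefficient is \<open>0\<close>.\<close>

definition partial :: "'n \<Rightarrow> 'n rpoly \<Rightarrow> 'n rpoly" where
  "partial i f =
     (\<Sum>m\<in>Poly_Mapping.keys f.
        Poly_Mapping.single (m - Poly_Mapping.single i 1)
          (real (Poly_Mapping.lookup m i) * Poly_Mapping.lookup f m))"

definition norm_sq_vars :: "'n::finite rpoly" where
  "norm_sq_vars = (\<Sum>i\<in>UNIV. (Var i)\<^sup>2)"

definition norm_sq_grad :: "'n::finite rpoly \<Rightarrow> 'n rpoly" where
  "norm_sq_grad f = (\<Sum>i\<in>UNIV. (partial i f)\<^sup>2)"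

definition sum_of_squares :: "'n rpoly \<Rightarrow> bool" where
  "sum_of_squares s \<longleftrightarrow> (\<exists>qs. s = (\<Sum>q\<leftarrow>qs. q\<^sup>2))"

definition gradient_variety :: "'n::finite rpoly \<Rightarrow> (complex ^ 'n) set" where
  "gradient_variety f = {z. \<forall>i. eval_rpoly (partial i f) z = 0}"

definition complex_point :: "real ^ 'n \<Rightarrow> complex ^ 'n" where
  "complex_point x = (\<chi> i. complex_of_real (x $ i))"

text \<open>Ideals of a commutative ring are its submodules as a module over itself.\<close>

lemma module_times: "module ((*) :: 'a::comm_ring_1 \<Rightarrow> 'a \<Rightarrow> 'a)"
  by unfold_locales (simp_all add: algebra_simps)

definition ideal_gen :: "'a::comm_ring_1 set \<Rightarrow> 'a set" where
  "ideal_gen B = module.span (*) B"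

definition ideal_power :: "'a::comm_ring_1 set \<Rightarrow> nat \<Rightarrow> 'a set" where
  "ideal_power I N = ideal_gen {(\<Prod>k<N. g k) | g. \<forall>k<N. g k \<in> I}"

definition gradient_ideal :: "'n rpoly \<Rightarrow> 'n rpoly set" where
  "gradient_ideal f = ideal_gen (range (\<lambda>i. partial i f))"

end

theory Submission
  imports "HOL-Algebra.Algebraic_Closure_Type" "HOL-Computational_Algebra.Fraction_Field"
    "HOL-Computational_Algebra.Polynomial" Defs
begin

text \<open>
  Let \<open>g = \<parallel>\<nabla>f\<parallel>\<^sup>2 (1 + \<parallel>X\<parallel>\<^sup>2)\<close>. A real prime ideal \<open>J\<close> that contains \<open>g\<close> contains all partial
  derivatives of \<open>f\<close>, so every derivation over the reals of the residue field of \<open>J\<close> kills the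
  residue of \<open>f\<close>. Hence this residue is algebraic over the reals, and as the residue field is
  formally real it is a real number \<open>c\<close>. By the real Nullstellensatz \<open>g + (f - c)\<^sup>2 \<in> J\<close> has a real
  zero, which is a critical point of \<open>f\<close> with value \<open>c\<close>, so \<open>c \<ge> 0\<close>. Since every real prime ideal over
  \<open>g\<close> contains such a factor \<open>f - c\<close>, for some product \<open>H\<close> of them \<open>- H\<^sup>2\<close> is a sum of squares
  modulo \<open>g\<close>, and \<open>- H\<^bsup>2N\<^esup>\<close> is one modulo \<open>g\<^sup>N\<close>. Interpolating \<open>c \<mapsto> \<surd>(c + \<epsilon>/2)\<close> at the roots \<open>c\<close> by a
  univariate polynomial \<open>L\<close> gives \<open>f + \<epsilon> = L(f)\<^sup>2 + (\<epsilon>/2 + y)\<close> where \<open>H\<close> divides a power of \<open>y\<close>; a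
  \<open>y\<close> that is nilpotent in this sense becomes a sum of squares modulo \<open>g\<^sup>N\<close> after adding any
  positive constant.

  For the real Nullstellensatz, the residue field is embedded into a real closed field, built as the
  field of differences of a maximal cone in its algebraic closure, and the Cohen-Hoermander
  elimination of variables moves the generic zero of \<open>J\<close> to the reals.
\<close>

section \<open>Sums of squares\<close>

text \<open>Geometrically, \<open>f\<close> is constant on each connected component of its real
  critical set, and there are finitely many components. Derivations take the place of paths here,
  and finiteness is never proved as such: the values \<open>c\<close> are the finitely many factors
  of one certificate \<open>H\<^sup>2 + t = k * g\<close>, whose absence would let Zorn's lemma
  produce a real prime ideal over \<open>g\<close> that avoids all these factors. The residue field
  of a real prime is only formally real, so its polynomials need not satisfy the intermediate value
  theorem, on which sign tables rest. This is why a real closed field is put on top of it, and why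
  elimination compares signs in two different fields. Inside an algebraic closure \<open>- 1\<close>
  is a square, so a cone there can only be asked to contain the squares of differences of its own
  members. Maximality then yields both the total order on these differences and the intermediate
  value property, with no detour through square roots and odd degrees. The constant
  \<open>\<epsilon>\<close> is split in halves because it serves twice: one half makes the numbers
  under the roots positive, the other absorbs the nilpotent error of the interpolation.\<close>

inductive sos :: "'a::comm_ring_1 \<Rightarrow> bool" where
  zero: "sos 0"
| add_square: "sos s \<Longrightarrow> sos (a\<^sup>2 + s)"

lemma sos_square: "sos (a\<^sup>2)"
  using sos.add_square[OF sos.zero, of a] by simp

lemma sos_one: "sos 1"
  using sos_square[of 1] by simp

lemma sos_add: "sos s \<Longrightarrow> sos t \<Longrightarrow> sos (s + t)"
  by (induction rule: sos.induct) (auto simp: add.assoc intro: sos.intros)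

lemma sos_square_mult: "sos s \<Longrightarrow> sos (a\<^sup>2 * s)"
  by (induction rule: sos.induct)
    (auto simp: distrib_left simp flip: power_mult_distrib intro: sos.intros)

lemma sos_mult: "sos s \<Longrightarrow> sos t \<Longrightarrow> sos (s * t)"
  by (induction rule: sos.induct) (auto simp: distrib_right intro: sos.zero sos_add sos_square_mult)

lemma sos_sum: "(\<And>x. x \<in> A \<Longrightarrow> sos (f x)) \<Longrightarrow> sos (sum f A)"
  by (induction A rule: infinite_finite_induct) (auto intro: sos.zero sos_add)

lemma sos_iff_sum_list: "sos s \<longleftrightarrow> (\<exists>qs. s = (\<Sum>q\<leftarrow>qs. q * q))"
proof
  assume "sos s"
  then show "\<exists>qs. s = (\<Sum>q\<leftarrow>qs. q * q)"
  proof (induction rule: sos.induct)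
    case zero
    show ?case by (intro exI[of _ "[]"]) simp
  next
    case (add_square s a)
    then obtain qs where "s = (\<Sum>q\<leftarrow>qs. q * q)" by blast
    then show ?case by (intro exI[of _ "a # qs"]) (simp add: power2_eq_square)
  qed
next
  assume "\<exists>qs. s = (\<Sum>q\<leftarrow>qs. q * q)"
  then obtain qs where "s = (\<Sum>q\<leftarrow>qs. q * q)" by blast
  then show "sos s"
    by (induction qs arbitrary: s) (auto simp flip: power2_eq_square intro: sos.intros)
qed

lemma sum_of_squares_iff_sos: "sum_of_squares s \<longleftrightarrow> sos s"
  by (simp add: sum_of_squares_def sos_iff_sum_list power2_eq_square)

section \<open>Real prime ideals\<close>

definition is_ideal :: "'a::comm_ring_1 set \<Rightarrow> bool" where
  "is_ideal J \<longleftrightarrow> 0 \<in> J \<and> (\<forall>a\<in>J. \<forall>b\<in>J. a + b \<in> J) \<and> (\<forall>a\<in>J. \<forall>r. r * a \<in> J)"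

text \<open>The last clause makes the residue field formally real: clearing denominators in
  \<open>- 1 = s\<close> there would give \<open>a\<^sup>2 + t \<in> J\<close> with \<open>a\<close>
  outside \<open>J\<close>.\<close>

definition real_prime :: "'a::comm_ring_1 set \<Rightarrow> bool" where
  "real_prime J \<longleftrightarrow> is_ideal J \<and> 1 \<notin> J \<and> (\<forall>a b. a * b \<in> J \<longrightarrow> a \<in> J \<or> b \<in> J) \<and>
     (\<forall>a t. sos t \<longrightarrow> a\<^sup>2 + t \<in> J \<longrightarrow> a \<in> J)"

lemma ideal_add: "is_ideal J \<Longrightarrow> a \<in> J \<Longrightarrow> b \<in> J \<Longrightarrow> a + b \<in> J"
  and ideal_mult: "is_ideal J \<Longrightarrow> a \<in> J \<Longrightarrow> r * a \<in> J"
  and ideal_zero: "is_ideal J \<Longrightarrow> 0 \<in> J"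
  by (auto simp: is_ideal_def)

lemma ideal_minus: "is_ideal J \<Longrightarrow> a \<in> J \<Longrightarrow> - a \<in> J"
  using ideal_mult[of J a "-1"] by simp

lemma ideal_diff: "is_ideal J \<Longrightarrow> a \<in> J \<Longrightarrow> b \<in> J \<Longrightarrow> a - b \<in> J"
  using ideal_add[of J a "-b"] ideal_minus[of J b] by simp

lemma is_ideal_adjoin:
  assumes "is_ideal J"
  shows "is_ideal {j + c * a | j c. j \<in> J}"
  unfolding is_ideal_def
proof (intro conjI ballI allI)
  show "0 \<in> {j + c * a | j c. j \<in> J}"
    using ideal_zero[OF assms] by (auto intro!: exI[of _ 0])
next
  fix x y assume "x \<in> {j + c * a | j c. j \<in> J}" "y \<in> {j + c * a | j c. j \<in> J}"
  then obtain j c k d where "x = j + c * a" "y = k + d * a" "j \<in> J" "k \<in> J" by blast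
  then show "x + y \<in> {j + c * a | j c. j \<in> J}"
    using ideal_add[OF assms, of j k]
    by (intro CollectI exI[of _ "j + k"] exI[of _ "c + d"]) (simp add: algebra_simps)
next
  fix x r assume "x \<in> {j + c * a | j c. j \<in> J}"
  then obtain j c where "x = j + c * a" "j \<in> J" by blast
  then show "r * x \<in> {j + c * a | j c. j \<in> J}"
    using ideal_mult[OF assms, of j r]
    by (intro CollectI exI[of _ "r * j"] exI[of _ "r * c"]) (simp add: algebra_simps)
qed

text \<open>The prime ideal is a maximal element among the ideals that contain no \<open>s\<^sup>2 + t\<close>
  with \<open>s \<in> S\<close> and \<open>t\<close> a sum of squares.\<close>

lemma ex_real_prime:
  fixes I S :: "'a::comm_ring_1 set"
  assumes I: "is_ideal I" and one: "1 \<in> S" and mult: "\<And>a b. a \<in> S \<Longrightarrow> b \<in> S \<Longrightarrow> a * b \<in> S"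
    and disj: "\<And>s t. s \<in> S \<Longrightarrow> sos t \<Longrightarrow> s\<^sup>2 + t \<notin> I"
  shows "\<exists>J. real_prime J \<and> I \<subseteq> J \<and> J \<inter> S = {}"
proof -
  define F where "F = {J. is_ideal J \<and> I \<subseteq> J \<and> (\<forall>s\<in>S. \<forall>t. sos t \<longrightarrow> s\<^sup>2 + t \<notin> J)}"
  have "\<exists>M\<in>F. \<forall>Y\<in>F. M \<subseteq> Y \<longrightarrow> Y = M"
  proof (rule subset_Zorn_nonempty)
    show "F \<noteq> {}" using I disj by (auto simp: F_def)
    fix C assume C: "C \<noteq> {}" "subset.chain F C"
    then have CX: "J \<in> F" if "J \<in> C" for J using that by (auto simp: subset.chain_def)
    have "is_ideal (\<Union>C)" unfolding is_ideal_def
    proof (intro conjI ballI allI)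
      show "0 \<in> \<Union>C" using C(1) CX by (auto simp: F_def is_ideal_def)
    next
      fix a b assume "a \<in> \<Union>C" "b \<in> \<Union>C"
      then obtain J K where JK: "J \<in> C" "K \<in> C" "a \<in> J" "b \<in> K" by blast
      then have "J \<subseteq> K \<or> K \<subseteq> J" using C(2) by (auto simp: subset_chain_def)
      then show "a + b \<in> \<Union>C"
      proof
        assume "J \<subseteq> K"
        then have "a + b \<in> K" using JK CX[of K] by (auto simp: F_def intro: ideal_add)
        then show ?thesis using JK by blast
      next
        assume "K \<subseteq> J"
        then have "a + b \<in> J" using JK CX[of J] by (auto simp: F_def intro: ideal_add)
        then show ?thesis using JK by blast
      qed
    next
      fix a r assume "a \<in> \<Union>C"
      then show "r * a \<in> \<Union>C" using CX by (fastforce simp: F_def is_ideal_def)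
    qed
    then show "\<Union>C \<in> F" using C(1) CX by (auto simp: F_def)
  qed
  then obtain J where J: "J \<in> F" and max: "\<And>Y. Y \<in> F \<Longrightarrow> J \<subseteq> Y \<Longrightarrow> Y = J" by blast
  have Ji: "is_ideal J" and IJ: "I \<subseteq> J" and Jd: "\<And>s t. s \<in> S \<Longrightarrow> sos t \<Longrightarrow> s\<^sup>2 + t \<notin> J"
    using J by (auto simp: F_def)
  have ext: "\<exists>s t j c. s \<in> S \<and> sos t \<and> j \<in> J \<and> s\<^sup>2 + t = j + c * a" if "a \<notin> J" for a
  proof -
    let ?Y = "{j + c * a | j c. j \<in> J}"
    have "J \<subseteq> ?Y" by (force intro: exI[of _ 0])
    moreover have "a \<in> ?Y" using ideal_zero[OF Ji] by (intro CollectI exI[of _ 0] exI[of _ 1]) simp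
    ultimately have "?Y \<notin> F" using max[of ?Y] that by blast
    moreover have "is_ideal ?Y" by (rule is_ideal_adjoin[OF Ji])
    ultimately show ?thesis using IJ \<open>J \<subseteq> ?Y\<close> unfolding F_def by fast
  qed
  have "1 \<notin> J" using Jd[OF one sos.zero] by simp
  moreover have "a \<in> J \<or> b \<in> J" if ab: "a * b \<in> J" for a b
  proof (rule ccontr)
    assume "\<not> (a \<in> J \<or> b \<in> J)"
    then obtain s t j c s' t' j' c' where
      1: "s \<in> S" "sos t" "j \<in> J" "s\<^sup>2 + t = j + c * a" and
      2: "s' \<in> S" "sos t'" "j' \<in> J" "s'\<^sup>2 + t' = j' + c' * b"
      using ext[of a] ext[of b] by blast
    \<comment> \<open>The product of two elements of the shape \<open>s\<^sup>2 + t\<close> has this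
      shape again, with leading part \<open>s * s'\<close> in \<open>S\<close>; modulo
      \<open>J\<close> it is a multiple of \<open>a * b\<close>.\<close>
    have "(s * s')\<^sup>2 + (s\<^sup>2 * t' + (s'\<^sup>2 * t + t * t')) = (s\<^sup>2 + t) * (s'\<^sup>2 + t')"
      by (simp add: algebra_simps power2_eq_square)
    also have "\<dots> = (j' + c' * b) * j + (c * a * j' + c * c' * (a * b))"
      unfolding 1 2 by (simp add: algebra_simps)
    also have "\<dots> \<in> J" by (intro ideal_add[OF Ji] ideal_mult[OF Ji] 1 2 ab)
    finally show False
      using Jd[OF mult[OF 1(1) 2(1)], of "s\<^sup>2 * t' + (s'\<^sup>2 * t + t * t')"] 1 2
      by (auto intro: sos_add sos_square_mult sos_mult)
  qed
  moreover have "a \<in> J" if t: "sos u" and au: "a\<^sup>2 + u \<in> J" for a u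
  proof (rule ccontr)
    assume "a \<notin> J"
    then obtain s t j c where 1: "s \<in> S" "sos t" "j \<in> J" "s\<^sup>2 + t = j + c * a"
      using ext by blast
    \<comment> \<open>Modulo \<open>J\<close> the element \<open>s\<^sup>2 + t\<close> is
      \<open>c * a\<close>, so its square plus \<open>c\<^sup>2 * u\<close> is
      \<open>c\<^sup>2 * (a\<^sup>2 + u)\<close>, which lies in \<open>J\<close>.\<close>
    have "(s * s)\<^sup>2 + (s\<^sup>2 * t + (s\<^sup>2 * t + (t * t + c\<^sup>2 * u))) = (s\<^sup>2 + t)\<^sup>2 + c\<^sup>2 * u"
      by (simp add: algebra_simps power2_eq_square)
    also have "\<dots> = (j + 2 * c * a) * j + c\<^sup>2 * (a\<^sup>2 + u)"
      unfolding 1 by (simp add: algebra_simps power2_eq_square)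
    also have "\<dots> \<in> J" by (intro ideal_add[OF Ji] ideal_mult[OF Ji] 1 au)
    finally have "(s * s)\<^sup>2 + (s\<^sup>2 * t + (s\<^sup>2 * t + (t * t + c\<^sup>2 * u))) \<in> J" .
    moreover have "sos (s\<^sup>2 * t + (s\<^sup>2 * t + (t * t + c\<^sup>2 * u)))"
      by (intro sos_add sos_square_mult sos_mult 1 t)
    ultimately show False using Jd[OF mult[OF 1(1) 1(1)]] by blast
  qed
  ultimately have "real_prime J" using Ji by (auto simp: real_prime_def)
  moreover have "s \<notin> J" if "s \<in> S" for s
    using Jd[OF that sos.zero] ideal_mult[OF Ji, of s s] by (auto simp: power2_eq_square)
  ultimately show ?thesis using IJ by blast
qed

section \<open>Evaluation and partial derivatives\<close>

lemma rpoly_sum_single: "p = (\<Sum>m\<in>Poly_Mapping.keys p. Poly_Mapping.single m (Poly_Mapping.lookup p m))"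
  by (rule poly_mapping_eqI)
    (auto simp: lookup_sum lookup_single when_def sum.delta' in_keys_iff)

lemma rpoly_induct_single:
  assumes "\<And>m c. P (Poly_Mapping.single m c)" "\<And>p q. P p \<Longrightarrow> P q \<Longrightarrow> P (p + q)"
  shows "P (p :: 'a \<Rightarrow>\<^sub>0 'b::comm_monoid_add)"
proof -
  have "P 0" using assms(1)[of undefined 0] by simp
  then have "P (\<Sum>m\<in>M. Poly_Mapping.single m (f m))" for M f
    by (induction M rule: infinite_finite_induct) (auto intro: assms)
  then show ?thesis by (subst rpoly_sum_single) 
qed

text \<open>Induction on the total degree. The scheme suits maps known on constants and variables
  that are additive and either multiplicative or subject to the Leibniz rule.\<close>

lemma rpoly_induct [case_names Const mult_Var add]:
  fixes p :: "'n::finite rpoly"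
  assumes const: "\<And>c. P (Const c)" and var: "\<And>p i. P p \<Longrightarrow> P (p * Var i)"
    and add: "\<And>p q. P p \<Longrightarrow> P q \<Longrightarrow> P (p + q)"
  shows "P p"
proof (rule rpoly_induct_single[of P, OF _ add])
  fix m :: "'n \<Rightarrow>\<^sub>0 nat" and c
  show "P (Poly_Mapping.single m c)"
  proof (induction "\<Sum>i\<in>UNIV. Poly_Mapping.lookup m i" arbitrary: m)
    case 0
    then have "m = 0" by (intro poly_mapping_eqI) simp
    then show ?case using const[of c] by (simp add: Const_def)
  next
    case (Suc k)
    then obtain i where i: "Poly_Mapping.lookup m i > 0"
      by (metis gr0I sum.neutral nat.distinct(1))
    define m' where "m' = m - Poly_Mapping.single i 1"
    have m: "m = m' + Poly_Mapping.single i 1"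
      using i by (intro poly_mapping_eqI) (auto simp: m'_def lookup_add lookup_minus lookup_single when_def)
    have "(\<Sum>j\<in>UNIV. Poly_Mapping.lookup m j) = (\<Sum>j\<in>UNIV. Poly_Mapping.lookup m' j) + 1"
      by (simp add: m lookup_add sum.distrib lookup_single when_def)
    then have "P (Poly_Mapping.single m' c)" using Suc by auto
    from var[OF this, of i] show ?case by (simp add: m Var_def mult_single)
  qed
qed

lemma eval_rpoly_superset:
  assumes "finite M" "Poly_Mapping.keys f \<subseteq> M"
  shows "eval_rpoly f x = (\<Sum>m\<in>M. Poly_Mapping.lookup f m *\<^sub>R (\<Prod>i\<in>UNIV. (x $ i) ^ Poly_Mapping.lookup m i))"
  unfolding eval_rpoly_def using assms by (intro sum.mono_neutral_left) (auto simp: in_keys_iff)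

lemma eval_rpoly_add: "eval_rpoly (f + g) x = eval_rpoly f x + eval_rpoly g x"
  using keys_add[of f g]
  by (simp add: eval_rpoly_superset[of "Poly_Mapping.keys f \<union> Poly_Mapping.keys g"] lookup_add
      scaleR_left_distrib sum.distrib)

lemma eval_rpoly_single:
  "eval_rpoly (Poly_Mapping.single m c) x = c *\<^sub>R (\<Prod>i\<in>UNIV. (x $ i) ^ Poly_Mapping.lookup m i)"
  by (subst eval_rpoly_superset[of "{m}"]) auto

lemma eval_rpoly_mult: "eval_rpoly (f * g) x = eval_rpoly f x * eval_rpoly g x"
proof (induction f rule: rpoly_induct_single)
  fix m c
  show "eval_rpoly (Poly_Mapping.single m c * g) x = eval_rpoly (Poly_Mapping.single m c) x * eval_rpoly g x"
    by (induction g rule: rpoly_induct_single)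
      (auto simp: mult_single eval_rpoly_single lookup_add power_add prod.distrib
        distrib_left eval_rpoly_add)
qed (auto simp: distrib_right eval_rpoly_add)

lemma eval_rpoly_Const: "eval_rpoly (Const c) x = of_real c"
  by (simp add: Const_def eval_rpoly_single of_real_def)

lemma eval_rpoly_Var: "eval_rpoly (Var j) x = x $ j"
proof -
  have "(\<Prod>i\<in>UNIV. x $ i ^ Poly_Mapping.lookup (Poly_Mapping.single j 1) i) =
      (\<Prod>i\<in>UNIV. if i = j then x $ i else 1)"
    by (intro prod.cong) (auto simp: lookup_single)
  then show ?thesis by (simp add: Var_def eval_rpoly_single)
qed

lemma Const_0: "Const 0 = 0" and Const_1: "Const 1 = 1"
  and Const_add: "Const (a + b) = Const a + Const b"
  and Const_mult: "Const (a * b) = Const a * Const b"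
  and Const_minus: "Const (- a) = - Const a"
  by (simp_all add: Const_def single_add single_uminus mult_single)

lemma Const_power: "Const (a ^ k) = Const a ^ k"
  by (induction k) (simp_all add: Const_1 Const_mult)

lemma eval_rpoly_1: "eval_rpoly 1 x = 1"
  using eval_rpoly_Const[of 1 x] by (simp add: Const_1)

lemma eval_rpoly_0: "eval_rpoly 0 x = 0"
  using eval_rpoly_Const[of 0 x] by (simp add: Const_0)

lemma eval_rpoly_minus: "eval_rpoly (- f) x = - eval_rpoly f x"
  using eval_rpoly_add[of f "-f" x] by (simp add: eval_rpoly_0 eq_neg_iff_add_eq_0 add.commute)

lemma eval_rpoly_diff: "eval_rpoly (f - g) x = eval_rpoly f x - eval_rpoly g x"
  using eval_rpoly_add[of f "- g" x] by (simp add: eval_rpoly_minus)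

lemma eval_rpoly_power: "eval_rpoly (f ^ k) x = eval_rpoly f x ^ k"
  by (induction k) (simp_all add: eval_rpoly_1 eval_rpoly_mult)

lemma eval_rpoly_sum: "eval_rpoly (\<Sum>a\<in>A. f a) x = (\<Sum>a\<in>A. eval_rpoly (f a) x)"
  by (induction A rule: infinite_finite_induct) (simp_all add: eval_rpoly_0 eval_rpoly_add)

lemmas eval_rpoly_simps = eval_rpoly_0 eval_rpoly_1 eval_rpoly_add eval_rpoly_mult eval_rpoly_minus
  eval_rpoly_diff eval_rpoly_power eval_rpoly_sum eval_rpoly_Const eval_rpoly_Var

lemma eval_rpoly_complex_point: "eval_rpoly f (complex_point x) = complex_of_real (eval_rpoly f x)"
  by (induction f rule: rpoly_induct) (auto simp: eval_rpoly_simps complex_point_def)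

section \<open>Rules for formal partial derivatives\<close>

lemma partial_superset:
  assumes "finite M" "Poly_Mapping.keys f \<subseteq> M"
  shows "partial i f = (\<Sum>m\<in>M. Poly_Mapping.single (m - Poly_Mapping.single i 1)
    (real (Poly_Mapping.lookup m i) * Poly_Mapping.lookup f m))"
  unfolding partial_def using assms by (intro sum.mono_neutral_left) (auto simp: in_keys_iff)

lemma partial_add: "partial i (f + g) = partial i f + partial i g"
  using keys_add[of f g]
  by (simp add: partial_superset[of "Poly_Mapping.keys f \<union> Poly_Mapping.keys g"] lookup_add
      distrib_left single_add sum.distrib)

lemma partial_single:
  "partial i (Poly_Mapping.single m c) =
    Poly_Mapping.single (m - Poly_Mapping.single i 1) (real (Poly_Mapping.lookup m i) * c)"
  by (subst partial_superset[of "{m}"]) auto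

lemma partial_Const: "partial i (Const c) = 0"
  by (simp add: Const_def partial_single)

lemma partial_mult_Var:
  "partial i (p * Var j) = partial i p * Var j + (if i = j then p else 0)"
proof (induction p rule: rpoly_induct_single)
  fix m :: "'a \<Rightarrow>\<^sub>0 nat" and c :: real
  let ?e = "\<lambda>i. Poly_Mapping.single i (1::nat)"
  show "partial i (Poly_Mapping.single m c * Var j) =
      partial i (Poly_Mapping.single m c) * Var j + (if i = j then Poly_Mapping.single m c else 0)"
  proof (cases "i = j")
    case True
    have "m - ?e j + ?e j = m" if "Poly_Mapping.lookup m j \<noteq> 0"
      using that by (intro poly_mapping_eqI) (auto simp: lookup_add lookup_minus lookup_single when_def)
    moreover have "m + ?e j - ?e j = m" by simp
    ultimately show ?thesis using True
      by (cases "Poly_Mapping.lookup m j = 0")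
        (auto simp: Var_def mult_single partial_single lookup_add distrib_right add.commute[of c] simp flip: single_add)
  next
    case False
    have "m + ?e j - ?e i = m - ?e i + ?e j"
      using False by (intro poly_mapping_eqI) (auto simp: lookup_add lookup_minus lookup_single when_def)
    then show ?thesis using False
      by (simp add: Var_def mult_single partial_single lookup_add lookup_single)
  qed
qed (auto simp: distrib_right partial_add)

section \<open>Real closed fields\<close>

text \<open>The intermediate value property for polynomials serves as the definition; a coefficient
  function with a degree bound expresses it by the field operations alone.\<close>

class real_closed_field = linordered_field +
  assumes real_closed: "a < b \<Longrightarrow> (\<Sum>k\<le>n. f k * a ^ k) < 0 \<Longrightarrow> 0 < (\<Sum>k\<le>n. f k * b ^ k) \<Longrightarrow>
    \<exists>x. a < x \<and> x < b \<and> (\<Sum>k\<le>n. f k * x ^ k) = 0"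


instance real :: real_closed_field
proof
  fix a b :: real and f n
  assume ab: "a < b" "(\<Sum>k\<le>n. f k * a ^ k) < 0" "0 < (\<Sum>k\<le>n. f k * b ^ k)"
  have "poly (\<Sum>k\<le>n. monom (f k) k) x = (\<Sum>k\<le>n. f k * x ^ k)" for x
    by (simp add: poly_sum poly_monom)
  then show "\<exists>x. a < x \<and> x < b \<and> (\<Sum>k\<le>n. f k * x ^ k) = 0"
    using poly_IVT_pos[OF ab(1), of "\<Sum>k\<le>n. monom (f k) k"] ab by simp
qed

section \<open>Rolle's theorem and signs of polynomials over a real closed field\<close>

lemma poly_IVT_rcf:
  fixes p :: "'a::real_closed_field poly"
  assumes "a < b" "poly p a * poly p b < 0"
  shows "\<exists>x. a < x \<and> x < b \<and> poly p x = 0"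
proof -
  have *: "\<exists>x. a < x \<and> x < b \<and> poly q x = 0" if "poly q a < 0" "0 < poly q b" for q :: "'a poly"
    using real_closed[of a b "coeff q" "degree q"] that assms(1) by (simp add: poly_altdef)
  show ?thesis
    using assms(2) *[of p] *[of "-p"] by (auto simp: mult_less_0_iff)
qed

text \<open>The values are integers so that signs in two different ordered fields can be
  equated.\<close>

definition sg :: "'a::linordered_idom \<Rightarrow> int" where
  "sg x = (if x = 0 then 0 else if 0 < x then 1 else -1)"

lemma sg_eq_0_iff [simp]: "sg x = 0 \<longleftrightarrow> x = 0"
  by (simp add: sg_def)

lemma sg_0 [simp]: "sg 0 = 0"
  by (simp add: sg_def)

lemma sg_eq_iff: "sg x = sg y \<longleftrightarrow> (x < 0 \<longleftrightarrow> y < 0) \<and> (0 < x \<longleftrightarrow> 0 < y)"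
  by (auto simp: sg_def)

lemma sg_mult: "sg (x * y) = sg x * sg y"
  by (auto simp: sg_def zero_less_mult_iff)

lemma sg_power: "sg (x ^ n) = sg x ^ n"
  by (induction n) (auto simp: sg_mult, simp add: sg_def)

lemma sg_eq_if_close: "\<bar>x - y\<bar> < \<bar>y\<bar> \<Longrightarrow> sg x = sg y"
  by (simp add: sg_def) linarith

lemma sg_poly_const:
  fixes p :: "'a::real_closed_field poly"
  assumes "a \<le> b" "\<And>x. a \<le> x \<Longrightarrow> x \<le> b \<Longrightarrow> poly p x \<noteq> 0"
  shows "sg (poly p a) = sg (poly p b)"
proof (rule ccontr)
  assume ne: "sg (poly p a) \<noteq> sg (poly p b)"
  moreover have "poly p a \<noteq> 0" "poly p b \<noteq> 0" "a < b"
    using assms ne by (auto simp: order.strict_iff_order)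
  ultimately have "poly p a * poly p b < 0"
    by (auto simp: sg_def mult_less_0_iff not_less split: if_splits)
  then show False using poly_IVT_rcf[OF \<open>a < b\<close>] assms(2) by (meson less_imp_le)
qed

text \<open>An algebraic proof that needs no extremum. Splitting off all factors at \<open>a\<close>
  and \<open>b\<close> leaves \<open>r\<close> without roots on the closed interval, hence of
  constant sign. The derivative is \<open>A ^ m * (B ^ n * s)\<close>, and at \<open>a\<close> and
  \<open>b\<close> only one term of \<open>s\<close> survives, with the factor \<open>a - b\<close>
  and \<open>b - a\<close> respectively; so \<open>s\<close> changes sign.\<close>

lemma poly_Rolle_consecutive:
  fixes p :: "'a::real_closed_field poly"
  assumes ab: "a < b" and pa: "poly p a = 0" and pb: "poly p b = 0" and p: "p \<noteq> 0"
    and no: "\<And>x. a < x \<Longrightarrow> x < b \<Longrightarrow> poly p x \<noteq> 0"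
  shows "\<exists>x. a < x \<and> x < b \<and> poly (pderiv p) x = 0"
proof -
  obtain q where q: "p = [:-a,1:] ^ order a p * q" "\<not> [:-a,1:] dvd q"
    using order_decomp[OF p] by blast
  then have q0: "q \<noteq> 0" by auto
  obtain r where r: "q = [:-b,1:] ^ order b q * r" "\<not> [:-b,1:] dvd r"
    using order_decomp[OF q0] by blast
  have "poly q a \<noteq> 0" using q(2) by (simp add: poly_eq_0_iff_dvd)
  then have ra: "poly r a \<noteq> 0" using arg_cong[OF r(1), of "\<lambda>q. poly q a"] by auto
  have rb: "poly r b \<noteq> 0" using r(2) by (simp add: poly_eq_0_iff_dvd)
  have qb: "poly q b = 0" using arg_cong[OF q(1), of "\<lambda>q. poly q b"] pb ab by auto
  obtain m where m: "order a p = Suc m" using p pa order_root[of p a] by (auto simp: gr0_conv_Suc neq0_conv)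
  obtain n where n: "order b q = Suc n" using q0 qb order_root[of q b] by (auto simp: gr0_conv_Suc neq0_conv)
  have p_eq: "p = [:-a,1:] ^ Suc m * ([:-b,1:] ^ Suc n * r)"
    using q(1) r(1) m n by metis
  have "poly r x \<noteq> 0" if "a \<le> x" "x \<le> b" for x
  proof (cases "x = a \<or> x = b")
    case False
    then have "poly p x \<noteq> 0" using that no by auto
    then show ?thesis by (auto simp: p_eq)
  qed (use ra rb in auto)
  then have sgr: "sg (poly r a) = sg (poly r b)" using ab by (intro sg_poly_const) auto
  define A B where "A = [:-a,1:]" and "B = [:-b,1:]"
  define s where "s = smult (of_nat (Suc m)) (B * r) + smult (of_nat (Suc n)) (A * r) + A * (B * pderiv r)"
  have "pderiv A = 1" "pderiv B = 1" by (simp_all add: A_def B_def pderiv_pCons)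
  then have dp: "pderiv p = A ^ m * (B ^ n * s)"
    unfolding p_eq pderiv_mult pderiv_power_Suc s_def A_def[symmetric] B_def[symmetric]
    by (simp add: algebra_simps smult_add_right)
  have sa: "poly s a = of_nat (Suc m) * (a - b) * poly r a"
    and sb: "poly s b = of_nat (Suc n) * (b - a) * poly r b"
    by (simp_all add: s_def A_def B_def algebra_simps)
  have "sg (of_nat (Suc k) :: 'a) = 1" for k by (simp add: sg_def del: of_nat_Suc)
  then have "sg (poly s a) = - sg (poly r a)" "sg (poly s b) = sg (poly r b)"
    using ab by (simp_all add: sa sb sg_mult del: of_nat_Suc) (auto simp: sg_def)
  then have "poly s a * poly s b < 0"
    using sgr ra rb by (auto simp: sg_def mult_less_0_iff split: if_splits)
  from poly_IVT_rcf[OF ab this] show ?thesis by (auto simp: dp)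
qed

lemma poly_Rolle_rcf:
  fixes p :: "'a::real_closed_field poly"
  assumes ab: "a < b" and pa: "poly p a = 0" and pb: "poly p b = 0" and p: "p \<noteq> 0"
  shows "\<exists>x. a < x \<and> x < b \<and> poly (pderiv p) x = 0"
proof -
  let ?R = "{x. poly p x = 0 \<and> a < x \<and> x \<le> b}"
  have fin: "finite ?R" using poly_roots_finite[OF p] by (rule rev_finite_subset) auto
  have "b \<in> ?R" using ab pb by auto
  define c where "c = Min ?R"
  have c: "c \<in> ?R" unfolding c_def using fin \<open>b \<in> ?R\<close> by (intro Min_in) auto
  have "poly p x \<noteq> 0" if "a < x" "x < c" for x
    using Min_le[OF fin, of x] that c by (force simp flip: c_def)
  with poly_Rolle_consecutive[of a c p] c p pa show ?thesis by force
qed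

lemma sg_poly_at_top:
  fixes p :: "'a::linordered_field poly"
  shows "\<exists>M. \<forall>x\<ge>M. sg (poly p x) = sg (lead_coeff p)"
proof (cases "p = 0")
  case False
  define n where "n = degree p"
  define K where "K = (\<Sum>i<n. \<bar>coeff p i\<bar>)"
  have lc: "lead_coeff p \<noteq> 0" using False by simp
  show ?thesis
  \<comment> \<open>Beyond this bound \<open>x \<ge> 1\<close>, and the leading term exceeds
    \<open>K * x ^ (n - 1)\<close>, which dominates the sum of all lower terms.\<close>
  proof (intro exI[of _ "1 + K / \<bar>lead_coeff p\<bar>"] allI impI)
    fix x assume x: "1 + K / \<bar>lead_coeff p\<bar> \<le> x"
    have "K \<ge> 0" by (simp add: K_def sum_nonneg)
    then have x1: "1 \<le> x" using x lc by (meson abs_ge_zero divide_nonneg_nonneg le_add_same_cancel1 order_trans)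
    have "K / \<bar>lead_coeff p\<bar> < x" using x by linarith
    then have xK: "K < \<bar>lead_coeff p\<bar> * x" using lc by (simp add: divide_less_eq mult.commute)
    have px: "poly p x = (\<Sum>i<n. coeff p i * x ^ i) + lead_coeff p * x ^ n"
      unfolding poly_altdef n_def by (simp add: lessThan_Suc_atMost[symmetric])
    show "sg (poly p x) = sg (lead_coeff p)"
    proof (cases n)
      case 0
      then show ?thesis using px by simp
    next
      case (Suc k)
      have "\<bar>\<Sum>i<n. coeff p i * x ^ i\<bar> \<le> (\<Sum>i<n. \<bar>coeff p i\<bar> * x ^ k)"
        using x1 Suc by (intro order_trans[OF sum_abs] sum_mono)
          (auto simp: abs_mult intro!: mult_left_mono power_increasing)
      also have "\<dots> = K * x ^ k" by (simp add: K_def sum_distrib_right)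
      also have "\<dots> < \<bar>lead_coeff p\<bar> * x * x ^ k"
        using xK x1 by (intro mult_strict_right_mono) auto
      also have "\<dots> = \<bar>lead_coeff p * x ^ n\<bar>" using x1 by (simp add: Suc abs_mult)
      finally have "\<bar>poly p x - lead_coeff p * x ^ n\<bar> < \<bar>lead_coeff p * x ^ n\<bar>" by (simp add: px)
      then have "sg (poly p x) = sg (lead_coeff p * x ^ n)"
        by (rule sg_eq_if_close)
      also have "\<dots> = sg (lead_coeff p)"
      proof -
        have "0 < x ^ n" using x1 by simp
        then have "sg (x ^ n) = 1" unfolding sg_def by (metis less_irrefl)
        then show ?thesis by (simp only: sg_mult mult_1_right)
      qed
      finally show ?thesis .
    qed
  qed
qed simp

lemma sg_poly_at_bot:
  fixes p :: "'a::linordered_field poly"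
  shows "\<exists>M. \<forall>x\<le>M. sg (poly p x) = (-1) ^ degree p * sg (lead_coeff p)"
proof -
  obtain M where M: "\<And>x. x \<ge> M \<Longrightarrow> sg (poly (p \<circ>\<^sub>p [:0,-1:]) x) = sg (lead_coeff (p \<circ>\<^sub>p [:0,-1:]))"
    using sg_poly_at_top[of "p \<circ>\<^sub>p [:0,-1:]"] by blast
  have "lead_coeff (p \<circ>\<^sub>p [:0,-1:]) = lead_coeff p * (-1) ^ degree p"
    by (subst lead_coeff_comp) auto
  moreover have "sg ((-1) ^ k :: 'a) = (-1) ^ k" for k
    by (simp add: sg_power) (simp add: sg_def)
  ultimately have "sg (poly p x) = (-1) ^ degree p * sg (lead_coeff p)" if "x \<le> - M" for x
    using M[of "-x"] that by (simp add: poly_pcompose sg_mult mult.commute)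
  then show ?thesis by blast
qed

section \<open>Sign tables\<close>

text \<open>The graph of an order isomorphism between finite sets of points in two ordered fields;
  the points are meant to include the roots of the polynomials that are compared.\<close>

definition matching :: "('a::linordered_idom \<times> 'b::linordered_idom) set \<Rightarrow> bool" where
  "matching Z \<longleftrightarrow> finite Z \<and> (\<forall>(x,y)\<in>Z. \<forall>(x',y')\<in>Z. x < x' \<longleftrightarrow> y < y')"

text \<open>The points of \<open>Z\<close> cut each line into points and open intervals;
  \<open>u\<close> and \<open>v\<close> lie in corresponding pieces.\<close>

definition same_cell :: "('a::linordered_idom \<times> 'b::linordered_idom) set \<Rightarrow> 'a \<Rightarrow> 'b \<Rightarrow> bool" where
  "same_cell Z u v \<longleftrightarrow> (\<forall>(x,y)\<in>Z. sg (u - x) = sg (v - y))"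

text \<open>A table without a list of sign vectors. Points of \<open>Z\<close> need not be roots, so
  a table survives every enlargement of \<open>Z\<close>.\<close>

definition sign_table ::
    "('a::linordered_idom \<times> 'b::linordered_idom) set \<Rightarrow> 'a poly \<Rightarrow> 'b poly \<Rightarrow> bool" where
  "sign_table Z p q \<longleftrightarrow> (\<forall>u v. same_cell Z u v \<longrightarrow> sg (poly p u) = sg (poly q v))"

lemma same_cell_iff: "same_cell Z u v \<longleftrightarrow> (\<forall>(x,y)\<in>Z. (u < x \<longleftrightarrow> v < y) \<and> (x < u \<longleftrightarrow> y < v))"
  by (simp add: same_cell_def sg_eq_iff)

lemma matching_less: "matching Z \<Longrightarrow> (x,y) \<in> Z \<Longrightarrow> (x',y') \<in> Z \<Longrightarrow> x < x' \<longleftrightarrow> y < y'"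
  unfolding matching_def by fast

lemma matching_eq: "matching Z \<Longrightarrow> (x,y) \<in> Z \<Longrightarrow> (x',y') \<in> Z \<Longrightarrow> x = x' \<longleftrightarrow> y = y'"
  using matching_less[of Z x y x' y'] matching_less[of Z x' y' x y] by (meson linorder_neqE order.irrefl)

lemma matching_converse: "matching Z \<Longrightarrow> matching (Z\<inverse>)"
  unfolding matching_def by auto

lemma same_cell_converse: "same_cell (Z\<inverse>) v u \<longleftrightarrow> same_cell Z u v"
  by (auto simp: same_cell_def Ball_def)

lemma sign_table_converse: "sign_table (Z\<inverse>) q p \<longleftrightarrow> sign_table Z p q"
  unfolding sign_table_def same_cell_converse by metis

lemma same_cell_mono: "same_cell Z u v \<Longrightarrow> W \<subseteq> Z \<Longrightarrow> same_cell W u v"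
  by (auto simp: same_cell_def)

lemma sign_table_mono: "sign_table W p q \<Longrightarrow> W \<subseteq> Z \<Longrightarrow> sign_table Z p q"
  unfolding sign_table_def using same_cell_mono by blast

lemma matching_same_cell: "matching Z \<Longrightarrow> (x,y) \<in> Z \<Longrightarrow> same_cell Z x y"
  unfolding same_cell_iff using matching_less by blast

lemma same_cell_point: "same_cell Z x v \<Longrightarrow> (x,y) \<in> Z \<Longrightarrow> v = y"
  unfolding same_cell_iff by force

text \<open>An ordered field is dense and unbounded, and the partners of the points below
  \<open>u\<close> lie below the partners of those above \<open>u\<close>, so there is room for
  \<open>v\<close>.\<close>

lemma ex_same_cell:
  fixes Z :: "('a::linordered_field \<times> 'b::linordered_field) set"
  assumes Z: "matching Z"
  shows "\<exists>v. same_cell Z u v"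
proof (cases "u \<in> fst ` Z")
  case True
  then show ?thesis using matching_same_cell[OF Z] by force
next
  case False
  define L where "L = {y. \<exists>x. (x,y) \<in> Z \<and> x < u}"
  define U where "U = {y. \<exists>x. (x,y) \<in> Z \<and> u < x}"
  have fin: "finite Z" using Z by (simp add: matching_def)
  have "L \<subseteq> snd ` Z" "U \<subseteq> snd ` Z" by (force simp: L_def U_def)+
  then have finL: "finite L" and finU: "finite U" using fin by (meson finite_imageI finite_subset)+
  have LU: "y < y'" if "y \<in> L" "y' \<in> U" for y y'
    using that matching_less[OF Z] by (auto simp: L_def U_def) (meson order.strict_trans)
  have "\<exists>v. (\<forall>y\<in>L. y < v) \<and> (\<forall>y\<in>U. v < y)"
  proof (cases "L = {}")
    case True
    have "Min U - 1 < y" if "y \<in> U" for y using Min_le[OF finU that] by simp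
    then show ?thesis using True by blast
  next
    case L: False
    show ?thesis
    proof (cases "U = {}")
      case True
      have "y < Max L + 1" if "y \<in> L" for y using Max_ge[OF finL that] by simp
      then show ?thesis using True by blast
    next
      case False
      have "Max L < Min U" using LU L False finL finU by simp
      then obtain v where "Max L < v" "v < Min U" using dense by blast
      then show ?thesis using Max_ge[OF finL] Min_le[OF finU] by (meson le_less_trans less_le_trans)
    qed
  qed
  then obtain v where v: "\<And>y. y \<in> L \<Longrightarrow> y < v" "\<And>y. y \<in> U \<Longrightarrow> v < y" by blast
  have "same_cell Z u v" unfolding same_cell_iff
  proof (clarify)
    fix x y assume xy: "(x,y) \<in> Z"
    with False have "x \<noteq> u" by force
    then consider "x < u" "y \<in> L" | "u < x" "y \<in> U" using xy by (force simp: L_def U_def)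
    then show "(u < x \<longleftrightarrow> v < y) \<and> (x < u \<longleftrightarrow> y < v)"
      using v by cases force+
  qed
  then show ?thesis by blast
qed

lemma ex_same_cell':
  fixes Z :: "('a::linordered_field \<times> 'b::linordered_field) set"
  assumes "matching Z"
  shows "\<exists>u. same_cell Z u v"
  using ex_same_cell[OF matching_converse[OF assms], of v] same_cell_converse by blast

lemma finite_right_gap:
  fixes A :: "'a::linordered_field set"
  assumes "finite A"
  shows "\<exists>u'>u. \<forall>a\<in>A. \<not> (u < a \<and> a \<le> u')"
proof (cases "{a\<in>A. u < a} = {}")
  case True
  then show ?thesis by (intro exI[of _ "u + 1"]) auto
next
  case False
  then have "u < Min {a\<in>A. u < a}" using assms by auto
  then obtain u' where u': "u < u'" "u' < Min {a\<in>A. u < a}" using dense by blast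
  then show ?thesis using assms False by (intro exI[of _ u']) (auto simp: not_le)
qed

text \<open>Otherwise the sign \<open>0\<close> at \<open>u\<close> would spread over an open cell,
  although a nonzero polynomial has only finitely many roots.\<close>

lemma sign_table_root:
  fixes Z :: "('a::linordered_field \<times> 'b::linordered_field) set"
  assumes Z: "matching Z" and T: "sign_table Z p q" and p: "p \<noteq> 0" and u: "poly p u = 0"
  shows "u \<in> fst ` Z"
proof (rule ccontr)
  assume un: "u \<notin> fst ` Z"
  obtain v where v: "same_cell Z u v" using ex_same_cell[OF Z] by blast
  have "finite (fst ` Z \<union> {x. poly p x = 0})"
    using Z poly_roots_finite[OF p] by (simp add: matching_def)
  from finite_right_gap[OF this, of u] obtain u' where
    u': "u < u'" "\<And>a. a \<in> fst ` Z \<or> poly p a = 0 \<Longrightarrow> \<not> (u < a \<and> a \<le> u')" by blast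
  have "same_cell Z u' v" unfolding same_cell_iff
  proof clarify
    fix x y assume xy: "(x,y) \<in> Z"
    then have "x \<noteq> u" "\<not> (u < x \<and> x \<le> u')" using un u'(2)[of x] by force+
    then have "u' < x \<longleftrightarrow> u < x" "x < u' \<longleftrightarrow> x < u" using u'(1) by auto
    then show "(u' < x \<longleftrightarrow> v < y) \<and> (x < u' \<longleftrightarrow> y < v)"
      using v xy unfolding same_cell_iff by fast
  qed
  then have "sg (poly p u') = sg (poly p u)" using T v unfolding sign_table_def by metis
  then have "poly p u' = 0" using u by simp
  then show False using u' by blast
qed

text \<open>Points that are not roots of \<open>p\<close> may be discarded: \<open>p\<close> keeps
  its sign when such a point is crossed, so \<open>u\<close> can be moved to a point
  \<open>u'\<close> that the finer table pairs with \<open>v\<close>.\<close>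

lemma sign_table_restrict:
  fixes Z :: "('a::real_closed_field \<times> 'b::linordered_field) set"
  assumes Z: "matching Z" and T: "sign_table Z p q" and W: "W \<subseteq> Z"
    and roots: "\<And>u. poly p u = 0 \<Longrightarrow> u \<in> fst ` W"
  shows "sign_table W p q"
  unfolding sign_table_def
proof (intro allI impI)
  fix u v assume uv: "same_cell W u v"
  obtain u' where u': "same_cell Z u' v" using ex_same_cell'[OF Z] by blast
  then have "same_cell W u' v" using W by (rule same_cell_mono)
  with uv have eq: "sg (u - x) = sg (u' - x)" if "x \<in> fst ` W" for x
    using that unfolding same_cell_def by fastforce
  have "sg (poly p u) = sg (poly p u')"
  proof (cases u u' rule: linorder_cases)
    case less
    have "poly p x \<noteq> 0" if "u \<le> x" "x \<le> u'" for x
      using eq[of x] roots[of x] that less by (auto simp: sg_eq_iff)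
    then show ?thesis using less by (intro sg_poly_const) auto
  next
    case greater
    have "poly p x \<noteq> 0" if "u' \<le> x" "x \<le> u" for x
      using eq[of x] roots[of x] that greater by (auto simp: sg_eq_iff)
    then show ?thesis using greater by (intro sg_poly_const[symmetric]) auto
  qed simp
  then show "sg (poly p u) = sg (poly q v)" using T u' unfolding sign_table_def by simp
qed

lemma matching_insert:
  assumes "matching Z" "same_cell Z z w"
  shows "matching (insert (z,w) Z)"
  unfolding matching_def
proof (intro conjI)
  show "finite (insert (z, w) Z)" using assms by (simp add: matching_def)
  show "\<forall>(x, y)\<in>insert (z, w) Z. \<forall>(x', y')\<in>insert (z, w) Z. (x < x') = (y < y')"
    using assms unfolding same_cell_iff matching_def by auto
qed

lemma cell_root_unique:
  fixes Z :: "('a::real_closed_field \<times> 'b::linordered_field) set"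
  assumes Z: "matching Z" and T: "sign_table Z (pderiv p) q'" and p': "pderiv p \<noteq> 0"
    and z: "poly p z = 0" "poly p z' = 0" and cell: "\<And>x. x \<in> fst ` Z \<Longrightarrow> sg (z - x) = sg (z' - x)"
  shows "z = z'"
proof -
  have p: "p \<noteq> 0" using p' by auto
  have no: "\<not> (a < b \<and> poly p a = 0 \<and> poly p b = 0 \<and> (\<forall>x\<in>fst ` Z. sg (a - x) = sg (b - x)))" for a b
  proof
    assume *: "a < b \<and> poly p a = 0 \<and> poly p b = 0 \<and> (\<forall>x\<in>fst ` Z. sg (a - x) = sg (b - x))"
    then obtain x where x: "a < x" "x < b" "poly (pderiv p) x = 0"
      using poly_Rolle_rcf[of a b p] p by blast
    then have "x \<in> fst ` Z" using sign_table_root[OF Z T p'] by blast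
    with * have "sg (a - x) = sg (b - x)" by blast
    then show False using x by (auto simp: sg_eq_iff)
  qed
  show ?thesis
    using no[of z z'] no[of z' z] z cell by (metis linorder_neqE)
qed

lemma ex_neighbours:
  fixes A :: "'a::linorder set"
  assumes "finite A" "u \<notin> A" "l \<in> A" "l < u" "r \<in> A" "u < r"
  shows "\<exists>c\<in>A. \<exists>d\<in>A. c < u \<and> u < d \<and> (\<forall>x\<in>A. x \<le> c \<or> d \<le> x)"
proof -
  let ?C = "{x\<in>A. x < u}" and ?D = "{x\<in>A. u < x}"
  have fin: "finite ?C" "finite ?D" "?C \<noteq> {}" "?D \<noteq> {}" using assms by auto
  have "Max ?C \<in> ?C" "Min ?D \<in> ?D" using Max_in[OF fin(1,3)] Min_in[OF fin(2,4)] by blast+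
  moreover have "x \<le> Max ?C \<or> Min ?D \<le> x" if "x \<in> A" for x
  proof (cases x u rule: linorder_cases)
    case less then show ?thesis using Max_ge[OF fin(1), of x] that by simp
  next
    case greater then show ?thesis using Min_le[OF fin(2), of x] that by simp
  qed (use assms that in auto)
  ultimately show ?thesis by blast
qed

text \<open>Let \<open>c\<close> and \<open>d\<close> be the points next to \<open>z\<close>. The
  derivative of \<open>p\<close> has no root between them, so \<open>p\<close> changes sign from
  \<open>c\<close> to \<open>d\<close>. The sign data at points carry this change over to
  \<open>q\<close>, and the intermediate value property of the second field gives
  \<open>w\<close>.\<close>

lemma cell_root_exists:
  fixes Z :: "('a::real_closed_field \<times> 'b::real_closed_field) set"
  assumes Z: "matching Z" and T: "sign_table Z (pderiv p) q'" and p': "pderiv p \<noteq> 0"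
    and S: "\<And>x y. (x,y) \<in> Z \<Longrightarrow> sg (poly p x) = sg (poly q y)"
    and z: "poly p z = 0" "z \<notin> fst ` Z" and l: "l \<in> fst ` Z" "l < z" and r: "r \<in> fst ` Z" "z < r"
  shows "\<exists>w. poly q w = 0 \<and> same_cell Z z w"
proof -
  have p: "p \<noteq> 0" using p' by auto
  have "finite (fst ` Z)" using Z by (simp add: matching_def)
  from ex_neighbours[OF this z(2) l r] obtain c d where
    cd: "c \<in> fst ` Z" "d \<in> fst ` Z" "c < z" "z < d" "\<And>x. x \<in> fst ` Z \<Longrightarrow> x \<le> c \<or> d \<le> x" by blast
  then obtain c' d' where c': "(c,c') \<in> Z" and d': "(d,d') \<in> Z" by force
  have no: "poly (pderiv p) x \<noteq> 0" if "c < x" "x < d" for x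
    using sign_table_root[OF Z T p', of x] cd(5)[of x] that by auto
  have pc: "poly p c \<noteq> 0" using poly_Rolle_rcf[of c z p] cd z p no by force
  have pd: "poly p d \<noteq> 0" using poly_Rolle_rcf[of z d p] cd z p no by force
  have "poly p c * poly p d < 0"
  proof (rule ccontr)
    assume "\<not> poly p c * poly p d < 0"
    then have pos: "poly p c * poly p d > 0" using pc pd by (auto simp: not_less order.strict_iff_order)
    \<comment> \<open>If \<open>p\<close> had equal signs at \<open>c\<close> and \<open>d\<close>,
      then \<open>g\<close> would change sign and have a root \<open>w\<close> in between. For
      \<open>w \<noteq> z\<close> this contradicts Rolle, and for \<open>w = z\<close> it makes
      \<open>z\<close> a root of the derivative.\<close>
    obtain g where g: "p = [:-z,1:] * g" using z by (metis poly_eq_0_iff_dvd dvdE)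
    have "pderiv [:-z,1:] = 1" by (simp add: pderiv_pCons)
    then have pder: "poly (pderiv p) z = poly g z" unfolding g pderiv_mult by simp
    have "poly p c * poly p d = ((c - z) * (d - z)) * (poly g c * poly g d)" by (simp add: g algebra_simps)
    moreover have "(c - z) * (d - z) < 0" using cd by (simp add: mult_neg_pos)
    ultimately have "poly g c * poly g d < 0" using pos by (metis mult_less_0_iff mult_neg_neg order.asym zero_less_mult_iff mult_less_cancel_left_neg mult_zero_right)
    then obtain w where w: "c < w" "w < d" "poly g w = 0" using poly_IVT_rcf[of c d g] cd by force
    then have pw: "poly p w = 0" by (simp add: g)
    show False
    proof (cases w z rule: linorder_cases)
      case less then show False using poly_Rolle_rcf[of w z p] p pw z w cd no by force
    next
      case greater then show False using poly_Rolle_rcf[of z w p] p pw z w cd no by force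
    next
      case equal then show False using pder no[of z] cd w by simp
    qed
  qed
  then have "poly q c' * poly q d' < 0"
    using S[OF c'] S[OF d'] by (auto simp: mult_less_0_iff sg_eq_iff)
  moreover have "c' < d'" using matching_less[OF Z c' d'] cd by auto
  ultimately obtain w where w: "c' < w" "w < d'" "poly q w = 0" using poly_IVT_rcf by blast
  have "same_cell Z z w" unfolding same_cell_iff
  proof clarify
    fix x y assume xy: "(x,y) \<in> Z"
    then have "x \<le> c \<or> d \<le> x" using cd(5) by force
    then have "x \<le> c \<and> y \<le> c' \<or> d \<le> x \<and> d' \<le> y"
      using matching_less[OF Z c' xy] matching_less[OF Z xy d'] by (auto simp: not_less[symmetric])
    then show "(z < x \<longleftrightarrow> w < y) \<and> (x < z \<longleftrightarrow> y < w)" using w cd by auto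
  qed
  then show ?thesis using w by blast
qed

text \<open>By \<open>gap\<close>, no point of \<open>Z\<close> other than \<open>c\<close> can
  separate \<open>u\<close> from \<open>c\<close>, so both polynomials keep their sign on the way
  from \<open>c\<close> to \<open>u\<close> and from \<open>c'\<close> to \<open>v\<close>.\<close>

lemma sg_neighbour:
  fixes Z :: "('a::real_closed_field \<times> 'b::real_closed_field) set"
  assumes Z: "matching Z" and uv: "same_cell Z u v" and cd: "(c,c') \<in> Z"
    and S: "sg (poly p c) = sg (poly q c')" "poly p c \<noteq> 0"
    and rp: "\<And>x. poly p x = 0 \<Longrightarrow> x \<in> fst ` Z" and rq: "\<And>y. poly q y = 0 \<Longrightarrow> y \<in> snd ` Z"
    and gap: "\<And>x. x \<in> fst ` Z \<Longrightarrow> x \<noteq> c \<Longrightarrow> sg (u - x) = sg (c - x)"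
  shows "sg (poly p u) = sg (poly q v)"
proof -
  have gap': "sg (v - y) = sg (c' - y)" if y: "y \<in> snd ` Z" "y \<noteq> c'" for y
  proof -
    obtain x where xy: "(x,y) \<in> Z" using y by force
    then have "x \<noteq> c" using matching_eq[OF Z xy cd] y by simp
    then have "sg (u - x) = sg (c - x)" using gap xy by force
    moreover have "sg (u - x) = sg (v - y)" using uv xy unfolding same_cell_def by fast
    moreover have "sg (c - x) = sg (c' - y)"
      using matching_same_cell[OF Z cd] xy unfolding same_cell_def by fast
    ultimately show ?thesis by simp
  qed
  have qc: "poly q c' \<noteq> 0" using S by (metis sg_eq_0_iff)
  have "sg (poly p u) = sg (poly p c)"
  proof (cases "u \<le> c")
    case True
    have "poly p x \<noteq> 0" if "u \<le> x" "x \<le> c" for x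
      using gap[OF rp, of x] that S(2) by (cases "x = c") (auto simp: sg_eq_iff)
    then show ?thesis using True by (intro sg_poly_const)
  next
    case False
    have "poly p x \<noteq> 0" if "c \<le> x" "x \<le> u" for x
      using gap[OF rp, of x] that S(2) by (cases "x = c") (auto simp: sg_eq_iff)
    then show ?thesis using False by (intro sg_poly_const[symmetric]) auto
  qed
  moreover have "sg (poly q v) = sg (poly q c')"
  proof (cases "v \<le> c'")
    case True
    have "poly q x \<noteq> 0" if "v \<le> x" "x \<le> c'" for x
      using gap'[OF rq, of x] that qc by (cases "x = c'") (auto simp: sg_eq_iff)
    then show ?thesis using True by (intro sg_poly_const)
  next
    case False
    have "poly q x \<noteq> 0" if "c' \<le> x" "x \<le> v" for x
      using gap'[OF rq, of x] that qc by (cases "x = c'") (auto simp: sg_eq_iff)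
    then show ?thesis using False by (intro sg_poly_const[symmetric]) auto
  qed
  ultimately show ?thesis using S by simp
qed

lemma ex_sg_poly_bounds:
  fixes r :: "'a::linordered_field poly"
  assumes "finite A"
  shows "\<exists>m M. (\<forall>x\<in>A. m < x \<and> x < M) \<and> m < M \<and> (\<forall>x\<ge>M. sg (poly r x) = sg (lead_coeff r)) \<and>
      (\<forall>x\<le>m. sg (poly r x) = (-1) ^ degree r * sg (lead_coeff r))"
proof -
  obtain M1 m1 where 1: "\<forall>x\<ge>M1. sg (poly r x) = sg (lead_coeff r)"
    "\<forall>x\<le>m1. sg (poly r x) = (-1) ^ degree r * sg (lead_coeff r)"
    using sg_poly_at_top[of r] sg_poly_at_bot[of r] by blast
  define M where "M = max M1 (Max (insert 0 A) + 1)"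
  define m where "m = min m1 (Min (insert 0 A) - 1)"
  have *: "x < M" "m < x" if "x \<in> insert 0 A" for x
  proof -
    have "x \<le> Max (insert 0 A)" "Min (insert 0 A) \<le> x"
      using that \<open>finite A\<close> by (intro Max_ge Min_le; simp)+
    then have "x < Max (insert 0 A) + 1" "Min (insert 0 A) - 1 < x" by linarith+
    then show "x < M" "m < x" by (auto simp: M_def m_def less_max_iff_disj min_less_iff_disj)
  qed
  from *[of 0] have "m < M" by (meson insertI1 order.strict_trans)
  then show ?thesis using 1 * by (intro exI[of _ m] exI[of _ M]) (auto simp: M_def m_def)
qed

text \<open>Rolle's theorem leaves at most one root of \<open>p\<close> in each cell that is free of roots of the
  derivative, and the signs at the two ends of the cell decide whether there is one.\<close>

lemma sign_table_extend:
  fixes Z0 :: "('a::real_closed_field \<times> 'b::real_closed_field) set"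
  assumes Z0: "matching Z0" and T0: "sign_table Z0 (pderiv p) (pderiv q)"
    and p': "pderiv p \<noteq> 0" and q': "pderiv q \<noteq> 0"
    and S0: "\<And>x y. (x,y) \<in> Z0 \<Longrightarrow> sg (poly p x) = sg (poly q y)"
    and lc: "sg (lead_coeff p) = sg (lead_coeff q)" and deg: "degree p = degree q"
  shows "\<exists>Z. Z0 \<subseteq> Z \<and> matching Z \<and> sign_table Z p q"
proof -
  have p: "p \<noteq> 0" and q: "q \<noteq> 0" using p' q' by auto
  have fin0: "finite (fst ` Z0)" "finite (snd ` Z0)" using Z0 by (simp_all add: matching_def)
  obtain m M where M: "\<And>x. x \<in> fst ` Z0 \<Longrightarrow> m < x \<and> x < M" "m < M"
    "\<And>x. x \<ge> M \<Longrightarrow> sg (poly p x) = sg (lead_coeff p)"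
    "\<And>x. x \<le> m \<Longrightarrow> sg (poly p x) = (-1) ^ degree p * sg (lead_coeff p)"
    using ex_sg_poly_bounds[OF fin0(1), of p] by blast
  obtain n N where N: "\<And>x. x \<in> snd ` Z0 \<Longrightarrow> n < x \<and> x < N" "n < N"
    "\<And>x. x \<ge> N \<Longrightarrow> sg (poly q x) = sg (lead_coeff q)"
    "\<And>x. x \<le> n \<Longrightarrow> sg (poly q x) = (-1) ^ degree q * sg (lead_coeff q)"
    using ex_sg_poly_bounds[OF fin0(2), of q] by blast
  \<comment> \<open>The two new pairs lie beyond all points and all roots, so every root is enclosed
    by points. The signs there agree, since the leading coefficients have the same sign and the
    degrees coincide.\<close>
  define Z1 where "Z1 = insert (m,n) (insert (M,N) Z0)"
  have "same_cell Z0 M N" unfolding same_cell_iff using M(1) N(1) by force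
  then have "matching (insert (M,N) Z0)" by (rule matching_insert[OF Z0])
  moreover have "same_cell (insert (M,N) Z0) m n" unfolding same_cell_iff using M(1,2) N(1,2) by force
  ultimately have Z1: "matching Z1" unfolding Z1_def by (rule matching_insert)
  have "Z0 \<subseteq> Z1" by (auto simp: Z1_def)
  have T1: "sign_table Z1 (pderiv p) (pderiv q)" by (rule sign_table_mono[OF T0 \<open>Z0 \<subseteq> Z1\<close>])
  have S1: "sg (poly p x) = sg (poly q y)" if "(x,y) \<in> Z1" for x y
    using that S0 M(3)[of M] M(4)[of m] N(3)[of N] N(4)[of n] lc deg by (auto simp: Z1_def)
  have Z1c: "matching (Z1\<inverse>)" and T1c: "sign_table (Z1\<inverse>) (pderiv q) (pderiv p)"
    using Z1 T1 by (simp_all add: matching_converse sign_table_converse)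
  have mM: "m \<in> fst ` Z1" "M \<in> fst ` Z1" "n \<in> snd ` Z1" "N \<in> snd ` Z1" by (auto simp: Z1_def image_iff)
  have p_in: "m < z \<and> z < M" if "poly p z = 0" for z
    using that M(3)[of z] M(4)[of z] p by (metis leading_coeff_0_iff mult_eq_0_iff not_less
        power_eq_0_iff sg_0 sg_eq_0_iff zero_neq_neg_one)
  have q_in: "n < z \<and> z < N" if "poly q z = 0" for z
    using that N(3)[of z] N(4)[of z] q by (metis leading_coeff_0_iff mult_eq_0_iff not_less
        power_eq_0_iff sg_0 sg_eq_0_iff zero_neq_neg_one)
  \<comment> \<open>Roots that already are points of \<open>Z1\<close> are left out; the others are
    paired when they lie in corresponding cells, where each has exactly one partner.\<close>
  define R where "R = {(z,w). poly p z = 0 \<and> poly q w = 0 \<and> same_cell Z1 z w \<and> z \<notin> fst ` Z1}"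
  define Z2 where "Z2 = Z1 \<union> R"
  have ex_w: "\<exists>w. (z,w) \<in> Z2" if "poly p z = 0" for z
  proof (cases "z \<in> fst ` Z1")
    case False
    then show ?thesis
      using cell_root_exists[OF Z1 T1 p' S1 that False mM(1) _ mM(2)] p_in[OF that] that
      by (auto simp: Z2_def R_def)
  qed (auto simp: Z2_def)
  have ex_z: "\<exists>z. (z,w) \<in> Z2" if "poly q w = 0" for w
  proof (cases "w \<in> snd ` Z1")
    case False
    have "\<exists>z. poly p z = 0 \<and> same_cell (Z1\<inverse>) w z"
    proof (rule cell_root_exists[OF Z1c T1c q' _ that])
      show "sg (poly q x) = sg (poly p y)" if "(x,y) \<in> Z1\<inverse>" for x y using S1[of y x] that by simp
      show "w \<notin> fst ` (Z1\<inverse>)" "n \<in> fst ` (Z1\<inverse>)" "N \<in> fst ` (Z1\<inverse>)" using False mM by force+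
    qed (use q_in[OF that] in auto)
    then obtain z where z: "poly p z = 0" "same_cell Z1 z w" by (auto simp: same_cell_converse)
    have "z \<notin> fst ` Z1" using same_cell_point[OF z(2)] False by force
    then show ?thesis using z that by (auto simp: Z2_def R_def)
  qed (auto simp: Z2_def)
  have "R \<subseteq> {z. poly p z = 0} \<times> {w. poly q w = 0}" by (auto simp: R_def)
  then have "finite R" using poly_roots_finite[OF p] poly_roots_finite[OF q] by (meson finite_SigmaI finite_subset)
  have RR: "z < z' \<longleftrightarrow> w < w'" if "(z,w) \<in> R" "(z',w') \<in> R" for z w z' w'
  proof -
    have *: "b < b'" if "(a,b) \<in> R" "(a',b') \<in> R" "a < a'" for a b a' b'
    proof -
      have "poly p a = 0" "poly p a' = 0" using that by (auto simp: R_def)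
      then obtain x where x: "x \<in> fst ` Z1" "sg (a - x) \<noteq> sg (a' - x)"
        using cell_root_unique[OF Z1 T1 p', of a a'] \<open>a < a'\<close> by (metis order.irrefl)
      then obtain y where xy: "(x,y) \<in> Z1" by force
      have "x \<noteq> a" "x \<noteq> a'" using x that by (auto simp: R_def)
      then have "a < x \<and> x < a'" using x(2) \<open>a < a'\<close> by (auto simp: sg_eq_iff)
      then show ?thesis using that xy unfolding R_def same_cell_iff by (force intro: order.strict_trans)
    qed
    have "w = w'" if eq: "z = z'"
    proof (rule cell_root_unique[OF Z1c T1c q'])
      show "poly q w = 0" "poly q w' = 0" using \<open>(z,w) \<in> R\<close> \<open>(z',w') \<in> R\<close> by (auto simp: R_def)
      show "sg (w - y) = sg (w' - y)" if y: "y \<in> fst ` (Z1\<inverse>)" for y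
      proof -
        obtain x where "(x,y) \<in> Z1" using y by force
        then show ?thesis
          using \<open>(z,w) \<in> R\<close> \<open>(z',w') \<in> R\<close> eq unfolding R_def same_cell_def by fastforce
      qed
    qed
    then show ?thesis using *[OF that] *[OF that(2,1)] by (metis linorder_neqE order.asym)
  qed
  have lt: "x < x' \<longleftrightarrow> y < y'" if "(x,y) \<in> Z2" "(x',y') \<in> Z2" for x y x' y'
    using that RR[of x y x' y'] matching_less[OF Z1, of x y x' y'] unfolding Z2_def
    by (auto simp: R_def same_cell_iff)
  have "finite Z2" using Z1 \<open>finite R\<close> by (simp add: Z2_def matching_def)
  then have Z2: "matching Z2" unfolding matching_def using lt by blast
  have S2: "sg (poly p x) = sg (poly q y)" if "(x,y) \<in> Z2" for x y
    using that S1 by (auto simp: Z2_def R_def)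
  have rp: "x \<in> fst ` Z2" if "poly p x = 0" for x using ex_w[OF that] by force
  have rq: "y \<in> snd ` Z2" if "poly q y = 0" for y using ex_z[OF that] by force
  have "sign_table Z2 p q" unfolding sign_table_def
  proof (intro allI impI)
    fix u v assume uv: "same_cell Z2 u v"
    show "sg (poly p u) = sg (poly q v)"
    proof (cases "u \<in> fst ` Z2")
      case True
      then obtain y where "(u,y) \<in> Z2" by force
      then show ?thesis using S2 same_cell_point[OF uv] by blast
    next
      case False
      have mnMN: "(m,n) \<in> Z2" "(M,N) \<in> Z2" by (auto simp: Z2_def Z1_def)
      then have cmp: "u < m \<longleftrightarrow> v < n" "M < u \<longleftrightarrow> N < v" using uv unfolding same_cell_iff by fast+
      have "u \<noteq> m" "u \<noteq> M" using False mnMN by force+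
      then consider "u < m" | "M < u" | "m < u" "u < M" by fastforce
      then show ?thesis
      proof cases
        case 1
        then show ?thesis using M(4)[of u] N(4)[of v] cmp lc deg by simp
      next
        case 2
        then show ?thesis using M(3)[of u] N(3)[of v] cmp lc by simp
      next
        case 3
        have "finite (fst ` Z2)" "m \<in> fst ` Z2" "M \<in> fst ` Z2"
          using \<open>finite Z2\<close> mnMN by force+
        from ex_neighbours[OF this(1) False this(2) 3(1) this(3) 3(2)] obtain c d where
          cd: "c \<in> fst ` Z2" "d \<in> fst ` Z2" "c < u" "u < d" "\<And>x. x \<in> fst ` Z2 \<Longrightarrow> x \<le> c \<or> d \<le> x" by blast
        then obtain c' d' where c': "(c,c') \<in> Z2" and d': "(d,d') \<in> Z2" by force
        \<comment> \<open>At least one neighbour is not a root: otherwise Rolle would place a root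
          of the derivative, hence a point of \<open>Z1\<close>, strictly between neighbours. The
          sign at \<open>u\<close> can be read off at that neighbour.\<close>
        have "poly p c \<noteq> 0 \<or> poly p d \<noteq> 0"
        proof (rule ccontr)
          assume "\<not> (poly p c \<noteq> 0 \<or> poly p d \<noteq> 0)"
          then obtain x where x: "c < x" "x < d" "poly (pderiv p) x = 0"
            using poly_Rolle_rcf[of c d p] p cd by force
          then have "x \<in> fst ` Z2" using sign_table_root[OF Z1 T1 p'] by (auto simp: Z2_def)
          then show False using cd(5)[of x] x by auto
        qed
        then show ?thesis
        proof
          assume "poly p c \<noteq> 0"
          then show ?thesis
          proof (rule sg_neighbour[OF Z2 uv c' S2[OF c'] _ rp rq])
            show "sg (u - x) = sg (c - x)" if "x \<in> fst ` Z2" "x \<noteq> c" for x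
              using cd(3,4) cd(5)[OF that(1)] that(2) by (auto simp: sg_eq_iff)
          qed
        next
          assume "poly p d \<noteq> 0"
          then show ?thesis
          proof (rule sg_neighbour[OF Z2 uv d' S2[OF d'] _ rp rq])
            show "sg (u - x) = sg (d - x)" if "x \<in> fst ` Z2" "x \<noteq> d" for x
              using cd(3,4) cd(5)[OF that(1)] that(2) by (auto simp: sg_eq_iff)
          qed
        qed
      qed
    qed
  qed
  then show ?thesis using Z2 \<open>Z0 \<subseteq> Z1\<close> by (intro exI[of _ Z2]) (auto simp: Z2_def)
qed

section \<open>Elimination of one variable\<close>

definition ring_morphism :: "('c::comm_ring_1 \<Rightarrow> 'a::comm_ring_1) \<Rightarrow> bool" where
  "ring_morphism h \<longleftrightarrow> h 1 = 1 \<and> (\<forall>x y. h (x + y) = h x + h y) \<and> (\<forall>x y. h (x * y) = h x * h y)"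

lemma ring_morphismD:
  assumes "ring_morphism h"
  shows "h 1 = 1" "h (x + y) = h x + h y" "h (x * y) = h x * h y" "h 0 = 0" "h (- x) = - h x"
    "h (x - y) = h x - h y" "h (x ^ n) = h x ^ n" "h (of_nat n) = of_nat n" "h (sum f A) = (\<Sum>a\<in>A. h (f a))"
proof -
  show 1: "h 1 = 1" and a: "\<And>x y. h (x + y) = h x + h y" and m: "\<And>x y. h (x * y) = h x * h y"
    using assms by (auto simp: ring_morphism_def)
  show z: "h 0 = 0" using a[of 0 0] by simp
  show n: "h (- x) = - h x" for x using a[of x "- x"] z by (simp add: eq_neg_iff_add_eq_0 add.commute)
  show "h (x - y) = h x - h y" using a[of x "- y"] n by simp
  show "h (x ^ n) = h x ^ n" by (induction n) (simp_all add: 1 m)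
  show "h (of_nat n) = of_nat n" by (induction n) (simp_all add: 1 a z)
  show "h (sum f A) = (\<Sum>a\<in>A. h (f a))"
    by (induction A rule: infinite_finite_induct) (simp_all add: z a)
qed

lemma coeff_map_poly_morphism: "ring_morphism h \<Longrightarrow> coeff (map_poly h p) n = h (coeff p n)"
  by (simp add: coeff_map_poly ring_morphismD)

lemma map_poly_morphism:
  assumes "ring_morphism h"
  shows "map_poly h (p + q) = map_poly h p + map_poly h q"
    and "map_poly h (p * q) = map_poly h p * map_poly h q"
    and "map_poly h (smult c p) = smult (h c) (map_poly h p)"
    and "map_poly h [:c:] = [:h c:]"
  using assms
  by (auto intro!: poly_eqI simp: coeff_map_poly_morphism ring_morphismD coeff_mult coeff_pCons split: nat.splits)

text \<open>\<^const>\<open>pderiv\<close> is only available over rings without zero divisors.\<close>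

definition formal_deriv :: "'c::comm_ring_1 poly \<Rightarrow> 'c poly" where
  "formal_deriv p = (\<Sum>i<degree p. monom (of_nat (Suc i) * coeff p (Suc i)) i)"

lemma coeff_formal_deriv: "coeff (formal_deriv p) n = of_nat (Suc n) * coeff p (Suc n)"
  by (simp add: formal_deriv_def coeff_sum when_def coeff_eq_0 not_less del: of_nat_Suc)

lemma map_poly_formal_deriv:
  fixes h :: "'c::comm_ring_1 \<Rightarrow> 'a::idom"
  assumes "ring_morphism h"
  shows "map_poly h (formal_deriv p) = pderiv (map_poly h p)"
  by (intro poly_eqI)
    (simp only: coeff_map_poly_morphism[OF assms] coeff_pderiv coeff_formal_deriv ring_morphismD[OF assms])

definition same_signs :: "('c \<Rightarrow> 'a::linordered_idom) \<Rightarrow> ('c \<Rightarrow> 'b::linordered_idom) \<Rightarrow> 'c set \<Rightarrow> bool" where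
  "same_signs \<sigma> \<tau> S \<longleftrightarrow> (\<forall>s\<in>S. sg (\<sigma> s) = sg (\<tau> s))"

text \<open>\<open>T\<close> only carries the type of the target field of \<open>\<tau>\<close>.\<close>

definition eliminable :: "'b::real_closed_field itself \<Rightarrow> ('c \<Rightarrow> 'a::real_closed_field) \<Rightarrow> 'c::comm_ring_1 poly set \<Rightarrow> bool" where
  "eliminable T \<sigma> F \<longleftrightarrow> (\<exists>S. finite S \<and> (\<forall>\<tau> :: 'c \<Rightarrow> 'b.
     ring_morphism \<tau> \<longrightarrow> same_signs \<sigma> \<tau> S \<longrightarrow>
     (\<exists>Z. matching Z \<and> (\<forall>p\<in>F. sign_table Z (map_poly \<sigma> p) (map_poly \<tau> p)))))"

lemma eliminable_transfer:
  fixes T :: "'b::real_closed_field itself" and \<sigma> :: "'c::comm_ring_1 \<Rightarrow> 'a::real_closed_field"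
  assumes "eliminable T \<sigma> G" "finite S0"
    and "\<And>\<tau> :: 'c \<Rightarrow> 'b. ring_morphism \<tau> \<Longrightarrow> same_signs \<sigma> \<tau> S0 \<Longrightarrow>
      (\<exists>Z. matching Z \<and> (\<forall>p\<in>G. sign_table Z (map_poly \<sigma> p) (map_poly \<tau> p))) \<Longrightarrow>
      (\<exists>Z. matching Z \<and> (\<forall>p\<in>F. sign_table Z (map_poly \<sigma> p) (map_poly \<tau> p)))"
  shows "eliminable T \<sigma> F"
proof -
  obtain S where S: "finite S" "\<And>\<tau> :: 'c \<Rightarrow> 'b. ring_morphism \<tau> \<Longrightarrow> same_signs \<sigma> \<tau> S \<Longrightarrow>
     (\<exists>Z. matching Z \<and> (\<forall>p\<in>G. sign_table Z (map_poly \<sigma> p) (map_poly \<tau> p)))"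
    using assms(1) unfolding eliminable_def by blast
  show ?thesis unfolding eliminable_def
  proof (intro exI[of _ "S \<union> S0"] conjI allI impI)
    show "finite (S \<union> S0)" using S assms by simp
    fix \<tau> :: "'c \<Rightarrow> 'b" assume \<tau>: "ring_morphism \<tau>" "same_signs \<sigma> \<tau> (S \<union> S0)"
    then have "same_signs \<sigma> \<tau> S" "same_signs \<sigma> \<tau> S0" by (auto simp: same_signs_def)
    then show "\<exists>Z. matching Z \<and> (\<forall>p\<in>F. sign_table Z (map_poly \<sigma> p) (map_poly \<tau> p))"
      using S(2) assms(3) \<tau>(1) by blast
  qed
qed

text \<open>Ensures that \<open>map_poly \<sigma>\<close> preserves the degree. Once the sign of the
  leading coefficient is recorded, \<open>\<tau>\<close> preserves it too.\<close>

definition normalized :: "('c \<Rightarrow> 'a::zero) \<Rightarrow> 'c::comm_ring_1 poly \<Rightarrow> bool" where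
  "normalized \<sigma> p \<longleftrightarrow> \<sigma> (lead_coeff p) \<noteq> 0"

text \<open>Leading coefficients killed by \<open>\<sigma>\<close> are removed one after the other.
  Recording them in \<open>S\<close> makes \<open>\<tau>\<close> kill them as well, since sign
  \<open>0\<close> means vanishing.\<close>

lemma ex_normalized:
  fixes \<sigma> :: "'c::comm_ring_1 \<Rightarrow> 'a::linordered_idom"
  assumes \<sigma>: "ring_morphism \<sigma>"
  shows "\<exists>p' S. (p' = 0 \<or> normalized \<sigma> p') \<and> degree p' \<le> degree p \<and> finite S \<and>
    map_poly \<sigma> p = map_poly \<sigma> p' \<and>
    (\<forall>\<tau> :: 'c \<Rightarrow> 'b::linordered_idom.
       ring_morphism \<tau> \<longrightarrow> same_signs \<sigma> \<tau> S \<longrightarrow> map_poly \<tau> p = map_poly \<tau> p')"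
proof (induction "degree p" arbitrary: p rule: less_induct)
  case less
  show ?case
  proof (cases "p = 0 \<or> normalized \<sigma> p")
    case True
    then show ?thesis by (intro exI[of _ p] exI[of _ "{}"]) auto
  next
    case False
    define c where "c = lead_coeff p"
    have c: "\<sigma> c = 0" and p: "p \<noteq> 0" using False by (auto simp: normalized_def c_def)
    define q where "q = p - monom c (degree p)"
    have drop: "map_poly h p = map_poly h q" if "ring_morphism h" "h c = 0"
      for h :: "'c \<Rightarrow> 'd::comm_ring_1"
      using that by (intro poly_eqI)
        (simp add: coeff_map_poly_morphism q_def coeff_diff ring_morphismD)
    have "degree q < degree p \<or> q = 0"
    proof (cases "degree p = 0")
      case True
      then have "q = 0" by (intro poly_eqI) (auto simp: q_def c_def coeff_eq_0)
      then show ?thesis ..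
    next
      case False
      have "degree q \<le> degree p" by (simp add: q_def degree_diff_le degree_monom_le)
      moreover have "coeff q (degree p) = 0" by (simp add: q_def c_def)
      ultimately show ?thesis using eq_zero_or_degree_less by blast
    qed
    then show ?thesis
    proof
      assume "q = 0"
      then show ?thesis using drop[OF \<sigma> c] drop
        by (intro exI[of _ 0] exI[of _ "{c}"]) (auto simp: same_signs_def c)
    next
      assume "degree q < degree p"
      from less[OF this] obtain p' S where *: "p' = 0 \<or> normalized \<sigma> p'" "degree p' \<le> degree q" "finite S"
        "map_poly \<sigma> q = map_poly \<sigma> p'"
        "\<And>\<tau> :: 'c \<Rightarrow> 'b. ring_morphism \<tau> \<Longrightarrow> same_signs \<sigma> \<tau> S \<Longrightarrow> map_poly \<tau> q = map_poly \<tau> p'"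
        by blast
      show ?thesis
      proof (intro exI[of _ p'] exI[of _ "insert c S"] conjI allI impI)
        fix \<tau> :: "'c \<Rightarrow> 'b" assume \<tau>: "ring_morphism \<tau>" "same_signs \<sigma> \<tau> (insert c S)"
        then have "\<tau> c = 0" "same_signs \<sigma> \<tau> S" using c by (auto simp: same_signs_def)
        then show "map_poly \<tau> p = map_poly \<tau> p'" using *(5) drop \<tau>(1) by metis
      qed (use * drop[OF \<sigma> c] \<open>degree q < degree p\<close> in auto)
    qed
  qed
qed

text \<open>Passing to normalized polynomials must not increase the number of those of degree
  \<open>d\<close>, because this number is the induction measure in
  \<open>eliminable_finite\<close>.\<close>

lemma eliminable_if_normalized:
  fixes \<sigma> :: "'c::comm_ring_1 \<Rightarrow> 'a::real_closed_field" and T :: "'b::real_closed_field itself"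
  assumes \<sigma>: "ring_morphism \<sigma>" and F: "finite F" "\<And>p. p \<in> F \<Longrightarrow> degree p \<le> d"
    and el: "\<And>G. finite G \<Longrightarrow> (\<And>p. p \<in> G \<Longrightarrow> degree p \<le> d \<and> normalized \<sigma> p) \<Longrightarrow>
      card {p\<in>G. degree p = d} \<le> card {p\<in>F. degree p = d} \<Longrightarrow> eliminable T \<sigma> G"
  shows "eliminable T \<sigma> F"
proof -
  obtain nf S where nf: "\<And>p. nf p = 0 \<or> normalized \<sigma> (nf p)" "\<And>p. degree (nf p) \<le> degree p"
    "\<And>p. finite (S p)" "\<And>p. map_poly \<sigma> p = map_poly \<sigma> (nf p)"
    "\<And>p \<tau>. ring_morphism (\<tau> :: 'c \<Rightarrow> 'b) \<Longrightarrow> same_signs \<sigma> \<tau> (S p) \<Longrightarrow> map_poly \<tau> p = map_poly \<tau> (nf p)"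
    using ex_normalized[OF \<sigma>, where ?'b = 'b] by metis
  let ?G = "nf ` F - {0}"
  have "{p\<in>?G. degree p = d} \<subseteq> nf ` {p\<in>F. degree p = d}"
    using F(2) nf(2) by (force intro: le_antisym)
  then have "card {p\<in>?G. degree p = d} \<le> card {p\<in>F. degree p = d}"
    using F(1) by (intro surj_card_le) auto
  then have "eliminable T \<sigma> ?G"
    using F nf(1,2) by (intro el) (auto intro: order_trans)
  then show ?thesis
  proof (rule eliminable_transfer)
    show "finite (\<Union>p\<in>F. S p)" using F nf(3) by auto
    fix \<tau> :: "'c \<Rightarrow> 'b" assume \<tau>: "ring_morphism \<tau>" "same_signs \<sigma> \<tau> (\<Union>p\<in>F. S p)"
      and "\<exists>Z. matching Z \<and> (\<forall>p\<in>?G. sign_table Z (map_poly \<sigma> p) (map_poly \<tau> p))"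
    then obtain Z where Z: "matching Z" "\<And>p. p \<in> ?G \<Longrightarrow> sign_table Z (map_poly \<sigma> p) (map_poly \<tau> p)" by blast
    have "sign_table Z (map_poly \<sigma> p) (map_poly \<tau> p)" if p: "p \<in> F" for p
    proof -
      have "map_poly \<tau> p = map_poly \<tau> (nf p)"
        using \<tau> p by (intro nf(5)) (auto simp: same_signs_def)
      then show ?thesis using Z(2)[of "nf p"] nf(4)[of p] p
        by (cases "nf p = 0") (auto simp: sign_table_def)
    qed
    then show "\<exists>Z. matching Z \<and> (\<forall>p\<in>F. sign_table Z (map_poly \<sigma> p) (map_poly \<tau> p))" using Z(1) by blast
  qed
qed

text \<open>Pseudo-division, as the coefficients form only a ring; \<open>c\<close> is a power of
  the leading coefficient of \<open>g\<close>, whence \<open>\<sigma> c \<noteq> 0\<close>.\<close>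

lemma ex_remainder:
  assumes \<sigma>: "ring_morphism (\<sigma> :: 'c::comm_ring_1 \<Rightarrow> 'a::idom)" and g: "normalized \<sigma> g"
  shows "\<exists>c r q. \<sigma> c \<noteq> 0 \<and> smult c f = g * q + r \<and> (r = 0 \<or> degree r < degree g)"
proof -
  have g0: "g \<noteq> 0" using g ring_morphismD[OF \<sigma>] by (auto simp: normalized_def)
  obtain q r where qr: "pseudo_divmod f g = (q, r)" by fastforce
  show ?thesis
    using pseudo_divmod[OF g0 qr] g ring_morphismD(7)[OF \<sigma>] unfolding normalized_def
    by (metis power_not_zero)
qed

lemma eliminable_const:
  fixes \<sigma> :: "'c::comm_ring_1 \<Rightarrow> 'a::real_closed_field" and T :: "'b::real_closed_field itself"
  assumes \<sigma>: "ring_morphism \<sigma>" and F: "finite F" "\<And>p. p \<in> F \<Longrightarrow> degree p = 0"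
  shows "eliminable T \<sigma> F"
  unfolding eliminable_def
proof (intro exI[of _ "(\<lambda>p. coeff p 0) ` F"] conjI allI impI exI[of _ "{}"] ballI)
  fix \<tau> :: "'c \<Rightarrow> 'b" and p
  assume \<tau>: "ring_morphism \<tau>" "same_signs \<sigma> \<tau> ((\<lambda>p. coeff p 0) ` F)" and p: "p \<in> F"
  obtain c where "p = [:c:]" using F(2)[OF p] by (metis degree_eq_zeroE)
  then show "sign_table {} (map_poly \<sigma> p) (map_poly \<tau> p)"
    using \<tau> p \<sigma> by (auto simp: sign_table_def map_poly_morphism same_signs_def)
qed (use F in \<open>auto simp: matching_def\<close>)

text \<open>At a root of \<open>g\<close> the identity \<open>c p = g h + r\<close> reduces the sign
  of \<open>p\<close> to those of \<open>c\<close> and of the remainder \<open>r\<close>. A common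
  table for the derivative, for \<open>F\<close> and for all remainders thus gives the signs of
  \<open>p\<close> at the roots of the derivative, which \<open>sign_table_extend\<close> turns into
  a table for \<open>p\<close>.\<close>

lemma eliminable_step:
  fixes \<sigma> :: "'c::comm_ring_1 \<Rightarrow> 'a::real_closed_field" and T :: "'b::real_closed_field itself"
  assumes \<sigma>: "ring_morphism \<sigma>" and F: "finite F" "\<And>p. p \<in> F \<Longrightarrow> normalized \<sigma> p"
    and p: "normalized \<sigma> p" "degree p > 0"
    and rem: "\<And>g. g \<in> insert (formal_deriv p) F \<Longrightarrow> \<sigma> (c g) \<noteq> 0 \<and> smult (c g) p = g * h g + r g"
    and el: "eliminable T \<sigma> (insert (formal_deriv p) F \<union> r ` insert (formal_deriv p) F)"
  shows "eliminable T \<sigma> (insert p F)"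
  using el
proof (rule eliminable_transfer)
  let ?H = "insert (formal_deriv p) F"
  let ?G = "?H \<union> r ` ?H"
  let ?S = "insert (lead_coeff p) (c ` ?H)"
  show "finite ?S" using F by simp
  fix \<tau> :: "'c \<Rightarrow> 'b"
  assume \<tau>: "ring_morphism \<tau>" and ss: "same_signs \<sigma> \<tau> ?S"
    and "\<exists>Z. matching Z \<and> (\<forall>p\<in>?G. sign_table Z (map_poly \<sigma> p) (map_poly \<tau> p))"
  then obtain Z where Z: "matching Z" "\<And>p. p \<in> ?G \<Longrightarrow> sign_table Z (map_poly \<sigma> p) (map_poly \<tau> p)" by blast
  let ?P = "map_poly \<sigma>" and ?Q = "map_poly \<tau>"
  have lc: "sg (\<sigma> (lead_coeff p)) = sg (\<tau> (lead_coeff p))" using ss by (simp add: same_signs_def)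
  then have lc\<tau>: "\<tau> (lead_coeff p) \<noteq> 0" using p(1) by (metis normalized_def sg_eq_0_iff)
  have deg: "degree (?P p) = degree p" "degree (?Q p) = degree p"
    using p(1) lc\<tau> by (auto intro!: map_poly_degree_eq simp: normalized_def)
  have dP: "?P (formal_deriv p) = pderiv (?P p)" "?Q (formal_deriv p) = pderiv (?Q p)"
    using map_poly_formal_deriv \<sigma> \<tau> by blast+
  have nz: "pderiv (?P p) \<noteq> 0" "pderiv (?Q p) \<noteq> 0" using deg p(2) by (simp_all add: pderiv_eq_0_iff)
  have H0: "?P g \<noteq> 0" if "g \<in> ?H" for g
  proof (cases "g = formal_deriv p")
    case False
    then have "coeff (?P g) (degree g) \<noteq> 0"
      using F(2)[of g] that by (simp add: coeff_map_poly_morphism[OF \<sigma>] normalized_def)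
    then show ?thesis by auto
  qed (use nz dP in simp)
  \<comment> \<open>Only at roots of some \<open>g\<close> do the remainders determine the sign of
    \<open>p\<close>, so all other points are dropped; by \<open>sign_table_restrict\<close> the
    table for each \<open>g\<close> survives.\<close>
  define W where "W = {(x,y)\<in>Z. \<exists>g\<in>?H. poly (?P g) x = 0}"
  have "W \<subseteq> Z" by (auto simp: W_def)
  then have W: "matching W" using Z(1) finite_subset[of W Z] unfolding matching_def by (auto simp: Ball_def subset_iff)
  have TW: "sign_table W (?P g) (?Q g)" if "g \<in> ?H" for g
  proof (rule sign_table_restrict[OF Z(1) _ \<open>W \<subseteq> Z\<close>])
    show "sign_table Z (?P g) (?Q g)" using Z(2) that by blast
    then show "u \<in> fst ` W" if "poly (?P g) u = 0" for u
      using sign_table_root[OF Z(1) _ H0[OF \<open>g \<in> ?H\<close>] that] that \<open>g \<in> ?H\<close> by (force simp: W_def)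
  qed
  have SW: "sg (poly (?P p) x) = sg (poly (?Q p) y)" if xyW: "(x,y) \<in> W" for x y
  proof -
    obtain g where g: "g \<in> ?H" "poly (?P g) x = 0" and xy: "(x,y) \<in> Z" using xyW by (auto simp: W_def)
    have cell: "same_cell Z x y" by (rule matching_same_cell[OF Z(1) xy])
    have "g \<in> ?G" "r g \<in> ?G" using g by auto
    then have *: "sg (poly (?P g) x) = sg (poly (?Q g) y)" "sg (poly (?P (r g)) x) = sg (poly (?Q (r g)) y)"
      using Z(2) cell unfolding sign_table_def by blast+
    have g': "poly (?Q g) y = 0" using * g by (metis sg_eq_0_iff)
    have e: "smult (c g) p = g * h g + r g" "\<sigma> (c g) \<noteq> 0" using rem[OF g(1)] by auto
    have c: "sg (\<sigma> (c g)) = sg (\<tau> (c g))" using ss imageI[OF g(1), of c] unfolding same_signs_def by blast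
    have "\<sigma> (c g) * poly (?P p) x = poly (?P (r g)) x"
      using arg_cong[OF e(1), of "\<lambda>p. poly (?P p) x"] g by (simp add: map_poly_morphism[OF \<sigma>])
    moreover have "\<tau> (c g) * poly (?Q p) y = poly (?Q (r g)) y"
      using arg_cong[OF e(1), of "\<lambda>p. poly (?Q p) y"] g' by (simp add: map_poly_morphism[OF \<tau>])
    ultimately have "sg (\<sigma> (c g)) * sg (poly (?P p) x) = sg (\<sigma> (c g)) * sg (poly (?Q p) y)"
      using *(2) c by (metis sg_mult)
    then show ?thesis using e by simp
  qed
  have "\<exists>Z'. W \<subseteq> Z' \<and> matching Z' \<and> sign_table Z' (?P p) (?Q p)"
  proof (rule sign_table_extend[OF W _ nz SW])
    show "sign_table W (pderiv (?P p)) (pderiv (?Q p))" using TW[of "formal_deriv p"] by (simp add: dP)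
    show "sg (lead_coeff (?P p)) = sg (lead_coeff (?Q p))" "degree (?P p) = degree (?Q p)"
      using lc by (simp_all add: deg coeff_map_poly_morphism \<sigma> \<tau>)
  qed
  then show "\<exists>Z. matching Z \<and> (\<forall>p\<in>insert p F. sign_table Z (?P p) (?Q p))"
    using TW sign_table_mono by blast
qed

lemma normalized_formal_deriv:
  fixes \<sigma> :: "'c::comm_ring_1 \<Rightarrow> 'a::{idom,ring_char_0}"
  assumes \<sigma>: "ring_morphism \<sigma>" and p: "normalized \<sigma> p" "degree p = Suc d"
  shows "degree (formal_deriv p) = d" "normalized \<sigma> (formal_deriv p)"
proof -
  have c: "\<sigma> (coeff (formal_deriv p) d) \<noteq> 0"
    using p by (simp add: coeff_formal_deriv ring_morphismD[OF \<sigma>] normalized_def del: of_nat_Suc)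
  then have "coeff (formal_deriv p) d \<noteq> 0" using ring_morphismD(4)[OF \<sigma>] by metis
  then have "d \<le> degree (formal_deriv p)" by (rule le_degree)
  moreover have "degree (formal_deriv p) \<le> d" using p(2) by (intro degree_le) (simp add: coeff_formal_deriv coeff_eq_0)
  ultimately show "degree (formal_deriv p) = d" by simp
  then show "normalized \<sigma> (formal_deriv p)" using c by (simp add: normalized_def)
qed

text \<open>Lexicographic induction on the degree bound and the number of polynomials attaining it.
  Replacing such a \<open>p\<close> by its derivative and its remainders removes one of them and
  creates none, since a remainder has smaller degree than its divisor.\<close>

lemma eliminable_finite:
  fixes \<sigma> :: "'c::comm_ring_1 \<Rightarrow> 'a::real_closed_field" and T :: "'b::real_closed_field itself"
  assumes \<sigma>: "ring_morphism \<sigma>" and F: "finite F"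
  shows "eliminable T \<sigma> F"
proof -
  have "eliminable T \<sigma> F" if "finite F" "\<And>p. p \<in> F \<Longrightarrow> degree p \<le> d" for F d
    using that
  proof (induction d arbitrary: F)
    case 0
    then show ?case by (intro eliminable_const[OF \<sigma>]) auto
  next
    case (Suc d)
    note lower = Suc.IH
    let ?top = "\<lambda>G. {p\<in>G. degree p = Suc d}"
    show ?case using Suc.prems
    proof (induction "card (?top F)" arbitrary: F rule: less_induct)
      case (less F)
      show ?case
      proof (rule eliminable_if_normalized[OF \<sigma> less.prems])
        fix G assume G: "finite G" "\<And>p. p \<in> G \<Longrightarrow> degree p \<le> Suc d \<and> normalized \<sigma> p"
          and cG: "card (?top G) \<le> card (?top F)"
        show "eliminable T \<sigma> G"
        proof (cases "\<exists>p\<in>G. degree p = Suc d")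
          case False
          then show ?thesis using G by (intro lower) (auto simp: le_Suc_eq)
        next
          case True
          then obtain p where p: "p \<in> G" "degree p = Suc d" by blast
          then have np: "normalized \<sigma> p" using G by blast
          let ?H = "insert (formal_deriv p) (G - {p})"
          have H: "normalized \<sigma> g \<and> degree g \<le> Suc d" if "g \<in> ?H" for g
            using that G normalized_formal_deriv[OF \<sigma> np p(2)] by auto
          then have "\<forall>g\<in>?H. \<exists>c r q. \<sigma> c \<noteq> 0 \<and> smult c p = g * q + r \<and> (r = 0 \<or> degree r < degree g)"
            using ex_remainder[OF \<sigma>] by blast
          then obtain c r h where rem: "\<And>g. g \<in> ?H \<Longrightarrow> \<sigma> (c g) \<noteq> 0 \<and> smult (c g) p = g * h g + r g"
            and rdeg: "\<And>g. g \<in> ?H \<Longrightarrow> r g = 0 \<or> degree (r g) < degree g"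
            unfolding bchoice_iff by metis
          have rd: "degree (r g) \<le> d" if "g \<in> ?H" for g using rdeg[OF that] H[OF that] by auto
          have "eliminable T \<sigma> (?H \<union> r ` ?H)"
          proof (rule less.hyps)
            have "?top (?H \<union> r ` ?H) \<subseteq> ?top G - {p}"
              using rd normalized_formal_deriv(1)[OF \<sigma> np p(2)] by force
            then have "card (?top (?H \<union> r ` ?H)) \<le> card (?top G - {p})"
              using G(1) by (intro card_mono) auto
            also have "\<dots> < card (?top G)" using p G(1) by (intro card_Diff1_less) auto
            finally show "card (?top (?H \<union> r ` ?H)) < card (?top F)" using cG by simp
            show "finite (?H \<union> r ` ?H)" using G by simp
            show "degree q \<le> Suc d" if "q \<in> ?H \<union> r ` ?H" for q using that H rd by fastforce
          qed
          from eliminable_step[OF \<sigma> _ _ np _ rem this] have "eliminable T \<sigma> (insert p (G - {p}))"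
            using G p(2) by simp
          then show ?thesis using p(1) by (simp add: insert_absorb)
        qed
      qed
    qed
  qed
  then show ?thesis using F by (metis Max_ge finite_imageI imageI)
qed

section \<open>Transfer from a real closed field to the reals\<close>

text \<open>Positive reals are squares, so \<open>of_real\<close> cannot fail to preserve the
  order.\<close>

lemma sg_of_real: "sg (of_real r :: 'k::{linordered_field, real_algebra_1}) = sg r"
proof -
  have pos: "0 < (of_real s :: 'k)" if "0 < s" for s
  proof -
    have "(of_real s :: 'k) = (of_real (sqrt s))\<^sup>2" using that by (simp flip: of_real_power)
    then show ?thesis using that by (metis of_real_eq_0_iff less_irrefl zero_less_power2 power_zero_numeral)
  qed
  show ?thesis
    using pos[of r] pos[of "- r"] by (cases r "0 :: real" rule: linorder_cases) (auto simp: sg_def)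
qed

lemma ring_morphism_eval_rpoly: "ring_morphism (\<lambda>p. eval_rpoly p x)"
  by (simp add: ring_morphism_def eval_rpoly_simps)

lemma ring_morphism_of_real: "ring_morphism (of_real :: real \<Rightarrow> 'a::{real_algebra_1, comm_ring_1})"
  by (simp add: ring_morphism_def)

definition vec_update :: "'n \<Rightarrow> 'a \<Rightarrow> 'a ^ 'n \<Rightarrow> 'a ^ 'n" where
  "vec_update i y z = (\<chi> j. if j = i then y else z $ j)"

text \<open>Regards \<open>h\<close> as a polynomial in \<open>Var i\<close> without introducing a
  smaller polynomial ring: the coefficients are evaluated with coordinate \<open>i\<close> set to
  \<open>0\<close>. Both conjuncts share one \<open>H\<close>, because elimination compares the
  images of the same coefficients in both fields.\<close>

lemma ex_univariate:
  fixes h :: "'n::finite rpoly"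
  shows "\<exists>H. (\<forall>(z :: 'k::{comm_ring_1, real_algebra_1} ^ 'n) y. eval_rpoly h (vec_update i y z) =
      poly (map_poly (\<lambda>c. eval_rpoly c (vec_update i 0 z)) H) y) \<and>
    (\<forall>(z :: real ^ 'n) y. eval_rpoly h (vec_update i y z) =
      poly (map_poly (\<lambda>c. eval_rpoly c (vec_update i 0 z)) H) y)"
proof (induction h rule: rpoly_induct)
  case (Const c)
  show ?case
    by (intro exI[of _ "[:Const c:]"])
      (simp add: map_poly_morphism(4)[OF ring_morphism_eval_rpoly] eval_rpoly_Const)
next
  case (mult_Var p j)
  then obtain H where "\<forall>(z :: 'k ^ 'n) y. eval_rpoly p (vec_update i y z) =
      poly (map_poly (\<lambda>c. eval_rpoly c (vec_update i 0 z)) H) y"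
    "\<forall>(z :: real ^ 'n) y. eval_rpoly p (vec_update i y z) =
      poly (map_poly (\<lambda>c. eval_rpoly c (vec_update i 0 z)) H) y" by blast
  then show ?case
    by (intro exI[of _ "H * (if j = i then [:0, 1:] else [:Var j:])"])
      (simp add: map_poly_morphism[OF ring_morphism_eval_rpoly] eval_rpoly_simps vec_update_def map_poly_pCons)
next
  case (add p q)
  then obtain H H' where "\<forall>(z :: 'k ^ 'n) y. eval_rpoly p (vec_update i y z) =
      poly (map_poly (\<lambda>c. eval_rpoly c (vec_update i 0 z)) H) y"
    "\<forall>(z :: real ^ 'n) y. eval_rpoly p (vec_update i y z) =
      poly (map_poly (\<lambda>c. eval_rpoly c (vec_update i 0 z)) H) y"
    "\<forall>(z :: 'k ^ 'n) y. eval_rpoly q (vec_update i y z) =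
      poly (map_poly (\<lambda>c. eval_rpoly c (vec_update i 0 z)) H') y"
    "\<forall>(z :: real ^ 'n) y. eval_rpoly q (vec_update i y z) =
      poly (map_poly (\<lambda>c. eval_rpoly c (vec_update i 0 z)) H') y" by blast
  then show ?case
    by (intro exI[of _ "H + H'"])
      (simp add: map_poly_morphism[OF ring_morphism_eval_rpoly] eval_rpoly_simps)
qed

lemma eval_rpoly_zero_vec: "eval_rpoly h (0 :: 'k::{comm_ring_1, real_algebra_1} ^ 'n::finite) = of_real (eval_rpoly h 0)"
  by (induction h rule: rpoly_induct) (simp_all add: eval_rpoly_simps)

text \<open>One coordinate is eliminated at a time, by induction on a set \<open>V\<close> outside
  of which the point vanishes. The induction hypothesis yields a real point with the right signs on
  the finite set \<open>S\<close> that elimination asks for; the missing coordinate is any real in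
  the cell corresponding to that of \<open>x $ i\<close>.\<close>

lemma real_transfer:
  fixes x :: "'k::{real_closed_field, real_algebra_1} ^ 'n::finite"
  assumes "finite F"
  shows "\<exists>a :: real ^ 'n. \<forall>h\<in>F. sg (eval_rpoly h x) = sg (eval_rpoly h a)"
proof -
  have "\<exists>a :: real ^ 'n. (\<forall>j. j \<notin> V \<longrightarrow> a $ j = 0) \<and> (\<forall>h\<in>F. sg (eval_rpoly h x) = sg (eval_rpoly h a))"
    if "finite V" "\<And>j. j \<notin> V \<Longrightarrow> x $ j = 0" "finite F"
    for V :: "'n set" and x :: "'k ^ 'n" and F
    using that
  proof (induction V arbitrary: x F)
    case empty
    then have "x = 0" by (simp add: vec_eq_iff)
    then show ?case by (intro exI[of _ 0]) (simp add: eval_rpoly_zero_vec[where 'k = 'k] sg_of_real)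
  next
    case (insert i V)
    define x' where "x' = vec_update i 0 x"
    have x: "vec_update i 0 x' = x'" "vec_update i (x $ i) x' = x"
      by (auto simp: x'_def vec_update_def vec_eq_iff)
    have x'0: "x' $ j = 0" if "j \<notin> V" for j
      using insert.prems(1)[of j] that by (cases "j = i") (auto simp: x'_def vec_update_def)
    let ?\<sigma> = "\<lambda>c. eval_rpoly c x'"
    obtain H where H: "\<And>h (z :: 'k ^ 'n) y. eval_rpoly h (vec_update i y z) =
        poly (map_poly (\<lambda>c. eval_rpoly c (vec_update i 0 z)) (H h)) y"
      "\<And>h (z :: real ^ 'n) y. eval_rpoly h (vec_update i y z) =
        poly (map_poly (\<lambda>c. eval_rpoly c (vec_update i 0 z)) (H h)) y"
      using ex_univariate[where ?'k = 'k and ?'n = 'n and i = i] by metis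
    have "eliminable TYPE(real) ?\<sigma> (H ` F)"
      using insert.prems by (intro eliminable_finite ring_morphism_eval_rpoly) simp
    then obtain S where S: "finite S" "\<And>\<tau> :: 'n rpoly \<Rightarrow> real. ring_morphism \<tau> \<Longrightarrow> same_signs ?\<sigma> \<tau> S \<Longrightarrow>
       (\<exists>Z. matching Z \<and> (\<forall>p\<in>H ` F. sign_table Z (map_poly ?\<sigma> p) (map_poly \<tau> p)))"
      unfolding eliminable_def by blast
    obtain a :: "real ^ 'n" where a: "\<And>j. j \<notin> V \<Longrightarrow> a $ j = 0"
      "\<And>h. h \<in> S \<Longrightarrow> sg (eval_rpoly h x') = sg (eval_rpoly h a)"
      using insert.IH[of x' S] x'0 S(1) by blast
    let ?\<tau> = "\<lambda>c. eval_rpoly c a"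
    have a': "vec_update i 0 a = a" using a(1)[OF insert.hyps(2)] by (auto simp: vec_update_def vec_eq_iff)
    have "same_signs ?\<sigma> ?\<tau> S" using a(2) by (simp add: same_signs_def)
    from S(2)[OF ring_morphism_eval_rpoly this] obtain Z where
      Z: "matching Z" "\<And>p. p \<in> H ` F \<Longrightarrow> sign_table Z (map_poly ?\<sigma> p) (map_poly ?\<tau> p)" by blast
    obtain v where v: "same_cell Z (x $ i) v" using ex_same_cell[OF Z(1)] by blast
    show ?case
    proof (intro exI[of _ "vec_update i v a"] conjI allI impI ballI)
      fix j assume "j \<notin> insert i V"
      then show "vec_update i v a $ j = 0" using a(1) by (simp add: vec_update_def)
    next
      fix h assume "h \<in> F"
      then have "sg (poly (map_poly ?\<sigma> (H h)) (x $ i)) = sg (poly (map_poly ?\<tau> (H h)) v)"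
        using Z(2)[of "H h"] v unfolding sign_table_def by blast
      then show "sg (eval_rpoly h x) = sg (eval_rpoly h (vec_update i v a))"
        using H(1)[of h "x $ i" x'] H(2)[of h v a] by (simp add: x a')
    qed
  qed
  from this[of UNIV x F] show ?thesis using assms by auto
qed

text \<open>A sign table comparing \<open>q\<close> over both fields gives a real root
  \<open>v\<close> in the cell of \<open>t\<close>. It need not equal \<open>t\<close>, but
  \<open>X - v\<close> can be divided out, and the degree drops until \<open>t\<close> is one of the
  real roots.\<close>

lemma algebraic_over_real:
  fixes t :: "'k::{real_closed_field, real_algebra_1}"
  assumes "q \<noteq> 0" "poly (map_poly of_real q) t = 0"
  shows "\<exists>r. t = of_real r"
  using assms
proof (induction "degree q" arbitrary: q rule: less_induct)
  case less
  have "eliminable TYPE(real) (of_real :: real \<Rightarrow> 'k) {q}"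
    by (intro eliminable_finite ring_morphism_of_real) simp
  moreover have "ring_morphism (\<lambda>x::real. x)" "same_signs (of_real :: real \<Rightarrow> 'k) (\<lambda>x. x) S" for S
    by (simp_all add: ring_morphism_def same_signs_def sg_of_real)
  ultimately obtain Z where Z: "matching Z" "sign_table Z (map_poly of_real q :: 'k poly) (map_poly (\<lambda>x. x) q)"
    unfolding eliminable_def by blast
  obtain v where "same_cell Z t v" using ex_same_cell[OF Z(1)] by blast
  then have "poly q v = 0" using Z(2) less.prems(2) unfolding sign_table_def by (metis map_poly_id' sg_0 sg_eq_0_iff)
  then obtain g where g: "q = [:-v,1:] * g" by (metis poly_eq_0_iff_dvd dvdE)
  have g0: "g \<noteq> 0" using g less.prems by auto
  have "degree q = Suc (degree g)" unfolding g by (subst degree_mult_eq) (use g0 in auto)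
  moreover have "map_poly of_real [:-v,1:] = [:- of_real v, 1 :: 'k:]"
    by (simp add: map_poly_pCons)
  then have "(t - of_real v) * poly (map_poly of_real g) t = 0"
    using less.prems(2) unfolding g map_poly_morphism(2)[OF ring_morphism_of_real]
    by (simp add: algebra_simps)
  ultimately show ?case using less.hyps[of g] g0 by auto
qed

section \<open>The real closure of a formally real field\<close>

class formally_real_field = field +
  assumes sum_list_squares_neq: "(\<Sum>q\<leftarrow>qs. q * q) \<noteq> - 1"

lemma formally_real:
  fixes s :: "'a::formally_real_field"
  shows "sos s \<Longrightarrow> s \<noteq> - 1"
  using sum_list_squares_neq by (auto simp: sos_iff_sum_list)

text \<open>These closure properties are those of the nonnegative elements in a subfield, namely the
  set of differences of members of \<open>C\<close>, once that order is total.\<close>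

definition cone :: "'l::field set \<Rightarrow> bool" where
  "cone C \<longleftrightarrow> 1 \<in> C \<and> - 1 \<notin> C \<and> (\<forall>a\<in>C. \<forall>b\<in>C. a + b \<in> C \<and> a * b \<in> C \<and> (a - b)\<^sup>2 \<in> C) \<and>
     (\<forall>a\<in>C. inverse a \<in> C)"

lemma coneD:
  assumes "cone C"
  shows "1 \<in> C" "- 1 \<notin> C" "a \<in> C \<Longrightarrow> b \<in> C \<Longrightarrow> a + b \<in> C" "a \<in> C \<Longrightarrow> b \<in> C \<Longrightarrow> a * b \<in> C"
    "a \<in> C \<Longrightarrow> b \<in> C \<Longrightarrow> (a - b)\<^sup>2 \<in> C" "a \<in> C \<Longrightarrow> inverse a \<in> C" "0 \<in> C"
proof -
  have "1 \<in> C \<longrightarrow> (1 - 1)\<^sup>2 \<in> C" using assms unfolding cone_def by blast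
  then show "0 \<in> C" using assms by (simp add: cone_def)
qed (use assms in \<open>auto simp: cone_def\<close>)

definition sos_cone :: "'k::field alg_closure set" where
  "sos_cone = to_ac ` {s. sos s}"

lemma cone_sos_cone: "cone (sos_cone :: 'k::formally_real_field alg_closure set)"
  unfolding cone_def
proof (intro conjI ballI)
  show "1 \<in> (sos_cone :: 'k alg_closure set)"
    unfolding sos_cone_def using sos_one by (auto intro!: image_eqI[of _ _ 1])
  show "- 1 \<notin> (sos_cone :: 'k alg_closure set)"
  proof
    assume "- 1 \<in> (sos_cone :: 'k alg_closure set)"
    then obtain s :: 'k where "sos s" "to_ac s = - to_ac 1" by (auto simp: sos_cone_def)
    then have "sos s" "s = - 1" by (simp_all only: to_ac_eq_iff flip: to_ac_minus)
    then show False using formally_real[of s] by blast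
  qed
  fix a b :: "'k alg_closure" assume "a \<in> sos_cone" "b \<in> sos_cone"
  then obtain s t where st: "a = to_ac s" "sos s" "b = to_ac t" "sos t" by (auto simp: sos_cone_def)
  show "a + b \<in> sos_cone" unfolding sos_cone_def st
    using st by (intro image_eqI[of _ _ "s + t"]) (auto intro: sos_add)
  show "a * b \<in> sos_cone" unfolding sos_cone_def st
    using st by (intro image_eqI[of _ _ "s * t"]) (auto intro: sos_mult)
  show "(a - b)\<^sup>2 \<in> sos_cone" unfolding sos_cone_def st
    using st by (intro image_eqI[of _ _ "(s - t)\<^sup>2"]) (auto intro: sos_square)
next
  fix a :: "'k alg_closure" assume "a \<in> sos_cone"
  then obtain s where s: "a = to_ac s" "sos s" by (auto simp: sos_cone_def)
  have "inverse s = (inverse s)\<^sup>2 * s" by (cases "s = 0") (simp_all add: power2_eq_square)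
  then have "sos (inverse s)" using sos_square_mult[OF s(2)] by metis
  then show "inverse a \<in> sos_cone" unfolding sos_cone_def s by (intro image_eqI[of _ _ "inverse s"]) auto
qed

lemma ex_maximal_cone:
  "\<exists>C :: 'k::formally_real_field alg_closure set. cone C \<and> sos_cone \<subseteq> C \<and> (\<forall>D. cone D \<longrightarrow> C \<subseteq> D \<longrightarrow> D = C)"
proof -
  let ?F = "{C :: 'k alg_closure set. cone C \<and> sos_cone \<subseteq> C}"
  have "\<exists>M\<in>?F. \<forall>Y\<in>?F. M \<subseteq> Y \<longrightarrow> Y = M"
  proof (rule subset_Zorn_nonempty)
    show "?F \<noteq> {}" using cone_sos_cone by blast
    fix Ch assume Ch: "Ch \<noteq> {}" "subset.chain ?F Ch"
    have c: "cone C" "sos_cone \<subseteq> C" if "C \<in> Ch" for C using Ch(2) that by (auto simp: subset.chain_def)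
    have common: "\<exists>C\<in>Ch. a \<in> C \<and> b \<in> C" if "a \<in> \<Union>Ch" "b \<in> \<Union>Ch" for a b
      using that Ch(2) unfolding subset_chain_def by blast
    have "cone (\<Union>Ch)" unfolding cone_def
    proof (intro conjI ballI)
      show "1 \<in> \<Union>Ch" "- 1 \<notin> \<Union>Ch" using c(1) Ch(1) coneD(1,2) by blast+
      fix a b assume "a \<in> \<Union>Ch" "b \<in> \<Union>Ch"
      then obtain C where "C \<in> Ch" "a \<in> C" "b \<in> C" using common by blast
      then show "a + b \<in> \<Union>Ch" "a * b \<in> \<Union>Ch" "(a - b)\<^sup>2 \<in> \<Union>Ch"
        using coneD(3-5)[OF c(1)] by blast+
    next
      fix a assume "a \<in> \<Union>Ch"
      then show "inverse a \<in> \<Union>Ch" using coneD(6)[OF c(1)] by blast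
    qed
    moreover have "sos_cone \<subseteq> \<Union>Ch" using c(2) Ch(1) by fast
    ultimately show "\<Union>Ch \<in> ?F" by simp
  qed
  then obtain M where M: "M \<in> ?F" "\<forall>Y\<in>?F. M \<subseteq> Y \<longrightarrow> Y = M" by (elim bexE)
  show ?thesis
  proof (intro exI[of _ M] conjI allI impI)
    show "cone M" "sos_cone \<subseteq> M" using M(1) by simp_all
    fix D assume "cone D" "M \<subseteq> D"
    with M(1) have "D \<in> ?F" by auto
    from bspec[OF M(2) this] \<open>M \<subseteq> D\<close> show "D = M" by (rule mp)
  qed
qed

definition max_cone :: "'k::formally_real_field alg_closure set" where
  "max_cone = (SOME C. cone C \<and> sos_cone \<subseteq> C \<and> (\<forall>D. cone D \<longrightarrow> C \<subseteq> D \<longrightarrow> D = C))"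

lemma cone_max_cone: "cone max_cone"
  and sos_cone_subset_max_cone: "sos_cone \<subseteq> max_cone"
  and max_cone_maximal: "cone D \<Longrightarrow> max_cone \<subseteq> D \<Longrightarrow> D = max_cone"
  using someI_ex[OF ex_maximal_cone] unfolding max_cone_def by blast+

lemmas max_coneD = coneD[OF cone_max_cone]

lemma max_cone_antisym:
  assumes "a \<in> max_cone" "- a \<in> max_cone"
  shows "a = 0"
proof (rule ccontr)
  assume "a \<noteq> 0"
  then have "- a * inverse a = - 1" by simp
  moreover have "- a * inverse a \<in> max_cone" using assms max_coneD(4,6) by blast
  ultimately show False using max_coneD(2) by metis
qed

text \<open>If neither \<open>x\<close> nor \<open>- x\<close> belonged to the cone, the elements
  \<open>c + d * x\<close> would form a strictly larger cone. It omits \<open>- 1\<close>, as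
  \<open>- 1 = c + d * x\<close> would give \<open>- x = (1 + c) / d\<close>. Writing
  \<open>x\<close> as \<open>a - b\<close> turns every difference of its members into one of members
  of the old cone, and inverses come from \<open>s / s\<^sup>2\<close>.\<close>

lemma max_cone_diff_total:
  assumes "a \<in> max_cone" "b \<in> max_cone"
  shows "a - b \<in> max_cone \<or> b - a \<in> max_cone"
proof (rule ccontr)
  define x where "x = a - b"
  assume "\<not> (a - b \<in> max_cone \<or> b - a \<in> max_cone)"
  then have x: "x \<notin> max_cone" "- x \<notin> max_cone" by (auto simp: x_def)
  define D where "D = {c + d * x | c d. c \<in> max_cone \<and> d \<in> max_cone}"
  have DI: "c \<in> max_cone \<Longrightarrow> d \<in> max_cone \<Longrightarrow> c + d * x \<in> D" for c d by (auto simp: D_def)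
  have sq: "(c + d * x - (c' + d' * x))\<^sup>2 \<in> max_cone"
    if "c \<in> max_cone" "d \<in> max_cone" "c' \<in> max_cone" "d' \<in> max_cone" for c d c' d'
  proof -
    have "c + d * x - (c' + d' * x) = (c + d * a + d' * b) - (c' + d * b + d' * a)"
      by (simp add: x_def algebra_simps)
    then show ?thesis using that assms by (metis max_coneD(3,4,5))
  qed
  have x2: "x\<^sup>2 \<in> max_cone" using assms max_coneD(5) by (simp add: x_def)
  have sub: "max_cone \<subseteq> D" using DI[OF _ max_coneD(7)] by force
  have "cone D" unfolding cone_def
  proof (intro conjI ballI)
    show "1 \<in> D" using sub max_coneD(1) by blast
    show "- 1 \<notin> D"
    proof
      assume "- 1 \<in> D"
      then obtain c d where cd: "- 1 = c + d * x" "c \<in> max_cone" "d \<in> max_cone" by (auto simp: D_def)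
      have "d \<noteq> 0" using cd max_coneD(2) by auto
      have "(1 + c) + d * x = 1 + (c + d * x)" by (simp only: add.assoc)
      also have "\<dots> = 0" by (simp flip: cd(1))
      finally have "1 + c = d * - x" by (simp add: eq_neg_iff_add_eq_0)
      then have "- x = (1 + c) * inverse d" using \<open>d \<noteq> 0\<close> by simp
      then show False using x(2) cd max_coneD(1,3,4,6) by metis
    qed
    fix s t assume "s \<in> D" "t \<in> D"
    then obtain c d c' d' where st: "s = c + d * x" "t = c' + d' * x"
      and m: "c \<in> max_cone" "d \<in> max_cone" "c' \<in> max_cone" "d' \<in> max_cone" by (auto simp: D_def)
    have "s + t = (c + c') + (d + d') * x" by (simp add: st algebra_simps)
    then show "s + t \<in> D" using DI m max_coneD(3) by metis
    have "s * t = (c * c' + d * d' * x\<^sup>2) + (c * d' + d * c') * x"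
      by (simp add: st algebra_simps power2_eq_square)
    then show "s * t \<in> D" using DI m x2 max_coneD(3,4) by metis
    show "(s - t)\<^sup>2 \<in> D" using sq[OF m] sub by (auto simp: st)
  next
    fix s assume "s \<in> D"
    then obtain c d where s: "s = c + d * x" "c \<in> max_cone" "d \<in> max_cone" by (auto simp: D_def)
    have "s\<^sup>2 \<in> max_cone" using sq[OF s(2,3) max_coneD(7,7)] by (simp add: s)
    then have i: "inverse (s\<^sup>2) \<in> max_cone" by (rule max_coneD)
    have "inverse s = c * inverse (s\<^sup>2) + d * inverse (s\<^sup>2) * x"
    proof -
      have "inverse s = s * inverse (s\<^sup>2)" by (cases "s = 0") (simp_all add: power2_eq_square)
      then show ?thesis by (simp add: s(1) algebra_simps)
    qed
    then show "inverse s \<in> D" using DI i s max_coneD(4) by metis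
  qed
  then have "D = max_cone" using sub by (rule max_cone_maximal)
  moreover have "x \<in> D" using DI[OF max_coneD(7,1)] by simp
  ultimately show False using x by simp
qed

section \<open>The ordered field of differences of the maximal cone\<close>

typedef (overloaded) 'k real_closure = "{x :: 'k::formally_real_field alg_closure. x \<in> max_cone \<or> - x \<in> max_cone}"
  using max_coneD(7) by blast

setup_lifting type_definition_real_closure

text \<open>The left side makes totality of the order evident, the right side closure under
  subtraction.\<close>

lemma real_closure_carrier_iff:
  "x \<in> max_cone \<or> - x \<in> max_cone \<longleftrightarrow> (\<exists>a\<in>max_cone. \<exists>b\<in>max_cone. x = a - b)"
proof
  assume "x \<in> max_cone \<or> - x \<in> max_cone"
  then show "\<exists>a\<in>max_cone. \<exists>b\<in>max_cone. x = a - b"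
    using max_coneD(7) by (metis diff_0 diff_zero minus_minus)
qed (use max_cone_diff_total in force)

lemma real_closure_diff:
  assumes "x \<in> max_cone \<or> - x \<in> max_cone" "y \<in> max_cone \<or> - y \<in> max_cone"
  shows "x - y \<in> max_cone \<or> - (x - y) \<in> max_cone"
proof -
  obtain a b c d where *: "a \<in> max_cone" "b \<in> max_cone" "c \<in> max_cone" "d \<in> max_cone"
    "x = a - b" "y = c - d" using assms unfolding real_closure_carrier_iff by blast
  then have "x - y = (a + d) - (b + c)" by simp
  then show ?thesis unfolding real_closure_carrier_iff using * max_coneD(3) by metis
qed

instantiation real_closure :: (formally_real_field) linordered_field
begin

lift_definition zero_real_closure :: "'a real_closure" is 0 using max_coneD(7) by blast
lift_definition one_real_closure :: "'a real_closure" is 1 using max_coneD(1) by blast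
lift_definition uminus_real_closure :: "'a real_closure \<Rightarrow> 'a real_closure" is uminus by auto
lift_definition minus_real_closure :: "'a real_closure \<Rightarrow> 'a real_closure \<Rightarrow> 'a real_closure" is "(-)"
  by (rule real_closure_diff)
lift_definition plus_real_closure :: "'a real_closure \<Rightarrow> 'a real_closure \<Rightarrow> 'a real_closure" is "(+)"
  by (metis real_closure_diff diff_minus_eq_add minus_minus)
lift_definition times_real_closure :: "'a real_closure \<Rightarrow> 'a real_closure \<Rightarrow> 'a real_closure" is "(*)"
  by (metis max_coneD(4) minus_mult_minus mult_minus_left mult_minus_right)
lift_definition inverse_real_closure :: "'a real_closure \<Rightarrow> 'a real_closure" is inverse
  by (metis max_coneD(6) inverse_minus_eq)
definition divide_real_closure :: "'a real_closure \<Rightarrow> 'a real_closure \<Rightarrow> 'a real_closure" where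
  "divide_real_closure x y = x * inverse y"
lift_definition less_eq_real_closure :: "'a real_closure \<Rightarrow> 'a real_closure \<Rightarrow> bool" is "\<lambda>x y. y - x \<in> max_cone" .
definition less_real_closure :: "'a real_closure \<Rightarrow> 'a real_closure \<Rightarrow> bool" where
  "less_real_closure x y \<longleftrightarrow> x \<le> y \<and> \<not> y \<le> x"
definition abs_real_closure :: "'a real_closure \<Rightarrow> 'a real_closure" where
  "abs_real_closure x = (if x < 0 then - x else x)"
definition sgn_real_closure :: "'a real_closure \<Rightarrow> 'a real_closure" where
  "sgn_real_closure x = (if x = 0 then 0 else if 0 < x then 1 else - 1)"

instance
proof
  fix x y z :: "'a real_closure"
  show "x + y + z = x + (y + z)" by transfer simp
  show "x + y = y + x" by transfer simp
  show "0 + x = x" by transfer simp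
  show "- x + x = 0" by transfer simp
  show "x + y - x = y" by transfer simp
  show "x - y - z = x - (y + z)" by transfer simp
  show "0 * x = 0" by transfer simp
  show "x * 0 = 0" by transfer simp
  show "x - y = x + - y" by transfer simp
  show "x * y * z = x * (y * z)" by transfer simp
  show "x * y = y * x" by transfer simp
  show "1 * x = x" by transfer simp
  show "(x + y) * z = x * z + y * z" by transfer (simp add: distrib_right)
  show "(0 :: 'a real_closure) \<noteq> 1" by transfer simp
  show "inverse (0 :: 'a real_closure) = 0" by transfer simp
  show "x div y = x * inverse y" by (rule divide_real_closure_def)
  show "x \<noteq> 0 \<Longrightarrow> inverse x * x = 1" by transfer simp
  show "x < y \<longleftrightarrow> x \<le> y \<and> \<not> y \<le> x" by (rule less_real_closure_def)
  have refl: "a \<le> a" for a :: "'a real_closure" by transfer (simp add: max_coneD(7))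
  show "x \<le> x" by (rule refl)
  show "x \<le> y \<Longrightarrow> y \<le> z \<Longrightarrow> x \<le> z"
  proof (transfer, goal_cases)
    case (1 x y z)
    then show ?case using max_coneD(3)[of "y - x" "z - y"] by simp
  qed
  have antisym: "a \<le> b \<Longrightarrow> b \<le> a \<Longrightarrow> a = b" for a b :: "'a real_closure"
  proof (transfer, goal_cases)
    case (1 a b)
    then have "b - a = 0" using max_cone_antisym[of "b - a"] by simp
    then show ?case by simp
  qed
  show "x \<le> y \<Longrightarrow> y \<le> x \<Longrightarrow> x = y" by (rule antisym)
  show "x \<le> y \<or> y \<le> x" 
  proof (transfer, goal_cases)
    case (1 x y)
    then show ?case using real_closure_diff[of x y] by auto
  qed
  show "x \<le> y \<Longrightarrow> z + x \<le> z + y" by transfer simp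
  show "\<bar>x\<bar> = (if x < 0 then - x else x)" by (rule abs_real_closure_def)
  show "sgn x = (if x = 0 then 0 else if 0 < x then 1 else - 1)" by (rule sgn_real_closure_def)
  have less_iff: "a < b \<longleftrightarrow> a \<le> b \<and> a \<noteq> b" for a b :: "'a real_closure"
    using refl antisym by (auto simp: less_real_closure_def)
  have "x \<le> y \<Longrightarrow> 0 \<le> z \<Longrightarrow> z * x \<le> z * y"
    by transfer (simp add: max_coneD(4) flip: right_diff_distrib)
  moreover have "x \<noteq> y \<Longrightarrow> z \<noteq> 0 \<Longrightarrow> z * x \<noteq> z * y" by transfer simp
  ultimately show "x < y \<Longrightarrow> 0 < z \<Longrightarrow> z * x < z * y" by (auto simp: less_iff)
qed

end

section \<open>Simple algebraic extensions and the intermediate value property of the real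
  closure\<close>

inductive_set weighted_sos :: "'k::formally_real_field alg_closure set \<Rightarrow> 'k alg_closure set" for E where
  zero: "0 \<in> weighted_sos E"
| step: "c \<in> max_cone \<Longrightarrow> u \<in> E \<Longrightarrow> s \<in> weighted_sos E \<Longrightarrow> c * u\<^sup>2 + s \<in> weighted_sos E"

lemma weighted_sos_add: "s \<in> weighted_sos E \<Longrightarrow> t \<in> weighted_sos E \<Longrightarrow> s + t \<in> weighted_sos E"
  by (induction rule: weighted_sos.induct) (auto simp: add.assoc intro: weighted_sos.intros)

lemma weighted_sos_scale:
  assumes E: "\<And>a b. a \<in> E \<Longrightarrow> b \<in> E \<Longrightarrow> a * b \<in> E" and cu: "c \<in> max_cone" "u \<in> E"
    and s: "s \<in> weighted_sos E"
  shows "c * u\<^sup>2 * s \<in> weighted_sos E"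
  using s
proof (induction rule: weighted_sos.induct)
  case (step d v s)
  have "c * d * (u * v)\<^sup>2 + c * u\<^sup>2 * s \<in> weighted_sos E"
    using step cu E max_coneD(4) by (intro weighted_sos.step) auto
  then show ?case by (simp add: algebra_simps power_mult_distrib)
qed (simp add: weighted_sos.zero)

lemma weighted_sos_mult:
  assumes E: "\<And>a b. a \<in> E \<Longrightarrow> b \<in> E \<Longrightarrow> a * b \<in> E"
    and s: "s \<in> weighted_sos E" and t: "t \<in> weighted_sos E"
  shows "s * t \<in> weighted_sos E"
  using s
  by (induction rule: weighted_sos.induct)
    (auto simp: distrib_right intro: weighted_sos.zero weighted_sos_add weighted_sos_scale[OF E _ _ t])

text \<open>If \<open>- 1\<close> is not a weighted sum of squares from the field \<open>E\<close>,
  these sums form a cone above \<open>max_cone\<close>, so they coincide with it by maximality.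
  Hence every square of \<open>E\<close> lies in \<open>max_cone\<close>, and \<open>x\<close> is a
  difference of such elements via \<open>4 * x = (x + 1)\<^sup>2 - (x - 1)\<^sup>2\<close>.\<close>

lemma max_cone_extend:
  assumes E: "1 \<in> E" "\<And>a b. a \<in> E \<Longrightarrow> b \<in> E \<Longrightarrow> a + b \<in> E" "\<And>a b. a \<in> E \<Longrightarrow> b \<in> E \<Longrightarrow> a * b \<in> E"
    "\<And>a. a \<in> E \<Longrightarrow> - a \<in> E" "\<And>a. a \<in> E \<Longrightarrow> inverse a \<in> E"
    and sub: "max_cone \<subseteq> E" and no: "- 1 \<notin> weighted_sos E" and x: "x \<in> E"
  shows "x \<in> max_cone \<or> - x \<in> max_cone"
proof -
  have sq: "u\<^sup>2 \<in> weighted_sos E" if "u \<in> E" for u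
    using weighted_sos.step[OF max_coneD(1) that weighted_sos.zero] by simp
  have wE: "s \<in> E" if "s \<in> weighted_sos E" for s
    using that by (induction rule: weighted_sos.induct)
      (use E sub max_coneD(7) in \<open>auto simp: power2_eq_square\<close>)
  have "cone (weighted_sos E)" unfolding cone_def
  proof (intro conjI ballI no)
    show "1 \<in> weighted_sos E" using sq[OF E(1)] by simp
    fix a b assume ab: "a \<in> weighted_sos E" "b \<in> weighted_sos E"
    then show "a + b \<in> weighted_sos E" by (rule weighted_sos_add)
    show "a * b \<in> weighted_sos E" using E(3) ab by (rule weighted_sos_mult)
    show "(a - b)\<^sup>2 \<in> weighted_sos E" using sq[of "a - b"] E(2)[of a "- b"] E(4)[of b] ab wE by simp
  next
    fix a assume a: "a \<in> weighted_sos E"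
    have "inverse a = 1 * (inverse a)\<^sup>2 * a" by (cases "a = 0") (simp_all add: power2_eq_square)
    also have "\<dots> \<in> weighted_sos E"
      using E a wE max_coneD(1) by (intro weighted_sos_scale) auto
    finally show "inverse a \<in> weighted_sos E" .
  qed
  moreover have "max_cone \<subseteq> weighted_sos E"
    using weighted_sos.step[OF _ E(1) weighted_sos.zero] by auto
  ultimately have eq: "weighted_sos E = max_cone" by (rule max_cone_maximal)
  have "x + 1 \<in> E" "x + - 1 \<in> E" using E(1,2,4) x by blast+
  then have "(x + 1)\<^sup>2 \<in> max_cone" "(x - 1)\<^sup>2 \<in> max_cone"
    using sq[of "x + 1"] sq[of "x + - 1"] eq by auto
  moreover have four: "4 \<in> (max_cone :: 'a alg_closure set)" "4 \<noteq> (0 :: 'a alg_closure)"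
  proof -
    have 2: "2 \<in> (max_cone :: 'a alg_closure set)" using max_coneD(3)[OF max_coneD(1,1)] by simp
    show "4 \<in> (max_cone :: 'a alg_closure set)" using max_coneD(3)[OF 2 2] by simp
    have "3 \<in> (max_cone :: 'a alg_closure set)" using max_coneD(3)[OF 2 max_coneD(1)] by simp
    then have "(3 :: 'a alg_closure) \<noteq> - 1" using max_coneD(2) by metis
    then show "4 \<noteq> (0 :: 'a alg_closure)" by (simp add: eq_neg_iff_add_eq_0)
  qed
  ultimately have "inverse 4 * (x + 1)\<^sup>2 \<in> max_cone" "inverse 4 * (x - 1)\<^sup>2 \<in> max_cone"
    using max_coneD(4,6) by blast+
  moreover have "x = inverse 4 * (x + 1)\<^sup>2 - inverse 4 * (x - 1)\<^sup>2"
  proof -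
    have "inverse 4 * (x + 1)\<^sup>2 - inverse 4 * (x - 1)\<^sup>2 = inverse 4 * (4 * x)"
      by (simp add: algebra_simps power2_eq_square)
    also have "\<dots> = x" using four(2) by simp
    finally show ?thesis by simp
  qed
  ultimately show ?thesis unfolding real_closure_carrier_iff by blast
qed

lemma ring_morphism_Rep: "ring_morphism (Rep_real_closure :: 'k::formally_real_field real_closure \<Rightarrow> 'k alg_closure)"
  by (simp add: ring_morphism_def one_real_closure.rep_eq plus_real_closure.rep_eq times_real_closure.rep_eq)

lemmas map_poly_Rep = map_poly_morphism[OF ring_morphism_Rep]

abbreviation lift_eval :: "'k::formally_real_field alg_closure \<Rightarrow> 'k real_closure poly \<Rightarrow> 'k alg_closure" where
  "lift_eval z p \<equiv> poly (map_poly Rep_real_closure p) z"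

lemma ring_morphism_lift_eval: "ring_morphism (lift_eval z)"
  unfolding ring_morphism_def by (simp add: map_poly_Rep one_real_closure.rep_eq)

lemmas lift_eval_simps = ring_morphismD[OF ring_morphism_lift_eval]

lemma lift_eval_const: "lift_eval z [:c:] = Rep_real_closure c"
  by (simp add: map_poly_Rep)

lemma lift_eval_mod:
  assumes "lift_eval z p = 0"
  shows "lift_eval z (g mod p) = lift_eval z g"
proof -
  have "lift_eval z (p * (g div p) + g mod p) = lift_eval z g" by (simp only: mult_div_mod_eq)
  then show ?thesis unfolding lift_eval_simps using assms by simp
qed

lemma max_cone_iff: "Rep_real_closure c \<in> max_cone \<longleftrightarrow> 0 \<le> c"
  by (simp add: less_eq_real_closure.rep_eq zero_real_closure.rep_eq)

text \<open>With \<open>p = g * q + r\<close>, the inverse of \<open>g\<close> at \<open>z\<close>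
  is \<open>- q / r\<close>, which leads to the inverse of a polynomial of smaller degree and
  finally to a constant. Minimality of \<open>p\<close> rules out \<open>r = 0\<close>.\<close>

lemma lift_eval_inverse:
  assumes p: "p \<noteq> 0" "lift_eval z p = 0"
    and min: "\<And>g. g \<noteq> 0 \<Longrightarrow> lift_eval z g = 0 \<Longrightarrow> degree p \<le> degree g"
  shows "\<exists>g'. lift_eval z g' = inverse (lift_eval z g)"
proof -
  have small: "\<exists>g'. lift_eval z g' = inverse (lift_eval z g)" if "degree g < degree p" for g
    using that
  proof (induction "degree g" arbitrary: g rule: less_induct)
    case less
    show ?case
    proof (cases "degree g = 0")
      case True
      then obtain c where c: "g = [:c:]" by (metis degree_eq_zeroE)
      show ?thesis
        by (intro exI[of _ "[:inverse c:]"]) (simp add: c lift_eval_const inverse_real_closure.rep_eq)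
    next
      case False
      then have g: "g \<noteq> 0" by auto
      define q r where "q = p div g" and "r = p mod g"
      have pqr: "p = g * q + r" by (simp add: q_def r_def)
      have r: "degree r < degree g" using degree_mod_less[OF g, of p] False by (auto simp: r_def)
      from less.hyps[OF r] less.prems r obtain r' where r': "lift_eval z r' = inverse (lift_eval z r)" by fastforce
      have e: "lift_eval z g * lift_eval z q = - lift_eval z r"
        using p(2) arg_cong[OF pqr, of "lift_eval z"] by (simp add: lift_eval_simps eq_neg_iff_add_eq_0)
      have "r \<noteq> 0"
      proof
        assume "r = 0"
        then have "p = g * q" "g \<noteq> 0" "q \<noteq> 0" using pqr p(1) by auto
        then have "degree q < degree p" using False by (simp add: degree_mult_eq)
        then have "lift_eval z q \<noteq> 0" using min[OF \<open>q \<noteq> 0\<close>] by auto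
        moreover have "lift_eval z g \<noteq> 0" using min[OF g] less.prems by auto
        ultimately show False using e \<open>r = 0\<close> by (simp add: lift_eval_simps)
      qed
      then have "lift_eval z r \<noteq> 0" using min[of r] r less.prems by auto
      then have "lift_eval z (- (q * r')) * lift_eval z g = 1"
        using e by (simp add: lift_eval_simps r' algebra_simps) (simp add: field_simps)
      then show ?thesis by (metis inverse_unique mult.commute)
    qed
  qed
  have "lift_eval z (g mod p) = lift_eval z g" using p(2) by (rule lift_eval_mod)
  moreover have "degree p \<noteq> 0"
    using p by (metis degree_eq_zeroE lift_eval_const pCons_0_0 zero_real_closure.rep_eq Rep_real_closure_inject)
  then have "degree (g mod p) < degree p" using degree_mod_less[OF p(1), of g] by auto
  ultimately show ?thesis using small[of "g mod p"] by simp
qed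

text \<open>Lifts \<open>weighted_sos\<close> to polynomials and keeps a degree bound, on which the
  degree count in \<open>sign_change_root\<close> depends.\<close>

inductive poly_wsos :: "'a::linordered_field poly \<Rightarrow> nat \<Rightarrow> bool" where
  zero: "poly_wsos 0 n"
| step: "0 \<le> c \<Longrightarrow> degree g \<le> n \<Longrightarrow> poly_wsos s n \<Longrightarrow> poly_wsos (smult c (g\<^sup>2) + s) n"

lemma poly_wsos_nonneg: "poly_wsos s n \<Longrightarrow> 0 \<le> poly s x"
  by (induction rule: poly_wsos.induct) auto

lemma poly_wsos_degree: "poly_wsos s n \<Longrightarrow> degree s \<le> 2 * n"
proof (induction rule: poly_wsos.induct)
  case (step c g n s)
  have "degree (smult c (g\<^sup>2)) \<le> 2 * n"
    using degree_smult_le[of c "g\<^sup>2"] degree_power_le[of g 2] step(2) by linarith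
  then show ?case using step by (intro degree_add_le) auto
qed simp

lemma weighted_sos_lift:
  assumes p: "p \<noteq> 0" "lift_eval z p = 0" "degree p = Suc n"
    and s: "s \<in> weighted_sos (range (lift_eval z))"
  shows "\<exists>g. s = lift_eval z g \<and> poly_wsos g n"
  using s
proof (induction rule: weighted_sos.induct)
  case zero
  show ?case by (intro exI[of _ 0]) (simp add: poly_wsos.zero lift_eval_simps)
next
  case (step c u s)
  then obtain g h where gh: "s = lift_eval z g" "poly_wsos g n" "u = lift_eval z h" by blast
  define d where "d = Abs_real_closure c"
  have d: "c = Rep_real_closure d" using step(1) by (simp add: d_def Abs_real_closure_inverse)
  have "degree (h mod p) \<le> n" using degree_mod_less[OF p(1), of h] p(3) by auto
  moreover have "lift_eval z (h mod p) = lift_eval z h" using p(2) by (rule lift_eval_mod)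
  moreover have "0 \<le> d" using step(1) by (simp add: d max_cone_iff)
  moreover have "lift_eval z (smult d f) = Rep_real_closure d * lift_eval z f" for f
    by (simp add: map_poly_Rep)
  ultimately show ?case using gh
    by (intro exI[of _ "smult d ((h mod p)\<^sup>2) + g"]) (auto simp: d lift_eval_simps intro: poly_wsos.step)
qed

text \<open>A rootless \<open>p\<close> with a sign change would have least degree among the
  polynomials vanishing at one of its roots \<open>z\<close> in the algebraic closure. Were
  \<open>- 1\<close> a weighted sum of squares in the field of \<open>z\<close>, then
  \<open>1 + g = p * q\<close> with \<open>g\<close> nonnegative everywhere and \<open>q\<close> of
  smaller degree than \<open>p\<close>. As \<open>p * q\<close> is positive, \<open>q\<close>
  changes sign with \<open>p\<close>, and its root contradicts \<open>1 + g > 0\<close>. So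
  \<open>max_cone_extend\<close> applies and \<open>z\<close> already lies in the real
  closure.\<close>

lemma sign_change_root:
  fixes p :: "'k::formally_real_field real_closure poly"
  assumes "poly p a * poly p b < 0"
  shows "\<exists>x. poly p x = 0"
  using assms
proof (induction "degree p" arbitrary: p a b rule: less_induct)
  case less
  show ?case
  proof (rule ccontr)
    assume no: "\<not> (\<exists>x. poly p x = 0)"
    have dp: "degree p \<noteq> 0"
    proof
      assume "degree p = 0"
      then obtain c where "p = [:c:]" by (metis degree_eq_zeroE)
      then show False using less.prems by (simp add: mult_less_0_iff)
    qed
    then have p0: "p \<noteq> 0" by auto
    have "degree (map_poly Rep_real_closure p) = degree p"
      using p0 by (intro map_poly_degree_eq) (metis Rep_real_closure_inject leading_coeff_0_iff zero_real_closure.rep_eq)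
    then obtain z where z: "lift_eval z p = 0"
      using alg_closed_imp_poly_has_root[of "map_poly Rep_real_closure p"] dp by auto
    have min: "degree p \<le> degree g" if g: "g \<noteq> 0" "lift_eval z g = 0" for g
    proof -
      obtain m where m: "m \<noteq> 0 \<and> lift_eval z m = 0" "\<And>g. g \<noteq> 0 \<and> lift_eval z g = 0 \<Longrightarrow> degree m \<le> degree g"
        using ex_has_least_nat[of "\<lambda>g. g \<noteq> 0 \<and> lift_eval z g = 0" p degree] p0 z by blast
      have dm: "degree m \<noteq> 0"
        using m(1) by (metis degree_eq_zeroE lift_eval_const pCons_0_0 zero_real_closure.rep_eq Rep_real_closure_inject)
      have "lift_eval z (p mod m) = 0"
        using lift_eval_mod[where p = m and g = p] m(1) z by simp
      moreover have "p mod m = 0 \<or> degree (p mod m) < degree m"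
        using degree_mod_less[of m p] m(1) by auto
      ultimately have "p mod m = 0" using m(2)[of "p mod m"] by (meson not_le)
      then obtain e where e: "p = m * e" by (metis mod_eq_0_iff_dvd dvdE)
      then have e0: "e \<noteq> 0" using p0 by auto
      have deg: "degree p = degree m + degree e" using m(1) e0 by (simp add: e degree_mult_eq)
      \<comment> \<open>In a proper factorization one factor changes sign between \<open>a\<close>
        and \<open>b\<close>; its root, given by induction, would be a root of
        \<open>p\<close>.\<close>
      have "degree e = 0"
      proof (rule ccontr)
        assume de: "degree e \<noteq> 0"
        have "(poly m a * poly m b) * (poly e a * poly e b) < 0" using less.prems by (simp add: e algebra_simps)
        then have "poly m a * poly m b < 0 \<or> poly e a * poly e b < 0" by (auto simp: mult_less_0_iff)
        then have "\<exists>x. poly m x = 0 \<or> poly e x = 0"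
          using less.hyps[of m a b] less.hyps[of e a b] deg de dm by auto
        then show False using no by (auto simp: e)
      qed
      then show ?thesis using deg m(2)[of g] g by simp
    qed
    let ?E = "range (lift_eval z)"
    obtain n where n: "degree p = Suc n" using dp not0_implies_Suc by blast
    have "- 1 \<notin> weighted_sos ?E"
    proof
      assume "- 1 \<in> weighted_sos ?E"
      from weighted_sos_lift[OF p0 z n this] obtain g where g: "- 1 = lift_eval z g" "poly_wsos g n" by blast
      define G where "G = 1 + g"
      have G: "lift_eval z G = 0" using g by (simp add: G_def lift_eval_simps flip: g(1))
      have Gpos: "0 < poly G x" for x using poly_wsos_nonneg[OF g(2), of x] by (simp add: G_def add_pos_nonneg)
      have dG: "degree G \<le> 2 * n" unfolding G_def using poly_wsos_degree[OF g(2)] by (intro degree_add_le) auto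
      have "lift_eval z (G mod p) = 0"
        using lift_eval_mod[OF z] G by simp
      moreover have "G mod p = 0 \<or> degree (G mod p) < degree p"
        using degree_mod_less[OF p0, of G] by auto
      ultimately have "G mod p = 0" using min[of "G mod p"] by (meson not_le)
      then obtain q where q: "G = p * q" by (metis mod_eq_0_iff_dvd dvdE)
      have "G \<noteq> 0" using Gpos[of 0] by auto
      then have "degree G = degree p + degree q" unfolding q by (subst degree_mult_eq) auto
      then have dq: "degree q < degree p" using dG n by simp
      have "0 < (poly p a * poly p b) * (poly q a * poly q b)"
        using mult_pos_pos[OF Gpos[of a] Gpos[of b]] by (simp add: q algebra_simps)
      then have "poly q a * poly q b < 0" using less.prems by (metis zero_less_mult_iff order.asym)
      from less.hyps[OF dq this] obtain x where "poly q x = 0" by blast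
      then show False using Gpos[of x] by (simp add: q)
    qed
    moreover have "max_cone \<subseteq> ?E"
    proof
      fix c :: "'k alg_closure" assume "c \<in> max_cone"
      then have "c = Rep_real_closure (Abs_real_closure c)" by (simp add: Abs_real_closure_inverse)
      then obtain d where "c = Rep_real_closure d" by blast
      then show "c \<in> ?E" by (intro image_eqI[of _ _ "[:d:]"]) (simp_all add: lift_eval_const)
    qed
    moreover have "z \<in> ?E"
      by (intro image_eqI[of _ _ "[:0,1:]"]) (simp_all add: map_poly_pCons zero_real_closure.rep_eq one_real_closure.rep_eq)
    ultimately have "z \<in> max_cone \<or> - z \<in> max_cone"
    proof (intro max_cone_extend[of ?E z])
      show "1 \<in> ?E" by (intro image_eqI[of _ _ 1]) (simp_all add: lift_eval_simps)
      fix x y assume "x \<in> ?E" "y \<in> ?E"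
      then obtain g h where gh: "x = lift_eval z g" "y = lift_eval z h" by blast
      show "x + y \<in> ?E" by (intro image_eqI[of _ _ "g + h"]) (simp_all add: gh lift_eval_simps)
      show "x * y \<in> ?E" by (intro image_eqI[of _ _ "g * h"]) (simp_all add: gh lift_eval_simps)
    next
      fix x assume "x \<in> ?E"
      then obtain g where g: "x = lift_eval z g" by blast
      show "- x \<in> ?E" by (intro image_eqI[of _ _ "- g"]) (simp_all add: g lift_eval_simps)
      show "inverse x \<in> ?E" using lift_eval_inverse[OF p0 z min, of g] unfolding g by (metis rangeI)
    qed auto
    then have "z = Rep_real_closure (Abs_real_closure z)" by (simp add: Abs_real_closure_inverse)
    then obtain c where c: "z = Rep_real_closure c" by blast
    have "lift_eval (Rep_real_closure c) q = Rep_real_closure (poly q c)" for q :: "'k real_closure poly"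
      by (induction q) (simp_all add: map_poly_pCons ring_morphismD[OF ring_morphism_Rep])
    then have "Rep_real_closure (poly p c) = Rep_real_closure 0" using z by (simp add: c zero_real_closure.rep_eq)
    then show False using no by (simp add: Rep_real_closure_inject)
  qed
qed

instance real_closure :: (formally_real_field) real_closed_field
proof
  \<comment> \<open>A sign change yields a root that may lie anywhere. A root \<open>w\<close>
    outside the interval contributes a factor of equal sign at both ends, so it can be divided
    out.\<close>
  have main: "\<exists>x. a < x \<and> x < b \<and> poly p x = 0" if "a < b" "poly p a * poly p b < 0"
    for a b and p :: "'a real_closure poly"
    using that
  proof (induction "degree p" arbitrary: p rule: less_induct)
    case less
    obtain w where w: "poly p w = 0" using sign_change_root[OF less.prems(2)] by blast
    then obtain q where q: "p = [:-w,1:] * q" by (metis poly_eq_0_iff_dvd dvdE)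
    have "q \<noteq> 0" using less.prems(2) by (auto simp: q)
    then have "degree p = Suc (degree q)" unfolding q by (subst degree_mult_eq) auto
    show ?case
    proof (cases "a < w \<and> w < b")
      case False
      have "w \<noteq> a" "w \<noteq> b" using less.prems(2) w by auto
      then have "w < a \<or> b < w" using False by auto
      then have "0 < (a - w) * (b - w)" using less.prems(1) by (auto intro: mult_neg_neg mult_pos_pos)
      moreover have "poly p a * poly p b = (a - w) * (b - w) * (poly q a * poly q b)" by (simp add: q algebra_simps)
      ultimately have "poly q a * poly q b < 0" using less.prems(2) by (metis mult_less_0_iff order.asym)
      then show ?thesis using less.hyps[of q] less.prems(1) \<open>degree p = _\<close> by (auto simp: q)
    qed (use w in auto)
  qed
  fix a b :: "'a real_closure" and f n
  assume ab: "a < b" "(\<Sum>k\<le>n. f k * a ^ k) < 0" "0 < (\<Sum>k\<le>n. f k * b ^ k)"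
  have "poly (\<Sum>k\<le>n. monom (f k) k) x = (\<Sum>k\<le>n. f k * x ^ k)" for x
    by (simp add: poly_sum poly_monom)
  then show "\<exists>x. a < x \<and> x < b \<and> (\<Sum>k\<le>n. f k * x ^ k) = 0"
    using main[of a b "\<Sum>k\<le>n. monom (f k) k"] ab by (simp add: mult_neg_pos)
qed

section \<open>The embedding of a formally real field into its real closure\<close>

definition to_real_closure :: "'k::formally_real_field \<Rightarrow> 'k real_closure" where
  "to_real_closure x = Abs_real_closure (to_ac x)"

lemma Rep_to_real_closure: "Rep_real_closure (to_real_closure x) = to_ac x"
proof -
  have sq: "to_ac (s\<^sup>2) \<in> max_cone" for s :: 'a
    using sos_cone_subset_max_cone sos_square[of s] by (auto simp: sos_cone_def)
  have "(4::'a) \<noteq> 0"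
  proof -
    have "sos (1\<^sup>2 + (1\<^sup>2 + (1\<^sup>2 + 0)) :: 'a)" by (intro sos.intros)
    then show ?thesis using formally_real[of "3 :: 'a"] by (simp add: eq_neg_iff_add_eq_0)
  qed
  moreover have "((x + 1) / 2)\<^sup>2 - ((x - 1) / 2)\<^sup>2 = ((x + 1)\<^sup>2 - (x - 1)\<^sup>2) / 4"
    by (simp only: power_divide diff_divide_distrib[symmetric]) (simp add: power2_eq_square)
  moreover have "(x + 1)\<^sup>2 - (x - 1)\<^sup>2 = 4 * x" by (simp add: algebra_simps power2_eq_square)
  ultimately have "x = ((x + 1) / 2)\<^sup>2 - ((x - 1) / 2)\<^sup>2" by simp
  then have "to_ac x = to_ac (((x + 1) / 2)\<^sup>2) - to_ac (((x - 1) / 2)\<^sup>2)" by (metis to_ac_diff)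
  then have "to_ac x \<in> max_cone \<or> - to_ac x \<in> max_cone"
    unfolding real_closure_carrier_iff using sq by blast
  then show ?thesis unfolding to_real_closure_def by (simp add: Abs_real_closure_inverse)
qed

lemma ring_morphism_to_real_closure: "ring_morphism to_real_closure"
  unfolding ring_morphism_def Rep_real_closure_inject[symmetric]
  by (simp add: Rep_to_real_closure one_real_closure.rep_eq plus_real_closure.rep_eq times_real_closure.rep_eq)

lemma to_real_closure_eq_0_iff: "to_real_closure x = 0 \<longleftrightarrow> x = 0"
  unfolding Rep_real_closure_inject[symmetric] by (simp add: Rep_to_real_closure zero_real_closure.rep_eq)

section \<open>The residue field of a real prime ideal\<close>

text \<open>The residue field of a real prime ideal has to be a type, so the ideal is fixed once and for
  all: if some real prime ideal violates the two properties wanted below, then \<open>test_ideal\<close> does.\<close>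

definition exceptional :: "'n::finite rpoly set \<Rightarrow> bool" where
  "exceptional J \<longleftrightarrow> (\<exists>q\<in>J. \<forall>x :: real ^ 'n. eval_rpoly q x \<noteq> 0) \<or>
     (\<exists>f. (\<forall>i. partial i f \<in> J) \<and> (\<forall>c. f - Const c \<notin> J))"

definition test_ideal :: "'n::finite rpoly set" where
  "test_ideal = (SOME J. real_prime J \<and> ((\<exists>J :: 'n rpoly set. real_prime J \<and> exceptional J) \<longrightarrow> exceptional J))"

lemma sos_eval_nonneg: "sos t \<Longrightarrow> 0 \<le> eval_rpoly t (x :: real ^ 'n::finite)"
  by (induction rule: sos.induct) (simp_all add: eval_rpoly_simps)

lemma test_ideal_spec:
  "real_prime (test_ideal :: 'n::finite rpoly set) \<and>
    ((\<exists>J :: 'n rpoly set. real_prime J \<and> exceptional J) \<longrightarrow> exceptional (test_ideal :: 'n rpoly set))"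
proof -
  \<comment> \<open>The ideal of the origin shows that real prime ideals exist, so the choice is
    meaningful even if none of them is exceptional.\<close>
  let ?J = "{p :: 'n rpoly. eval_rpoly p (0 :: real ^ 'n) = 0}"
  have "a \<in> ?J" if "sos t" "a\<^sup>2 + t \<in> ?J" for a t
  proof -
    have "(eval_rpoly a (0 :: real ^ 'n))\<^sup>2 + eval_rpoly t 0 = 0" using that(2) by (simp add: eval_rpoly_simps)
    then show ?thesis using sos_eval_nonneg[OF that(1), of 0] by (simp add: add_nonneg_eq_0_iff)
  qed
  then have "real_prime ?J" unfolding real_prime_def is_ideal_def by (auto simp: eval_rpoly_simps)
  then have "\<exists>J :: 'n rpoly set. real_prime J \<and> ((\<exists>J :: 'n rpoly set. real_prime J \<and> exceptional J) \<longrightarrow> exceptional J)"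
    by blast
  from someI_ex[OF this] show ?thesis unfolding test_ideal_def .
qed

lemma test_ideal_ideal: "is_ideal (test_ideal :: 'n::finite rpoly set)"
  and one_notin_test_ideal: "1 \<notin> (test_ideal :: 'n::finite rpoly set)"
  and test_ideal_prime: "a * b \<in> test_ideal \<Longrightarrow> a \<in> test_ideal \<or> b \<in> (test_ideal :: 'n::finite rpoly set)"
  and test_ideal_real: "sos t \<Longrightarrow> a\<^sup>2 + t \<in> test_ideal \<Longrightarrow> a \<in> (test_ideal :: 'n::finite rpoly set)"
  using test_ideal_spec[where ?'n = 'n] unfolding real_prime_def by blast+

lemmas test_idealD = ideal_zero[OF test_ideal_ideal] ideal_add[OF test_ideal_ideal]
  ideal_mult[OF test_ideal_ideal] ideal_diff[OF test_ideal_ideal] ideal_minus[OF test_ideal_ideal]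

\<comment> \<open>The residue ring, its fraction field and the generic point\<close>
quotient_type (overloaded) 'n residue = "'n::finite rpoly" / "\<lambda>x y. x - y \<in> (test_ideal :: 'n rpoly set)"
proof (rule equivpI)
  show "reflp (\<lambda>x y. x - y \<in> test_ideal)" by (simp add: reflp_def test_idealD(1))
  show "symp (\<lambda>x y. x - y \<in> test_ideal)" unfolding symp_def using test_idealD(5) by fastforce
  show "transp (\<lambda>x y. x - y \<in> test_ideal)"
  proof (rule transpI)
    fix x y z :: "'a rpoly" assume "x - y \<in> test_ideal" "y - z \<in> test_ideal"
    from test_idealD(2)[OF this] show "x - z \<in> test_ideal" by simp
  qed
qed

instantiation residue :: (finite) idom
begin

lift_definition zero_residue :: "'a residue" is 0 .
lift_definition one_residue :: "'a residue" is 1 .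
lift_definition plus_residue :: "'a residue \<Rightarrow> 'a residue \<Rightarrow> 'a residue" is "(+)"
proof -
  fix a b c d :: "'a rpoly" assume "a - b \<in> test_ideal" "c - d \<in> test_ideal"
  then have "(a - b) + (c - d) \<in> test_ideal" by (rule test_idealD)
  then show "a + c - (b + d) \<in> test_ideal" by (simp add: algebra_simps)
qed
lift_definition uminus_residue :: "'a residue \<Rightarrow> 'a residue" is uminus
proof -
  fix a b :: "'a rpoly" assume "a - b \<in> test_ideal"
  then have "- (a - b) \<in> test_ideal" by (rule test_idealD)
  then show "- a - - b \<in> test_ideal" by simp
qed
lift_definition minus_residue :: "'a residue \<Rightarrow> 'a residue \<Rightarrow> 'a residue" is "(-)"
proof -
  fix a b c d :: "'a rpoly" assume "a - b \<in> test_ideal" "c - d \<in> test_ideal"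
  then have "(a - b) - (c - d) \<in> test_ideal" by (rule test_idealD)
  moreover have "(a - b) - (c - d) = a - c - (b - d)" by simp
  ultimately show "a - c - (b - d) \<in> test_ideal" by metis
qed
lift_definition times_residue :: "'a residue \<Rightarrow> 'a residue \<Rightarrow> 'a residue" is "(*)"
proof -
  fix a b c d :: "'a rpoly" assume "a - b \<in> test_ideal" "c - d \<in> test_ideal"
  then have "c * (a - b) + b * (c - d) \<in> test_ideal" by (intro test_idealD(2,3))
  then show "a * c - b * d \<in> test_ideal" by (simp add: algebra_simps)
qed

instance
proof
  fix a b c :: "'a residue"
  show "a + b + c = a + (b + c)" by transfer (simp add: algebra_simps test_idealD)
  show "a + b = b + a" by transfer (simp add: algebra_simps test_idealD)
  show "0 + a = a" by transfer (simp add: algebra_simps test_idealD)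
  show "- a + a = 0" by transfer (simp add: algebra_simps test_idealD)
  show "a - b = a + - b" by transfer (simp add: algebra_simps test_idealD)
  show "a * b * c = a * (b * c)" by transfer (simp add: algebra_simps test_idealD)
  show "a * b = b * a" by transfer (simp add: algebra_simps test_idealD)
  show "1 * a = a" by transfer (simp add: algebra_simps test_idealD)
  show "(a + b) * c = a * c + b * c" by transfer (simp add: algebra_simps test_idealD)
  show "a * (b + c) = a * b + a * c" by transfer (simp add: algebra_simps test_idealD)
  show "0 * a = 0" by transfer (simp add: test_idealD)
  show "a * 0 = 0" by transfer (simp add: test_idealD)
  show "(0 :: 'a residue) \<noteq> 1"
  proof transfer
    show "0 - (1 :: 'a rpoly) \<notin> test_ideal"
      using one_notin_test_ideal test_idealD(5)[of "- 1 :: 'a rpoly"] by auto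
  qed
  show "a \<noteq> 0 \<Longrightarrow> b \<noteq> 0 \<Longrightarrow> a * b \<noteq> 0"
    by transfer (use test_ideal_prime in auto)
qed

end

lemma abs_residue_eq_0_iff: "abs_residue p = 0 \<longleftrightarrow> p \<in> test_ideal"
  by (simp add: zero_residue_def residue.abs_eq_iff)

lemma abs_residue_surj: "\<exists>b. a = abs_residue b"
  by (induction a rule: residue.abs_induct) blast

lemma sos_residue:
  fixes s :: "'n::finite residue"
  assumes "sos s"
  shows "\<exists>t. sos t \<and> s = abs_residue t"
  using assms
proof (induction rule: sos.induct)
  case zero
  show ?case by (intro exI[of _ 0]) (simp add: sos.zero zero_residue_def)
next
  case (add_square s a)
  then obtain t where t: "sos t" "s = abs_residue t" by blast
  obtain b where b: "a = abs_residue b" using abs_residue_surj by blast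
  show ?case
    by (intro exI[of _ "b\<^sup>2 + t"])
      (simp add: t b sos.add_square[unfolded power2_eq_square] power2_eq_square times_residue.abs_eq plus_residue.abs_eq)
qed

lemma residue_formally_real:
  fixes a s :: "'n::finite residue"
  assumes "sos s" "a\<^sup>2 + s = 0"
  shows "a = 0"
proof -
  obtain t where t: "sos t" "s = abs_residue t" using sos_residue[OF assms(1)] by blast
  obtain b where b: "a = abs_residue b" using abs_residue_surj by blast
  have "abs_residue (b\<^sup>2 + t) = 0"
    using assms(2) by (simp add: t b power2_eq_square times_residue.abs_eq plus_residue.abs_eq)
  then have "b\<^sup>2 + t \<in> test_ideal" by (simp add: abs_residue_eq_0_iff)
  then have "b \<in> test_ideal" using test_ideal_real t(1) by blast
  then show ?thesis by (simp add: b abs_residue_eq_0_iff)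
qed



text \<open>In a domain, excluding \<open>- 1\<close> as a sum of squares would be too weak:
  clearing denominators in the fraction field turns \<open>- 1 = s\<close> into
  \<open>b\<^sup>2 + t = 0\<close> with \<open>b \<noteq> 0\<close>.\<close>

class formally_real_idom = idom +
  assumes sum_list_squares_eq_0: "a * a + (\<Sum>q\<leftarrow>qs. q * q) = 0 \<Longrightarrow> a = 0"

instance residue :: (finite) formally_real_idom
proof
  fix a :: "'a residue" and qs assume "a * a + (\<Sum>q\<leftarrow>qs. q * q) = 0"
  then show "a = 0" using residue_formally_real[of "\<Sum>q\<leftarrow>qs. q * q" a] sos_iff_sum_list
    by (auto simp: power2_eq_square)
qed

lemma sos_fract:
  assumes "sos (s :: 'a::idom fract)"
  shows "\<exists>t b. sos t \<and> b \<noteq> 0 \<and> s = Fract t (b\<^sup>2)"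
  using assms
proof (induction rule: sos.induct)
  case zero
  show ?case by (intro exI[of _ 0] exI[of _ 1]) (simp add: sos.zero Zero_fract_def)
next
  case (add_square s a)
  then obtain t b where t: "sos t" "b \<noteq> 0" "s = Fract t (b\<^sup>2)" by blast
  obtain c d where c: "a = Fract c d" "d \<noteq> 0" by (cases a) auto
  have "sos ((c * b)\<^sup>2 + d\<^sup>2 * t)" using t by (intro sos.add_square sos_square_mult)
  moreover have "a\<^sup>2 + s = Fract ((c * b)\<^sup>2 + d\<^sup>2 * t) ((d * b)\<^sup>2)"
    using t(2) c(2) by (simp add: t(3) c(1) power2_eq_square algebra_simps)
  ultimately show ?case using t(2) c(2) by (intro exI[of _ "(c * b)\<^sup>2 + d\<^sup>2 * t"] exI[of _ "d * b"]) simp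
qed

instance fract :: (formally_real_idom) formally_real_field
proof
  fix qs :: "'a fract list"
  show "(\<Sum>q\<leftarrow>qs. q * q) \<noteq> - 1"
  proof
    assume *: "(\<Sum>q\<leftarrow>qs. q * q) = - 1"
    have "sos (\<Sum>q\<leftarrow>qs. q * q)" using sos_iff_sum_list by blast
    then obtain t :: 'a and b where t: "sos t" "b \<noteq> 0" "(- 1 :: 'a fract) = Fract t (b\<^sup>2)"
      using sos_fract unfolding * by blast
    then have "- (b * b) = t" by (simp add: One_fract_def eq_fract power2_eq_square)
    then have "b * b + t = 0" by (simp flip: \<open>- (b * b) = t\<close>)
    moreover obtain qs where "t = (\<Sum>q\<leftarrow>qs. q * q)" using t(1) sos_iff_sum_list by blast
    ultimately show False using sum_list_squares_eq_0 t(2) by blast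
  qed
qed

type_synonym 'n rcf = "'n residue fract real_closure"

definition residue_map :: "'n::finite rpoly \<Rightarrow> 'n rcf" where
  "residue_map p = to_real_closure (Fract (abs_residue p) 1)"

lemma ring_morphism_residue_map: "ring_morphism (residue_map :: 'n::finite rpoly \<Rightarrow> 'n rcf)"
proof -
  have "residue_map 1 = (1 :: 'n rcf)"
    using ring_morphismD(1)[OF ring_morphism_to_real_closure]
    by (simp add: residue_map_def flip: one_residue_def One_fract_def)
  moreover have "residue_map (p + q) = residue_map p + residue_map q" for p q :: "'n rpoly"
    by (simp add: residue_map_def plus_residue.abs_eq flip: ring_morphismD(2)[OF ring_morphism_to_real_closure])
  moreover have "residue_map (p * q) = residue_map p * residue_map q" for p q :: "'n rpoly"
    by (simp add: residue_map_def times_residue.abs_eq flip: ring_morphismD(3)[OF ring_morphism_to_real_closure])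
  ultimately show ?thesis by (simp add: ring_morphism_def)
qed

lemma residue_map_eq_0_iff: "residue_map p = 0 \<longleftrightarrow> p \<in> test_ideal"
  by (simp add: residue_map_def to_real_closure_eq_0_iff Zero_fract_def eq_fract abs_residue_eq_0_iff)

text \<open>Carries the real constants through the residue ring and its fraction field. The real
  closure at the top then becomes a \<open>real_algebra_1\<close>, so that \<open>eval_rpoly\<close>
  applies to its points.\<close>

class real_coefficients = comm_ring_1 +
  fixes from_real :: "real \<Rightarrow> 'a"
  assumes from_real_1: "from_real 1 = 1"
    and from_real_add: "from_real (r + s) = from_real r + from_real s"
    and from_real_mult: "from_real (r * s) = from_real r * from_real s"

instantiation residue :: (finite) real_coefficients
begin

definition from_real_residue :: "real \<Rightarrow> 'a residue" where
  "from_real_residue r = abs_residue (Const r)"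

instance
  by standard
    (simp_all add: from_real_residue_def Const_add Const_mult Const_1 plus_residue.abs_eq
      times_residue.abs_eq one_residue_def)

end

instantiation fract :: ("{idom, real_coefficients}") real_coefficients
begin

definition from_real_fract :: "real \<Rightarrow> 'a fract" where
  "from_real_fract r = Fract (from_real r) 1"

instance
  by standard
    (simp_all add: from_real_fract_def from_real_add from_real_mult from_real_1 One_fract_def)

end

instantiation real_closure :: ("{formally_real_field, real_coefficients}") real_algebra_1
begin

definition scaleR_real_closure :: "real \<Rightarrow> 'a real_closure \<Rightarrow> 'a real_closure" where
  "scaleR_real_closure r x = to_real_closure (from_real r) * x"

instance
  by standard
    (simp_all add: scaleR_real_closure_def algebra_simps ring_morphismD[OF ring_morphism_to_real_closure]
      from_real_add from_real_mult from_real_1)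

end

lemma residue_map_Const: "residue_map (Const c) = of_real c"
  by (simp add: residue_map_def of_real_def scaleR_real_closure_def from_real_fract_def from_real_residue_def)

lemma eval_rpoly_generic_point: "eval_rpoly p (\<chi> i. residue_map (Var i)) = residue_map p"
  by (induction p rule: rpoly_induct)
    (simp_all add: eval_rpoly_simps residue_map_Const ring_morphismD[OF ring_morphism_residue_map])

text \<open>The residues of the variables form a zero of \<open>q\<close> over the real closed
  field, and the sign \<open>0\<close> of \<open>q\<close> there is transferred to the
  reals.\<close>

lemma test_ideal_real_zero:
  assumes "q \<in> (test_ideal :: 'n::finite rpoly set)"
  shows "\<exists>x :: real ^ 'n. eval_rpoly q x = 0"
  using real_transfer[of "{q}" "\<chi> i. residue_map (Var i)"] assms
  by (simp add: eval_rpoly_generic_point residue_map_eq_0_iff[THEN iffD2])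

section \<open>Extension of derivations\<close>

text \<open>Here \<open>D\<close> is total but constrained only on the subring \<open>S\<close>.
  Working with subrings avoids closing under inverses at each extension; denominators are cleared by
  \<open>polys_over_division\<close>.\<close>

definition derivation_on :: "'a::comm_ring_1 set \<Rightarrow> ('a \<Rightarrow> 'a) \<Rightarrow> bool" where
  "derivation_on S D \<longleftrightarrow> 1 \<in> S \<and> (\<forall>a\<in>S. \<forall>b\<in>S. a - b \<in> S \<and> a * b \<in> S \<and>
     D (a - b) = D a - D b \<and> D (a * b) = a * D b + b * D a)"

lemma derivation_onD:
  assumes "derivation_on S D"
  shows "1 \<in> S" "0 \<in> S" "D 0 = 0" "D 1 = 0"
    and "a \<in> S \<Longrightarrow> - a \<in> S" "a \<in> S \<Longrightarrow> D (- a) = - D a"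
    and "a \<in> S \<Longrightarrow> b \<in> S \<Longrightarrow> a - b \<in> S" "a \<in> S \<Longrightarrow> b \<in> S \<Longrightarrow> D (a - b) = D a - D b"
    and "a \<in> S \<Longrightarrow> b \<in> S \<Longrightarrow> a + b \<in> S" "a \<in> S \<Longrightarrow> b \<in> S \<Longrightarrow> D (a + b) = D a + D b"
    and "a \<in> S \<Longrightarrow> b \<in> S \<Longrightarrow> a * b \<in> S" "a \<in> S \<Longrightarrow> b \<in> S \<Longrightarrow> D (a * b) = a * D b + b * D a"
proof -
  have diff: "a - b \<in> S" "D (a - b) = D a - D b" if "a \<in> S" "b \<in> S" for a b
    using assms that by (auto simp: derivation_on_def)
  have mult: "a * b \<in> S" "D (a * b) = a * D b + b * D a" if "a \<in> S" "b \<in> S" for a b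
    using assms that by (auto simp: derivation_on_def)
  show 1: "1 \<in> S" using assms by (simp add: derivation_on_def)
  show 0: "0 \<in> S" and D0: "D 0 = 0" using diff[OF 1 1] by simp_all
  show "D 1 = 0" using mult(2)[OF 1 1] by simp
  have m: "- a \<in> S" "D (- a) = - D a" if "a \<in> S" for a using diff[OF 0 that] D0 by simp_all
  show "a \<in> S \<Longrightarrow> - a \<in> S" "a \<in> S \<Longrightarrow> D (- a) = - D a" by (fact m)+
  show "a \<in> S \<Longrightarrow> b \<in> S \<Longrightarrow> a - b \<in> S" "a \<in> S \<Longrightarrow> b \<in> S \<Longrightarrow> D (a - b) = D a - D b" by (fact diff)+
  show "a \<in> S \<Longrightarrow> b \<in> S \<Longrightarrow> a + b \<in> S" "a \<in> S \<Longrightarrow> b \<in> S \<Longrightarrow> D (a + b) = D a + D b"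
    using diff[of a "- b"] m[of b] by simp_all
  show "a \<in> S \<Longrightarrow> b \<in> S \<Longrightarrow> a * b \<in> S" "a \<in> S \<Longrightarrow> b \<in> S \<Longrightarrow> D (a * b) = a * D b + b * D a" by (fact mult)+
qed

lemma derivation_on_sum:
  assumes "derivation_on S D" "\<And>i. i \<in> A \<Longrightarrow> f i \<in> S"
  shows "sum f A \<in> S \<and> D (sum f A) = (\<Sum>i\<in>A. D (f i))"
  using assms(2)
  by (induction A rule: infinite_finite_induct) (simp_all add: derivation_onD[OF assms(1)])

definition polys_over :: "'a::comm_ring_1 set \<Rightarrow> 'a poly set" where
  "polys_over S = {p. \<forall>n. coeff p n \<in> S}"

text \<open>The value that the Leibniz rule forces on the derivative of \<open>poly p x\<close> once
  \<open>x\<close> is given the derivative \<open>v\<close>.\<close>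

definition poly_deriv :: "('a \<Rightarrow> 'a) \<Rightarrow> 'a \<Rightarrow> 'a \<Rightarrow> 'a::idom poly \<Rightarrow> 'a" where
  "poly_deriv D x v p = poly (map_poly D p) x + poly (pderiv p) x * v"

context
  fixes S :: "'a::idom set" and D
  assumes D: "derivation_on S D"
begin

lemma polys_over_closed:
  shows "p \<in> polys_over S \<Longrightarrow> q \<in> polys_over S \<Longrightarrow> p - q \<in> polys_over S"
    and "p \<in> polys_over S \<Longrightarrow> q \<in> polys_over S \<Longrightarrow> p + q \<in> polys_over S"
    and "p \<in> polys_over S \<Longrightarrow> q \<in> polys_over S \<Longrightarrow> p * q \<in> polys_over S"
    and "c \<in> S \<Longrightarrow> p \<in> polys_over S \<Longrightarrow> smult c p \<in> polys_over S"
    and "c \<in> S \<Longrightarrow> monom c n \<in> polys_over S"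
    and "c \<in> S \<Longrightarrow> [:c:] \<in> polys_over S"
    and "p \<in> polys_over S \<Longrightarrow> pderiv p \<in> polys_over S"
proof -
  have "of_nat n \<in> S" for n by (induction n) (simp_all add: derivation_onD[OF D])
  then show "p \<in> polys_over S \<Longrightarrow> pderiv p \<in> polys_over S"
    by (simp add: polys_over_def coeff_pderiv derivation_onD[OF D] del: of_nat_Suc)
  show "p \<in> polys_over S \<Longrightarrow> q \<in> polys_over S \<Longrightarrow> p * q \<in> polys_over S"
    by (simp add: polys_over_def coeff_mult derivation_on_sum[OF D] derivation_onD[OF D])
qed (auto simp: polys_over_def derivation_onD[OF D] coeff_pCons split: nat.splits)

lemma map_poly_derivation:
  assumes "p \<in> polys_over S" "q \<in> polys_over S"
  shows "map_poly D (p - q) = map_poly D p - map_poly D q"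
    and "map_poly D (p * q) = p * map_poly D q + q * map_poly D p"
proof -
  have S: "coeff p n \<in> S" "coeff q n \<in> S" for n using assms by (auto simp: polys_over_def)
  show "map_poly D (p - q) = map_poly D p - map_poly D q"
    by (intro poly_eqI) (simp add: coeff_map_poly derivation_onD[OF D] S)
  show "map_poly D (p * q) = p * map_poly D q + q * map_poly D p"
  proof (intro poly_eqI)
    fix n
    have "coeff (map_poly D (p * q)) n = D (\<Sum>i\<le>n. coeff p i * coeff q (n - i))"
      by (simp add: coeff_map_poly derivation_onD[OF D] coeff_mult)
    also have "\<dots> = (\<Sum>i\<le>n. D (coeff p i * coeff q (n - i)))"
      by (intro derivation_on_sum[OF D, THEN conjunct2] derivation_onD[OF D] S)
    also have "\<dots> = (\<Sum>i\<le>n. coeff p i * D (coeff q (n - i)) + D (coeff p i) * coeff q (n - i))"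
      by (intro sum.cong refl) (simp add: derivation_onD[OF D] S mult.commute)
    also have "\<dots> = coeff (p * map_poly D q + map_poly D p * q) n"
      by (simp add: coeff_mult coeff_map_poly derivation_onD[OF D] sum.distrib)
    finally show "coeff (map_poly D (p * q)) n = coeff (p * map_poly D q + q * map_poly D p) n"
      by (simp add: mult.commute)
  qed
qed

lemma poly_deriv_diff:
  assumes "p \<in> polys_over S" "q \<in> polys_over S"
  shows "poly_deriv D x v (p - q) = poly_deriv D x v p - poly_deriv D x v q"
  by (simp add: poly_deriv_def map_poly_derivation[OF assms] pderiv_diff algebra_simps)

lemma poly_deriv_mult:
  assumes "p \<in> polys_over S" "q \<in> polys_over S"
  shows "poly_deriv D x v (p * q) = poly p x * poly_deriv D x v q + poly q x * poly_deriv D x v p"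
  by (simp add: poly_deriv_def map_poly_derivation[OF assms] pderiv_mult algebra_simps)

lemma poly_deriv_const: "c \<in> S \<Longrightarrow> poly_deriv D x v [:c:] = D c"
  by (simp add: poly_deriv_def map_poly_pCons derivation_onD[OF D])

text \<open>The only obstruction is that an element may have several representations
  \<open>poly p x\<close>; by linearity it is enough to look at representations of \<open>0\<close>,
  which is \<open>wd\<close>.\<close>

lemma derivation_on_adjoin:
  assumes wd: "\<And>p. p \<in> polys_over S \<Longrightarrow> poly p x = 0 \<Longrightarrow> poly_deriv D x v p = 0"
  shows "\<exists>S' D'. derivation_on S' D' \<and> S \<subseteq> S' \<and> x \<in> S' \<and> (\<forall>a\<in>S. D' a = D a) \<and> D' x = v"
proof -
  define S' where "S' = (\<lambda>p. poly p x) ` polys_over S"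
  define D' where "D' y = poly_deriv D x v (SOME p. p \<in> polys_over S \<and> poly p x = y)" for y
  have D': "D' (poly p x) = poly_deriv D x v p" if p: "p \<in> polys_over S" for p
  proof -
    define q where "q = (SOME q. q \<in> polys_over S \<and> poly q x = poly p x)"
    have q: "q \<in> polys_over S" "poly q x = poly p x"
      using someI[of "\<lambda>q. q \<in> polys_over S \<and> poly q x = poly p x" p] p by (auto simp: q_def)
    have "poly_deriv D x v (q - p) = 0" using p q by (intro wd polys_over_closed) auto
    then show ?thesis using poly_deriv_diff[OF q(1) p] by (simp add: D'_def q_def)
  qed
  have "derivation_on S' D'" unfolding derivation_on_def
  proof (intro conjI ballI)
    have 1: "1 \<in> polys_over S" using polys_over_closed(6)[of 1] derivation_onD(1)[OF D] by (simp add: one_pCons)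
    show "1 \<in> S'" unfolding S'_def using 1 by (intro image_eqI[of _ _ 1]) simp_all
    fix a b assume "a \<in> S'" "b \<in> S'"
    then obtain p q where pq: "a = poly p x" "b = poly q x" "p \<in> polys_over S" "q \<in> polys_over S"
      by (auto simp: S'_def)
    have m: "p - q \<in> polys_over S" "p * q \<in> polys_over S" using pq by (simp_all add: polys_over_closed)
    have "poly (p - q) x \<in> S'" "poly (p * q) x \<in> S'" unfolding S'_def using m by blast+
    then show "a - b \<in> S'" "a * b \<in> S'" by (simp_all add: pq)
    show "D' (a - b) = D' a - D' b"
      using D'[OF m(1)] D'[OF pq(3)] D'[OF pq(4)] poly_deriv_diff[OF pq(3,4)] by (simp add: pq)
    show "D' (a * b) = a * D' b + b * D' a"
      using D'[OF m(2)] D'[OF pq(3)] D'[OF pq(4)] poly_deriv_mult[OF pq(3,4)] by (simp add: pq)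
  qed
  moreover have c: "poly [:a:] x = a" "[:a:] \<in> polys_over S" if "a \<in> S" for a
    using that by (simp_all add: polys_over_closed)
  then have "S \<subseteq> S'" unfolding S'_def by force
  moreover have "D' a = D a" if "a \<in> S" for a using D'[OF c(2)[OF that]] that by (simp add: poly_deriv_const)
  moreover have "[:0, 1:] \<in> polys_over S"
    by (auto simp: polys_over_def coeff_pCons derivation_onD[OF D] split: nat.splits)
  moreover from this have "x \<in> S'" "D' x = v"
    using D'[of "[:0,1:]"] unfolding S'_def
    by (force, simp add: poly_deriv_def map_poly_pCons derivation_onD[OF D] pderiv_pCons)
  ultimately show ?thesis by blast
qed

text \<open>Pseudo-division with the factor, the quotient and the remainder all kept over
  \<open>S\<close>, which is only a subring.\<close>

lemma polys_over_division:
  assumes G: "G \<in> polys_over S" "G \<noteq> 0" and p: "p \<in> polys_over S"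
  shows "\<exists>c q r. c \<in> S \<and> c \<noteq> 0 \<and> q \<in> polys_over S \<and> r \<in> polys_over S \<and> smult c p = G * q + r \<and>
    (r = 0 \<or> degree r < degree G)"
  using p
proof (induction "degree p" arbitrary: p rule: less_induct)
  case less
  have z: "0 \<in> polys_over S" by (simp add: polys_over_def derivation_onD[OF D])
  show ?case
  proof (cases "p = 0 \<or> degree p < degree G")
    case True
    then show ?thesis using less.prems z derivation_onD[OF D]
      by (intro exI[of _ 1] exI[of _ 0] exI[of _ p]) auto
  next
    case False
    define m where "m = monom (lead_coeff p) (degree p - degree G)"
    define p1 where "p1 = smult (lead_coeff G) p - G * m"
    have lc: "lead_coeff G \<in> S" "lead_coeff p \<in> S" using G less.prems by (auto simp: polys_over_def)
    have m: "m \<in> polys_over S" unfolding m_def by (rule polys_over_closed(5)[OF lc(2)])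
    have p1: "p1 \<in> polys_over S" unfolding p1_def using m G less.prems lc by (simp add: polys_over_closed)
    have "lead_coeff p \<noteq> 0" using False by simp
    then have m0: "m \<noteq> 0" "degree m = degree p - degree G" unfolding m_def
      by (simp_all only: degree_monom_eq monom_eq_0_iff not_False_eq_True)
    have "degree (G * m) = degree p" using G m0 False by (simp add: degree_mult_eq)
    then have "degree p1 \<le> degree p" unfolding p1_def using G by (intro degree_diff_le) auto
    moreover have "coeff p1 (degree p) = 0"
    proof -
      have "coeff (G * m) (degree p) = lead_coeff (G * m)" using \<open>degree (G * m) = degree p\<close> by simp
      also have "\<dots> = lead_coeff G * lead_coeff p" unfolding lead_coeff_mult m_def lead_coeff_monom by simp
      finally show ?thesis by (simp add: p1_def)
    qed
    ultimately have "p1 = 0 \<or> degree p1 < degree p" using eq_zero_or_degree_less by blast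
    then have "\<exists>c q r. c \<in> S \<and> c \<noteq> 0 \<and> q \<in> polys_over S \<and> r \<in> polys_over S \<and> smult c p1 = G * q + r \<and>
        (r = 0 \<or> degree r < degree G)"
    proof
      assume "p1 = 0"
      then show ?thesis using z derivation_onD[OF D] by (intro exI[of _ 1] exI[of _ 0]) auto
    qed (use less.hyps p1 in blast)
    then obtain c q r where *: "c \<in> S" "c \<noteq> 0" "q \<in> polys_over S" "r \<in> polys_over S" "smult c p1 = G * q + r"
        "r = 0 \<or> degree r < degree G" by blast
    have "smult (c * lead_coeff G) p = smult c p1 + smult c (G * m)"
      by (simp add: p1_def smult_diff_right)
    also have "\<dots> = G * (q + smult c m) + r" by (simp add: * algebra_simps)
    finally show ?thesis using * m lc G
      by (intro exI[of _ "c * lead_coeff G"] exI[of _ "q + smult c m"] exI[of _ r])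
        (simp add: polys_over_closed derivation_onD[OF D])
  qed
qed

end

text \<open>For transcendental \<open>x\<close> any value may be prescribed, and \<open>0\<close> is
  taken. For algebraic \<open>x\<close>, a vanishing polynomial \<open>G\<close> of least degree
  forces the value \<open>v\<close>; its denominator is nonzero because in characteristic zero
  \<open>pderiv G\<close> is a nonzero polynomial of smaller degree. Pseudo-division reduces every
  other relation to \<open>G\<close>.\<close>

lemma derivation_on_extend:
  fixes S :: "'a::field_char_0 set"
  assumes D: "derivation_on S D"
  shows "\<exists>S' D'. derivation_on S' D' \<and> S \<subseteq> S' \<and> x \<in> S' \<and> (\<forall>a\<in>S. D' a = D a)"
proof (cases "\<exists>G\<in>polys_over S. G \<noteq> 0 \<and> poly G x = 0")
  case False
  have "poly_deriv D x 0 p = 0" if "p \<in> polys_over S" "poly p x = 0" for p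
    using False that by (auto simp: poly_deriv_def)
  from derivation_on_adjoin[OF D this] show ?thesis by blast
next
  case True
  then obtain G where G: "G \<in> polys_over S" "G \<noteq> 0" "poly G x = 0"
    and min: "\<And>p. p \<in> polys_over S \<Longrightarrow> p \<noteq> 0 \<Longrightarrow> poly p x = 0 \<Longrightarrow> degree G \<le> degree p"
    using ex_has_least_nat[of "\<lambda>G. G \<in> polys_over S \<and> G \<noteq> 0 \<and> poly G x = 0" _ degree] by blast
  have dG: "degree G \<noteq> 0" using G(2,3) by (metis degree_eq_zeroE pCons_0_0 poly_const_conv)
  then have "pderiv G \<noteq> 0" "degree (pderiv G) < degree G" by (simp_all add: pderiv_eq_0_iff degree_pderiv)
  then have G': "poly (pderiv G) x \<noteq> 0" using min[OF polys_over_closed(7)[OF D G(1)]] by auto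
  define v where "v = - poly (map_poly D G) x / poly (pderiv G) x"
  have DG: "poly_deriv D x v G = 0" using G' by (simp add: poly_deriv_def v_def)
  have "poly_deriv D x v p = 0" if p: "p \<in> polys_over S" "poly p x = 0" for p
  proof -
    obtain c q r where *: "c \<in> S" "c \<noteq> 0" "q \<in> polys_over S" "r \<in> polys_over S" "smult c p = G * q + r"
        "r = 0 \<or> degree r < degree G" using polys_over_division[OF D G(1,2) p(1)] by blast
    have "poly r x = 0" using arg_cong[OF *(5), of "\<lambda>p. poly p x"] p(2) G(3) by simp
    then have "r = 0" using min[OF *(4)] *(6) by force
    then have "[:c:] * p = G * q" using *(5) by simp
    then have "poly_deriv D x v ([:c:] * p) = 0"
      using poly_deriv_mult[OF D G(1) *(3), of x v] DG G(3) by simp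
    then show ?thesis
      using poly_deriv_mult[OF D polys_over_closed(6)[OF D *(1)] p(1), of x v] p(2) *(2) by simp
  qed
  from derivation_on_adjoin[OF D this] show ?thesis by blast
qed

lemma derivation_on_extend_finite:
  fixes S :: "'a::field_char_0 set"
  assumes D: "derivation_on S D" and V: "finite V"
  shows "\<exists>S' D'. derivation_on S' D' \<and> S \<subseteq> S' \<and> V \<subseteq> S' \<and> (\<forall>a\<in>S. D' a = D a)"
  using V
proof (induction V rule: finite_induct)
  case empty
  then show ?case using D by blast
next
  case (insert x V)
  then obtain S1 D1 where 1: "derivation_on S1 D1" "S \<subseteq> S1" "V \<subseteq> S1" "\<forall>a\<in>S. D1 a = D a" by blast
  obtain S2 D2 where 2: "derivation_on S2 D2" "S1 \<subseteq> S2" "x \<in> S2" "\<forall>a\<in>S1. D2 a = D1 a"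
    using derivation_on_extend[OF 1(1), of x] by blast
  then show ?case using 1 by (intro exI[of _ S2] exI[of _ D2]) auto
qed

text \<open>A derivation of the residue field that is trivial on the reals and \<open>1\<close> at \<open>f\<close> contradicts
  the chain rule if all partial derivatives of \<open>f\<close> vanish in the residue field.\<close>

lemma test_ideal_gradient_const:
  fixes f :: "'n::finite rpoly"
  assumes grad: "\<And>i. partial i f \<in> test_ideal"
  shows "\<exists>c. f - Const c \<in> test_ideal"
proof (rule ccontr)
  assume no: "\<nexists>c. f - Const c \<in> test_ideal"
  let ?\<pi> = "residue_map :: 'n rpoly \<Rightarrow> 'n rcf"
  note hom = ring_morphismD[OF ring_morphism_residue_map]
  define t where "t = ?\<pi> f"
  have "t \<noteq> of_real r" for r
  proof
    assume "t = of_real r"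
    then have "?\<pi> (f - Const r) = 0" by (simp add: t_def hom residue_map_Const)
    then show False using no residue_map_eq_0_iff by blast
  qed
  then have trans: "q = 0" if "poly (map_poly of_real q) t = 0" for q using algebraic_over_real that by blast
  let ?R = "range (of_real :: real \<Rightarrow> 'n rcf)"
  have R: "derivation_on ?R (\<lambda>_. 0)" unfolding derivation_on_def
    by (auto simp flip: of_real_diff of_real_mult intro: image_eqI[of _ _ 1])
  \<comment> \<open>Only \<open>p = 0\<close> can vanish at \<open>t\<close>, which is
    transcendental over the reals; therefore the value \<open>1\<close> at \<open>t\<close> is
    admissible.\<close>
  have "poly_deriv (\<lambda>_. 0) t 1 p = 0" if p: "p \<in> polys_over ?R" "poly p t = 0" for p
  proof -
    have "\<forall>n. \<exists>r. coeff p n = of_real r" using p(1) by (auto simp: polys_over_def)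
    then obtain r where r: "\<And>n. coeff p n = of_real (r n)" by metis
    define q where "q = (\<Sum>i\<le>degree p. monom (r i) i)"
    have "coeff q n = r n" for n
      using r[of n] by (cases "n \<le> degree p") (auto simp: q_def coeff_sum when_def coeff_eq_0)
    then have "map_poly of_real q = p" by (intro poly_eqI) (simp add: coeff_map_poly r)
    then show ?thesis using trans[of q] p(2) by (auto simp: poly_deriv_def)
  qed
  from derivation_on_adjoin[OF R this] obtain S0 D0 where
    0: "derivation_on S0 D0" "?R \<subseteq> S0" "t \<in> S0" "\<forall>a\<in>?R. D0 a = 0" "D0 t = 1" by blast
  have "finite (range (\<lambda>i. ?\<pi> (Var i)))" by simp
  from derivation_on_extend_finite[OF 0(1) this] obtain S D where
    S: "derivation_on S D" "S0 \<subseteq> S" "range (\<lambda>i. ?\<pi> (Var i)) \<subseteq> S" "\<forall>a\<in>S0. D a = D0 a" by blast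
  \<comment> \<open>The chain rule: on residues of polynomials, \<open>D\<close> is determined by
    its values on the residues of the variables.\<close>
  have "?\<pi> p \<in> S \<and> D (?\<pi> p) = (\<Sum>i\<in>UNIV. ?\<pi> (partial i p) * D (?\<pi> (Var i)))" for p
  proof (induction p rule: rpoly_induct)
    case (Const c)
    have "of_real c \<in> S0" "D0 (of_real c) = 0" using 0(2,4) by blast+
    then show ?case using S(2,4) by (auto simp: residue_map_Const partial_Const hom)
  next
    case (mult_Var p j)
    have j: "?\<pi> (Var j) \<in> S" using S(3) by blast
    have "D (?\<pi> (p * Var j)) = ?\<pi> p * D (?\<pi> (Var j)) + ?\<pi> (Var j) * D (?\<pi> p)"
      using mult_Var j by (simp add: hom derivation_onD[OF S(1)])
    also have "\<dots> = (\<Sum>i\<in>UNIV. (if i = j then ?\<pi> p * D (?\<pi> (Var i)) else 0)) +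
        (\<Sum>i\<in>UNIV. ?\<pi> (Var j) * (?\<pi> (partial i p) * D (?\<pi> (Var i))))"
      using mult_Var by (simp add: sum_distrib_left)
    also have "\<dots> = (\<Sum>i\<in>UNIV. ?\<pi> (partial i (p * Var j)) * D (?\<pi> (Var i)))"
      unfolding sum.distrib[symmetric]
      by (intro sum.cong refl) (simp add: partial_mult_Var hom algebra_simps)
    finally show ?case using mult_Var j by (simp add: hom derivation_onD[OF S(1)])
  next
    case (add p q)
    then show ?case by (simp add: hom derivation_onD[OF S(1)] partial_add sum.distrib distrib_right)
  qed
  from this[of f] have "D t = 0"
    using grad residue_map_eq_0_iff unfolding t_def by (metis (no_types, lifting) mult_zero_left sum.neutral)
  then show False using 0(3,5) S(4) by simp
qed

lemma real_prime_real_zero: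
  assumes "real_prime J" "q \<in> J"
  shows "\<exists>x :: real ^ 'n::finite. eval_rpoly q x = 0"
proof -
  have "\<not> exceptional (test_ideal :: 'n rpoly set)"
    unfolding exceptional_def using test_ideal_real_zero test_ideal_gradient_const by metis
  then have "\<not> exceptional J" using test_ideal_spec[where ?'n = 'n] assms(1) by blast
  then show ?thesis using assms(2) unfolding exceptional_def by blast
qed

lemma real_prime_gradient_const:
  assumes "real_prime J" "\<And>i. partial i f \<in> J"
  shows "\<exists>c. f - Const c \<in> (J :: 'n::finite rpoly set)"
proof -
  have "\<not> exceptional (test_ideal :: 'n rpoly set)"
    unfolding exceptional_def using test_ideal_real_zero test_ideal_gradient_const by metis
  then have "\<not> exceptional J" using test_ideal_spec[where ?'n = 'n] assms(1) by blast
  then show ?thesis using assms(2) unfolding exceptional_def by blast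
qed

section \<open>Sums of squares modulo the gradient tentacle polynomial\<close>

lemma ring_morphism_Const: "ring_morphism Const"
  by (simp add: ring_morphism_def Const_1 Const_add Const_mult)

lemma sos_norm_sq_vars: "sos norm_sq_vars"
  unfolding norm_sq_vars_def by (intro sos_sum sos_square)

lemma sos_norm_sq_grad: "sos (norm_sq_grad f)"
  unfolding norm_sq_grad_def by (intro sos_sum sos_square)

text \<open>For each single \<open>i\<close> this is the form to which the reality of a prime ideal
  applies; at a real point it forces every partial derivative to vanish along with
  \<open>g\<close>.\<close>

lemma tentacle_eq_square_plus_sos:
  "\<exists>t. sos t \<and> norm_sq_grad f * (1 + norm_sq_vars) = (partial i f)\<^sup>2 + t"
proof -
  define r where "r = (\<Sum>j\<in>UNIV - {i}. (partial j f)\<^sup>2)"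
  have "sos r" unfolding r_def by (intro sos_sum sos_square)
  moreover have "norm_sq_grad f = (partial i f)\<^sup>2 + r"
    unfolding norm_sq_grad_def r_def by (simp add: sum.remove[of UNIV i])
  then have "norm_sq_grad f * (1 + norm_sq_vars) =
      (partial i f)\<^sup>2 + ((partial i f)\<^sup>2 * norm_sq_vars + r * (1 + norm_sq_vars))"
    by (simp add: algebra_simps)
  ultimately show ?thesis
    by (intro exI[of _ "(partial i f)\<^sup>2 * norm_sq_vars + r * (1 + norm_sq_vars)"])
      (simp add: sos_add sos_mult sos_one sos_square_mult sos_norm_sq_vars)
qed

lemma tentacle_ideal_partial:
  assumes J: "real_prime J" and g: "norm_sq_grad f * (1 + norm_sq_vars) \<in> J"
  shows "partial i f \<in> J"
  using tentacle_eq_square_plus_sos[of f i] J g unfolding real_prime_def by metis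

lemma critical_point_if_tentacle_zero:
  fixes x :: "real ^ 'n::finite"
  assumes "eval_rpoly (norm_sq_grad f * (1 + norm_sq_vars)) x = 0"
  shows "complex_point x \<in> gradient_variety f"
proof -
  have "eval_rpoly (partial i f) x = 0" for i
  proof -
    obtain t where t: "sos t" "norm_sq_grad f * (1 + norm_sq_vars) = (partial i f)\<^sup>2 + t"
      using tentacle_eq_square_plus_sos by blast
    have "(eval_rpoly (partial i f) x)\<^sup>2 + eval_rpoly t x = 0"
      using assms unfolding t(2) by (simp add: eval_rpoly_simps)
    then show ?thesis using sos_eval_nonneg[OF t(1), of x] by (simp add: add_nonneg_eq_0_iff)
  qed
  then show ?thesis by (simp add: gradient_variety_def eval_rpoly_complex_point)
qed

text \<open>The residue of \<open>f\<close> at every real prime ideal containing \<open>g\<close> is a nonnegative real \<open>c\<close>: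
  otherwise \<open>g + (f - c)\<^sup>2\<close> would be a member of the ideal without real zeros.\<close>

lemma ex_critical_values:
  fixes f :: "'n::finite rpoly"
  defines "g \<equiv> norm_sq_grad f * (1 + norm_sq_vars)"
  assumes nonneg: "\<forall>x :: real ^ 'n. complex_point x \<in> gradient_variety f \<longrightarrow> 0 \<le> eval_rpoly f x"
  shows "\<exists>cs t k. (\<forall>c\<in>set cs. 0 \<le> c) \<and> sos t \<and> (\<Prod>c\<leftarrow>cs. f - Const c)\<^sup>2 + t = k * g"
proof (rule ccontr)
  assume no: "\<not> ?thesis"
  \<comment> \<open>The multiplicative set generated by all \<open>f - c\<close> with
    \<open>c \<ge> 0\<close>. The negated claim says precisely that no \<open>s\<^sup>2 + t\<close>
    with \<open>s\<close> in \<open>S\<close> is a multiple of \<open>g\<close>, which is the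
    disjointness that \<open>ex_real_prime\<close> requires.\<close>
  define S where "S = {\<Prod>c\<leftarrow>cs. f - Const c | cs. \<forall>c\<in>set cs. 0 \<le> c}"
  define I where "I = range (\<lambda>k. k * g)"
  have "\<exists>J. real_prime J \<and> I \<subseteq> J \<and> J \<inter> S = {}"
  proof (rule ex_real_prime)
    show "is_ideal I" unfolding is_ideal_def I_def
      by (auto simp: distrib_right[symmetric] mult.assoc[symmetric] intro: image_eqI[of _ _ 0])
    show "1 \<in> S" unfolding S_def by (intro CollectI exI[of _ "[]"]) simp
    fix a b :: "'n rpoly" assume "a \<in> S" "b \<in> S"
    then obtain cs ds where "a = (\<Prod>c\<leftarrow>cs. f - Const c)" "\<forall>c\<in>set cs. 0 \<le> c"
      "b = (\<Prod>c\<leftarrow>ds. f - Const c)" "\<forall>c\<in>set ds. 0 \<le> c" by (auto simp: S_def)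
    then show "a * b \<in> S" unfolding S_def by (intro CollectI exI[of _ "cs @ ds"]) auto
  next
    fix s t :: "'n rpoly" assume "s \<in> S" "sos t"
    then show "s\<^sup>2 + t \<notin> I" using no unfolding S_def I_def by blast
  qed
  then obtain J where J: "real_prime J" "I \<subseteq> J" "J \<inter> S = {}" by blast
  have Ji: "is_ideal J" using J(1) by (simp add: real_prime_def)
  have "1 * g \<in> I" unfolding I_def by blast
  then have gJ: "g \<in> J" using J(2) by auto
  then have "partial i f \<in> J" for i using tentacle_ideal_partial[OF J(1)] unfolding g_def by blast
  then obtain c where c: "f - Const c \<in> J" using real_prime_gradient_const[OF J(1)] by blast
  have "c < 0"
  proof (rule ccontr)
    assume "\<not> c < 0"
    then have "f - Const c \<in> S" unfolding S_def by (intro CollectI exI[of _ "[c]"]) simp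
    then show False using c J(3) by blast
  qed
  have "g + (f - Const c) * (f - Const c) \<in> J" using gJ c by (intro ideal_add[OF Ji] ideal_mult[OF Ji])
  from real_prime_real_zero[OF J(1) this] obtain x :: "real ^ 'n" where
    x: "eval_rpoly g x + (eval_rpoly f x - c)\<^sup>2 = 0" by (auto simp: eval_rpoly_simps power2_eq_square)
  have "sos g" unfolding g_def by (intro sos_mult sos_add sos_one sos_norm_sq_grad sos_norm_sq_vars)
  then have "0 \<le> eval_rpoly g x" by (rule sos_eval_nonneg)
  then have "eval_rpoly g x = 0" "eval_rpoly f x = c" using x by (simp_all add: add_nonneg_eq_0_iff)
  then show False using nonneg critical_point_if_tentacle_zero[of f x] \<open>c < 0\<close> unfolding g_def by auto
qed

section \<open>Interpolation and nilpotent summands\<close>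

lemma ex_interpolation:
  fixes \<phi> :: "'a::field \<Rightarrow> 'a"
  assumes "finite A"
  shows "\<exists>L. \<forall>a\<in>A. poly L a = \<phi> a"
  using assms
proof (induction A rule: finite_induct)
  case (insert b A)
  then obtain L where L: "\<forall>a\<in>A. poly L a = \<phi> a" by blast
  define P where "P = (\<Prod>a\<in>A. [:-a, 1:])"
  have P: "poly P a = 0" if "a \<in> A" for a using that insert.hyps by (auto simp: P_def poly_prod)
  have "poly P b \<noteq> 0" using insert.hyps by (auto simp: P_def poly_prod)
  then show ?case using L P
    by (intro exI[of _ "L + smult ((\<phi> b - poly L b) / poly P b) P"]) auto
qed simp

text \<open>The exponent allows for repetitions in \<open>cs\<close>.\<close>

lemma prod_list_linear_dvd_power:
  fixes u :: "'a::field poly"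
  assumes "\<forall>c\<in>set cs. poly u c = 0"
  shows "(\<Prod>c\<leftarrow>cs. [:-c, 1:]) dvd u ^ length cs"
  using assms
proof (induction cs)
  case (Cons c cs)
  then have "[:-c, 1:] dvd u" "(\<Prod>c\<leftarrow>cs. [:-c, 1:]) dvd u ^ length cs" by (auto simp: poly_eq_0_iff_dvd)
  from mult_dvd_mono[OF this] show ?case by (simp del: mult_pCons_left)
qed simp

text \<open>Turns a certificate modulo \<open>g\<close> into one modulo \<open>g ^ N\<close>: the
  \<open>N\<close>-th power of \<open>H\<^sup>2 + t = k * g\<close> again has a square plus a sum of
  squares on the left.\<close>

lemma power_square_plus_sos:
  assumes "sos t"
  shows "\<exists>t'. sos t' \<and> (a\<^sup>2 + t) ^ N = (a ^ N)\<^sup>2 + t'"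
proof (induction N)
  case 0
  then show ?case by (intro exI[of _ 0]) (simp add: sos.zero)
next
  case (Suc N)
  then obtain t' where t': "sos t'" "(a\<^sup>2 + t) ^ N = (a ^ N)\<^sup>2 + t'" by blast
  have "(a\<^sup>2 + t) ^ Suc N = (a ^ Suc N)\<^sup>2 + (a\<^sup>2 * t' + (t * (a ^ N)\<^sup>2 + t * t'))"
    unfolding power_Suc t'(2) by (simp add: algebra_simps power2_eq_square)
  then show ?case
    using t'(1) assms by (intro exI[of _ "a\<^sup>2 * t' + (t * (a ^ N)\<^sup>2 + t * t')"])
      (simp add: sos_add sos_square_mult sos_mult sos_square)
qed

definition sos_mod :: "'a::comm_ring_1 \<Rightarrow> 'a \<Rightarrow> bool" where
  "sos_mod G a \<longleftrightarrow> (\<exists>s p. sos s \<and> a = s + p * G)"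

lemma sos_mod_sos: "sos s \<Longrightarrow> sos_mod G s"
  unfolding sos_mod_def by (intro exI[of _ s] exI[of _ 0]) simp

lemma sos_mod_add: "sos_mod G a \<Longrightarrow> sos_mod G b \<Longrightarrow> sos_mod G (a + b)"
  unfolding sos_mod_def
proof (elim exE conjE)
  fix s p t q assume "sos s" "a = s + p * G" "sos t" "b = t + q * G"
  then show "\<exists>s p. sos s \<and> a + b = s + p * G"
    by (intro exI[of _ "s + t"] exI[of _ "p + q"]) (simp add: sos_add algebra_simps)
qed

lemma sos_mod_mult: "sos c \<Longrightarrow> sos_mod G a \<Longrightarrow> sos_mod G (c * a)"
  unfolding sos_mod_def
proof (elim exE conjE)
  fix s p assume "sos c" "sos s" "a = s + p * G"
  then show "\<exists>s p. sos s \<and> c * a = s + p * G"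
    by (intro exI[of _ "c * s"] exI[of _ "c * p"]) (simp add: sos_mult algebra_simps)
qed

lemma sos_Const: "0 \<le> c \<Longrightarrow> sos (Const c)"
  using sos_square[of "Const (sqrt c)"] by (simp flip: Const_power)

text \<open>\<open>2 \<delta> (\<delta> + y) = (\<delta> + y)\<^sup>2 + (\<delta>\<^sup>2 - y\<^sup>2)\<close>.\<close>

lemma sos_mod_Const_add:
  assumes "0 < \<delta>" "sos_mod G (Const (\<delta>\<^sup>2) - y\<^sup>2)"
  shows "sos_mod G (Const \<delta> + y)"
proof -
  have "sos_mod G (Const (1 / (2 * \<delta>)) * ((Const \<delta> + y)\<^sup>2 + (Const (\<delta>\<^sup>2) - y\<^sup>2)))"
    using assms(1) by (intro sos_mod_mult sos_mod_add[OF sos_mod_sos[OF sos_square] assms(2)] sos_Const) simp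
  moreover have "(Const \<delta> + y)\<^sup>2 + (Const (\<delta>\<^sup>2) - y\<^sup>2) = Const (2 * \<delta>) * (Const \<delta> + y)"
  proof -
    have two: "Const (2 * \<delta>) = Const \<delta> + Const \<delta>" by (simp flip: Const_add)
    show ?thesis unfolding Const_power two by (simp add: algebra_simps power2_eq_square)
  qed
  moreover have "Const (1 / (2 * \<delta>)) * (Const (2 * \<delta>) * (Const \<delta> + y)) = Const \<delta> + y"
    using assms(1) unfolding mult.assoc[symmetric] Const_mult[symmetric] by (simp add: Const_1)
  ultimately show ?thesis by simp
qed

text \<open>By \<open>sos_mod_Const_add\<close>, \<open>\<delta> - y ^ (2 ^ j)\<close> is reduced to
  \<open>\<delta>\<^sup>2 - y ^ (2 ^ Suc j)\<close>. After enough doublings the negated power of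
  \<open>y\<close> alone is a sum of squares modulo \<open>G\<close>, whatever positive constant has
  been reached.\<close>

lemma sos_mod_nilpotent:
  assumes y: "sos_mod G (- ((y ^ m)\<^sup>2))" and "0 < \<delta>"
  shows "sos_mod G (Const \<delta> + y)"
proof -
  have pow: "sos_mod G (- (y ^ (2 ^ Suc m)))"
  proof -
    have "m < 2 ^ m" by (rule less_exp)
    \<comment> \<open>The exponent exceeds \<open>2 * m\<close> by an even number, so the extra
      factor is a square.\<close>
    then have "2 ^ Suc m = (2 ^ m - m) * 2 + m * 2" by (simp add: diff_mult_distrib)
    then have "y ^ (2 ^ Suc m) = (y ^ (2 ^ m - m))\<^sup>2 * (y ^ m)\<^sup>2"
      by (simp only: power_add power_mult)
    then show ?thesis using sos_mod_mult[OF sos_square y] by simp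
  qed
  have "sos_mod G (Const \<delta> - y ^ (2 ^ (Suc m - i)))" if "i \<le> m" "0 < \<delta>" for i \<delta>
    using that
  proof (induction i arbitrary: \<delta>)
    case 0
    then show ?case using sos_mod_add[OF sos_mod_sos[OF sos_Const[of \<delta>]] pow] by simp
  next
    case (Suc i)
    have "sos_mod G (Const (\<delta>\<^sup>2) - y ^ (2 ^ (Suc m - i)))" using Suc by simp
    moreover have "y ^ (2 ^ (Suc m - i)) = (- (y ^ (2 ^ (m - i))))\<^sup>2"
      using Suc.prems(1) by (simp add: Suc_diff_le mult.commute flip: power_mult)
    ultimately show ?case using sos_mod_Const_add[OF Suc.prems(2), of G "- (y ^ (2 ^ (m - i)))"] by simp
  qed
  from this[of m "\<delta>\<^sup>2"] have "sos_mod G (Const (\<delta>\<^sup>2) - y\<^sup>2)" using \<open>0 < \<delta>\<close> by simp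
  then show ?thesis by (rule sos_mod_Const_add[OF \<open>0 < \<delta>\<close>])
qed

lemma sos_mod_tentacle_power:
  fixes f :: "'n::finite rpoly"
  assumes nonneg: "\<forall>x :: real ^ 'n. complex_point x \<in> gradient_variety f \<longrightarrow> 0 \<le> eval_rpoly f x"
    and \<epsilon>: "0 < \<epsilon>"
  shows "sos_mod ((norm_sq_grad f * (1 + norm_sq_vars)) ^ N) (f + Const \<epsilon>)"
proof -
  let ?g = "norm_sq_grad f * (1 + norm_sq_vars)"
  obtain cs t k where cs: "\<forall>c\<in>set cs. 0 \<le> c" and t: "sos t"
    and e: "(\<Prod>c\<leftarrow>cs. f - Const c)\<^sup>2 + t = k * ?g"
    using ex_critical_values[OF nonneg] by blast
  define H where "H = (\<Prod>c\<leftarrow>cs. f - Const c)"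
  obtain t' where t': "sos t'" "(H\<^sup>2 + t) ^ N = (H ^ N)\<^sup>2 + t'" using power_square_plus_sos[OF t] by blast
  have "(H ^ N)\<^sup>2 + t' = k ^ N * ?g ^ N" using t'(2) e by (simp add: H_def power_mult_distrib)
  then have "- ((H ^ N)\<^sup>2) = t' + (- (k ^ N)) * ?g ^ N" by (simp flip: \<open>_ = k ^ N * ?g ^ N\<close>)
  then have HN: "sos_mod (?g ^ N) (- ((H ^ N)\<^sup>2))" unfolding sos_mod_def using t'(1) by blast
  \<comment> \<open>The root is taken of \<open>c + \<epsilon> / 2\<close>, positive because
    \<open>c \<ge> 0\<close>; the other half of \<open>\<epsilon>\<close> is the constant that
    \<open>sos_mod_nilpotent\<close> adds to \<open>\<phi> u\<close>.\<close>
  obtain L where L: "\<forall>c\<in>set cs. poly L c = sqrt (c + \<epsilon> / 2)"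
    using ex_interpolation[of "set cs" "\<lambda>c. sqrt (c + \<epsilon> / 2)"] by auto
  define u where "u = [:\<epsilon> / 2, 1:] - L\<^sup>2"
  have "\<forall>c\<in>set cs. poly u c = 0" using L cs \<epsilon> by (auto simp: u_def)
  then obtain w where w: "u ^ length cs = (\<Prod>c\<leftarrow>cs. [:-c, 1:]) * w"
    using prod_list_linear_dvd_power[of cs u] by (auto elim: dvdE)
  \<comment> \<open>Substitution of \<open>f\<close> for the variable. Since \<open>u\<close>
    vanishes at all \<open>c\<close>, its image has a power divisible by \<open>H\<close>, and
    \<open>- (H ^ N)\<^sup>2\<close> is a sum of squares modulo \<open>g ^ N\<close>.\<close>
  define \<phi> where "\<phi> q = poly (map_poly Const q) f" for q :: "real poly"
  have \<phi>: "ring_morphism \<phi>"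
    by (simp add: ring_morphism_def \<phi>_def map_poly_morphism[OF ring_morphism_Const] Const_1)
  have lin: "\<phi> [:a, 1:] = f + Const a" for a
    by (simp add: \<phi>_def map_poly_pCons Const_0 Const_1)
  have "\<phi> (\<Prod>c\<leftarrow>cs. [:-c, 1:]) = H" unfolding H_def
    by (induction cs) (simp_all add: ring_morphismD[OF \<phi>] lin Const_minus del: mult_pCons_left)
  then have "\<phi> u ^ length cs = H * \<phi> w"
    using arg_cong[OF w, of \<phi>] by (simp add: ring_morphismD[OF \<phi>])
  then have "\<phi> u ^ (length cs * N) = H ^ N * \<phi> w ^ N" by (simp add: power_mult power_mult_distrib)
  then have "- ((\<phi> u ^ (length cs * N))\<^sup>2) = (\<phi> w ^ N)\<^sup>2 * - ((H ^ N)\<^sup>2)"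
    by (simp add: power_mult_distrib mult.commute)
  then have "sos_mod (?g ^ N) (- ((\<phi> u ^ (length cs * N))\<^sup>2))" using sos_mod_mult[OF sos_square HN] by simp
  from sos_mod_nilpotent[OF this, of "\<epsilon> / 2"] have "sos_mod (?g ^ N) (Const (\<epsilon> / 2) + \<phi> u)" using \<epsilon> by simp
  from sos_mod_add[OF sos_mod_sos[OF sos_square] this, of "\<phi> L"]
  have "sos_mod (?g ^ N) ((\<phi> L)\<^sup>2 + (Const (\<epsilon> / 2) + \<phi> u))" .
  moreover have "(\<phi> L)\<^sup>2 + (Const (\<epsilon> / 2) + \<phi> u) = f + Const \<epsilon>"
  proof -
    have "\<phi> u = f + Const (\<epsilon> / 2) - (\<phi> L)\<^sup>2" by (simp add: u_def ring_morphismD[OF \<phi>] lin)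
    moreover have "Const \<epsilon> = Const (\<epsilon> / 2) + (Const (\<epsilon> / 2) :: 'n rpoly)" by (simp flip: Const_add)
    ultimately show ?thesis by simp
  qed
  ultimately show ?thesis by simp
qed

lemma tentacle_power_in_ideal_power:
  "p * (norm_sq_grad f * (1 + norm_sq_vars)) ^ N \<in> ideal_power (gradient_ideal f) N"
proof -
  interpret Modules.module "(*) :: 'a rpoly \<Rightarrow> 'a rpoly \<Rightarrow> 'a rpoly" by (rule module_times)
  let ?g = "norm_sq_grad f * (1 + norm_sq_vars)"
  have "?g = (\<Sum>i\<in>UNIV. (partial i f * (1 + norm_sq_vars)) * partial i f)"
    unfolding norm_sq_grad_def sum_distrib_right
    by (intro sum.cong refl) (simp only: power2_eq_square mult.assoc mult.commute[of "1 + norm_sq_vars"])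
  also have "\<dots> \<in> gradient_ideal f" unfolding gradient_ideal_def ideal_gen_def
    by (intro span_sum span_scale span_base) auto
  \<comment> \<open>As \<open>g\<close> itself lies in the gradient ideal, its \<open>N\<close>-th
    power is one of the products that generate the power of the ideal, with all factors
    equal.\<close>
  finally have "(\<Prod>k<N. ?g) \<in> {(\<Prod>k<N. h k) | h. \<forall>k<N. h k \<in> gradient_ideal f}" by blast
  from span_scale[OF span_base[OF this], of p] have "p * (\<Prod>k<N. ?g) \<in> ideal_power (gradient_ideal f) N"
    unfolding ideal_power_def ideal_gen_def .
  then show ?thesis by (simp only: prod_constant card_lessThan)
qed

theorem corollary47:
  fixes f :: "'n::finite rpoly"
  assumes "\<forall>x :: real ^ 'n. complex_point x \<in> gradient_variety f \<longrightarrow> 0 \<le> eval_rpoly f x"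
  shows "(\<forall>\<epsilon>::real. \<forall>N::nat. \<epsilon> > 0 \<longrightarrow> N \<ge> 1 \<longrightarrow>
            (\<exists>s p. sum_of_squares s \<and>
              f + Const \<epsilon> = s + p * (norm_sq_grad f * (1 + norm_sq_vars)) ^ N))
       \<and> (\<forall>\<epsilon>::real. \<forall>N::nat. \<epsilon> > 0 \<longrightarrow> N \<ge> 1 \<longrightarrow>
            (\<exists>s. sum_of_squares s \<and>
              f + Const \<epsilon> \<in> (\<lambda>h. s + h) ` ideal_power (gradient_ideal f) N))"
proof (rule conjI; intro allI impI)
  fix \<epsilon> :: real and N :: nat
  assume "\<epsilon> > 0"
  then show *: "\<exists>s p. sum_of_squares s \<and> f + Const \<epsilon> = s + p * (norm_sq_grad f * (1 + norm_sq_vars)) ^ N"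
    using sos_mod_tentacle_power[OF assms] by (simp add: sos_mod_def sum_of_squares_iff_sos)
  then show "\<exists>s. sum_of_squares s \<and> f + Const \<epsilon> \<in> (\<lambda>h. s + h) ` ideal_power (gradient_ideal f) N"
    using tentacle_power_in_ideal_power[of _ f N] by blast
qed

end
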